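(* Let $(\Omega,\mathcal{F},\mathbb{P})$ be a complete probability space, $t_0<T$, $x_0$ a random variable and $a,b$ stochastic processes on $[t_0,T]$, and let $x(t,\omega)=x_0(\omega)\mathrm{e}^{\int_{t_0}^t a(s,\omega)\mathrm{d} s}+\int_{t_0}^t b(s,\omega)\mathrm{e}^{\int_s^t a(r,\omega)\mathrm{d} r}\mathrm{d} s$. Assume: (H1) $a,b\in \mathrm{L}^2([t_0,T]\times\Omega)$ and $x_0\in \mathrm{L}^2(\Omega)$; (H2) for every $N\ge1$, $x_0$, $\eta_1$ and $(\xi_1,\ldots,\xi_N,\eta_2,\ldots,\eta_N)$ are absolutely continuous and independent; (H3) the density $f_{\eta_1}$ of $\eta_1$ is Lipschitz on $\mathbb{R}$; (H4) $\xi_1,\xi_2,\ldots$ have support in $[-A,A]$ for some $A>0$, and $\psi_1>0$ on $(t_0,T)$. Then for each fixed $t\in(t_0,T]$, the sequence \[ f_1^N(x,t)=\int_{\mathbb{R}^{2N}} f_0\Big(x\,\mathrm{e}^{-K_a(t,\pmb{\xi}_N)}-\int_{t_0}^t S_b(s,\pmb{\eta}_N)\mathrm{e}^{-K_a(s,\pmb{\xi}_N)}\,\mathrm{d} s\Big)f_{\pmb{\xi}_N,\pmb{\eta}_N}(\pmb{\xi}_N,\pmb{\eta}_N)\,\mathrm{e}^{-K_a(t,\pmb{\xi}_N)}\,\mathrm{d} \pmb{\xi}_N\,\mathrm{d} \pmb{\eta}_N \] (where $f_0$ is the density of $x_0$) converges in $\mathrm{L}^\infty(J)$, for every bounded set $J\subseteq\mathbb{R}$,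 to a probability density $f_1(\cdot,t)$ of $x(t,\cdot)$.
   Context: Karhunen–Loève expansions: for $a\in \mathrm{L}^2([t_0,T]\times\Omega)$ write $a(t,\omega)=\mu_a(t)+\sum_{j=1}^\infty\sqrt{\nu_j}\,\phi_j(t)\xi_j(\omega)$ (convergence in $\mathrm{L}^2([t_0,T]\times\Omega)$), where $\mu_a(t)=\mathbb{E}[a(t)]$, $\{(\nu_j,\phi_j)\}$ are the (nonnegative) eigenvalue/eigenfunction pairs of the covariance operator $\mathcal{C}f(t)=\int_{t_0}^T\mathrm{Cov}[a(t),a(s)]f(s)\,\mathrm{d} s$ on $\mathrm{L}^2([t_0,T])$ with $\{\phi_j\}$ an orthonormal basis, and $\xi_j$ are zero-mean, unit-variance, pairwise uncorrelated random variables. Similarly $b(t,\omega)=\mu_b(t)+\sum_{i=1}^\infty\sqrt{\gamma_i}\,\psi_i(t)\eta_i(\omega)$; the condition $\psi_1>0$ presupposes that $b$ has at least one nonzero eigenvalue (i.e. $b(t,\omega)\ne\mu_b(t)$), with $\gamma_1>0$. Pairs may be enumerated in any order; if only finitely many eigenvalues are nonzero, vectors stop at that number. $\pmb{\xi}_N=(\xi_1,\ldots,\xi_N)$, $\pmb{\eta}_N=(\eta_1,\ldots,\eta_N)$, $K_a(t,\pmb{\xi}_N)=\int_{t_0}^t\big(\mu_a(s)+\sum_{j=1}^N\sqrt{\nu_j}\phi_j(s)\xi_j\big)\mathrm{d} s$, $S_b(s,\pmb{\eta}_N)=\mu_b(s)+\sum_{i=1}^N\sqrt{\gamma_i}\psi_i(s)\eta_i$,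 and $f_{\pmb{\xi}_N,\pmb{\eta}_N}$ is the joint density of $(\xi_1,\ldots,\xi_N,\eta_1,\ldots,\eta_N)$. (Under the hypotheses this $f_1^N$ equals, via a change of variables isolating $\eta_1$, an integral expression involving $f_{\eta_1}$.) *)

theory Defs
  imports "HOL-Probability.Probability"
begin

definition mean_fun :: "'w measure \<Rightarrow> (real \<Rightarrow> 'w \<Rightarrow> real) \<Rightarrow> real \<Rightarrow> real" where
  "mean_fun M a t = (\<integral>w. a t w \<partial>M)"

definition cov_fun :: "'w measure \<Rightarrow> (real \<Rightarrow> 'w \<Rightarrow> real) \<Rightarrow> real \<Rightarrow> real \<Rightarrow> real" where
  "cov_fun M a t s = (\<integral>w. (a t w - mean_fun M a t) * (a s w - mean_fun M a s) \<partial>M)"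

definition time_prod :: "real \<Rightarrow> real \<Rightarrow> 'w measure \<Rightarrow> (real \<times> 'w) measure" where
  "time_prod t0 T M = restrict_space lborel {t0..T} \<Otimes>\<^sub>M M"

definition L2_process :: "'w measure \<Rightarrow> real \<Rightarrow> real \<Rightarrow> (real \<Rightarrow> 'w \<Rightarrow> real) \<Rightarrow> bool" where
  "L2_process M t0 T a \<longleftrightarrow>
     (\<lambda>(t,w). a t w) \<in> borel_measurable (time_prod t0 T M) \<and>
     integrable (time_prod t0 T M) (\<lambda>(t,w). (a t w)\<^sup>2)"

definition L2_interval :: "real \<Rightarrow> real \<Rightarrow> (real \<Rightarrow> real) \<Rightarrow> bool" where
  "L2_interval t0 T f \<longleftrightarrow> f \<in> borel_measurable lborel \<and> set_integrable lborel {t0..T} (\<lambda>s. (f s)\<^sup>2)"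

text \<open>Indices of the (nonzero-eigenvalue) Karhunen-Loeve terms: 1,...,n (n may be infinite),
  and those among the first N.\<close>
definition KL_idx :: "enat \<Rightarrow> nat set" where
  "KL_idx n = {j. 1 \<le> j \<and> enat j \<le> n}"

definition KL_idxN :: "enat \<Rightarrow> nat \<Rightarrow> nat set" where
  "KL_idxN n N = {j. 1 \<le> j \<and> j \<le> N \<and> enat j \<le> n}"

text \<open>Karhunen-Loeve expansion of a: nu j > 0 (j in KL_idx n) are all nonzero eigenvalues of the
  covariance operator (with multiplicity), phi j orthonormal eigenfunctions which, together with
  an orthonormal basis of the kernel, form an orthonormal basis of L2([t0,T]); xi j zero-mean,
  unit-variance, pairwise uncorrelated; the expansion converges in L2([t0,T] x Omega).\<close>
definition KL_expansion :: "'w measure \<Rightarrow> real \<Rightarrow> real \<Rightarrow> (real \<Rightarrow> 'w \<Rightarrow> real) \<Rightarrow> enat \<Rightarrow>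
    (nat \<Rightarrow> real) \<Rightarrow> (nat \<Rightarrow> real \<Rightarrow> real) \<Rightarrow> (nat \<Rightarrow> 'w \<Rightarrow> real) \<Rightarrow> bool" where
  "KL_expansion M t0 T a n \<nu> \<phi> \<xi> \<longleftrightarrow>
     (\<forall>j\<in>KL_idx n. 0 < \<nu> j \<and> L2_interval t0 T (\<phi> j)) \<and>
     (\<forall>i\<in>KL_idx n. \<forall>j\<in>KL_idx n.
        (\<integral>s\<in>{t0..T}. \<phi> i s * \<phi> j s \<partial>lborel) = (if i = j then 1 else 0)) \<and>
     (\<forall>j\<in>KL_idx n. AE t in lborel. t \<in> {t0..T} \<longrightarrow>
        (\<integral>s\<in>{t0..T}. cov_fun M a t s * \<phi> j s \<partial>lborel) = \<nu> j * \<phi> j t) \<and>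
     (\<forall>f. L2_interval t0 T f \<and> (\<forall>j\<in>KL_idx n. (\<integral>s\<in>{t0..T}. f s * \<phi> j s \<partial>lborel) = 0) \<longrightarrow>
        (AE t in lborel. t \<in> {t0..T} \<longrightarrow> (\<integral>s\<in>{t0..T}. cov_fun M a t s * f s \<partial>lborel) = 0)) \<and>
     (\<forall>j\<in>KL_idx n. \<xi> j \<in> borel_measurable M \<and> integrable M (\<lambda>w. (\<xi> j w)\<^sup>2) \<and>
        (\<integral>w. \<xi> j w \<partial>M) = 0 \<and> (\<integral>w. (\<xi> j w)\<^sup>2 \<partial>M) = 1) \<and>
     (\<forall>i\<in>KL_idx n. \<forall>j\<in>KL_idx n. i \<noteq> j \<longrightarrow> (\<integral>w. \<xi> i w * \<xi> j w \<partial>M) = 0) \<and>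
     ((\<lambda>N. \<integral>\<^sup>+ (t,w). ennreal ((a t w - mean_fun M a t
          - (\<Sum>j\<in>KL_idxN n N. sqrt (\<nu> j) * \<phi> j t * \<xi> j w))\<^sup>2) \<partial>time_prod t0 T M)
       \<longlonglongrightarrow> 0)"

text \<open>Mutual independence of three random variables with (possibly) different value spaces;
  this is the definition of indep_vars written out for three variables.\<close>
definition indep3 :: "'w measure \<Rightarrow> 'a measure \<Rightarrow> ('w \<Rightarrow> 'a) \<Rightarrow> 'b measure \<Rightarrow> ('w \<Rightarrow> 'b)
    \<Rightarrow> 'c measure \<Rightarrow> ('w \<Rightarrow> 'c) \<Rightarrow> bool" where
  "indep3 M Ma X Mb Y Mc Z \<longleftrightarrow>
     X \<in> measurable M Ma \<and> Y \<in> measurable M Mb \<and> Z \<in> measurable M Mc \<and>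
     prob_space.indep_sets M
       (\<lambda>i::nat. if i = 0 then {X -` A \<inter> space M | A. A \<in> sets Ma}
                 else if i = 1 then {Y -` A \<inter> space M | A. A \<in> sets Mb}
                 else {Z -` A \<inter> space M | A. A \<in> sets Mc}) {0, 1, 2}"

definition xieta_vec :: "(nat \<Rightarrow> 'w \<Rightarrow> real) \<Rightarrow> (nat \<Rightarrow> 'w \<Rightarrow> real) \<Rightarrow> (nat + nat) set
    \<Rightarrow> 'w \<Rightarrow> (nat + nat) \<Rightarrow> real" where
  "xieta_vec \<xi> \<eta> D w = (\<lambda>k\<in>D. case k of Inl j \<Rightarrow> \<xi> j w | Inr i \<Rightarrow> \<eta> i w)"

definition RN :: "(nat + nat) set \<Rightarrow> ((nat + nat) \<Rightarrow> real) measure" where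
  "RN D = PiM D (\<lambda>_. lborel)"

definition idx_full :: "enat \<Rightarrow> enat \<Rightarrow> nat \<Rightarrow> (nat + nat) set" where
  "idx_full na nb N = Inl ` KL_idxN na N \<union> Inr ` KL_idxN nb N"

definition idx_rest :: "enat \<Rightarrow> enat \<Rightarrow> nat \<Rightarrow> (nat + nat) set" where
  "idx_rest na nb N = Inl ` KL_idxN na N \<union> Inr ` (KL_idxN nb N - {1})"

definition K_a :: "'w measure \<Rightarrow> (real \<Rightarrow> 'w \<Rightarrow> real) \<Rightarrow> real \<Rightarrow> enat \<Rightarrow> (nat \<Rightarrow> real)
    \<Rightarrow> (nat \<Rightarrow> real \<Rightarrow> real) \<Rightarrow> nat \<Rightarrow> real \<Rightarrow> ((nat + nat) \<Rightarrow> real) \<Rightarrow> real" where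
  "K_a M a t0 na \<nu> \<phi> N t z =
     (LBINT s=t0..t. mean_fun M a s + (\<Sum>j\<in>KL_idxN na N. sqrt (\<nu> j) * \<phi> j s * z (Inl j)))"

definition S_b :: "'w measure \<Rightarrow> (real \<Rightarrow> 'w \<Rightarrow> real) \<Rightarrow> enat \<Rightarrow> (nat \<Rightarrow> real)
    \<Rightarrow> (nat \<Rightarrow> real \<Rightarrow> real) \<Rightarrow> nat \<Rightarrow> real \<Rightarrow> ((nat + nat) \<Rightarrow> real) \<Rightarrow> real" where
  "S_b M b nb \<gamma> \<psi> N s z =
     mean_fun M b s + (\<Sum>i\<in>KL_idxN nb N. sqrt (\<gamma> i) * \<psi> i s * z (Inr i))"

text \<open>The approximating densities f_1^N(x,t), with f0 the density of x0 and g the joint density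
  of (xi_N, eta_N).\<close>
definition f1N :: "'w measure \<Rightarrow> real \<Rightarrow> (real \<Rightarrow> 'w \<Rightarrow> real) \<Rightarrow> (real \<Rightarrow> 'w \<Rightarrow> real)
    \<Rightarrow> enat \<Rightarrow> (nat \<Rightarrow> real) \<Rightarrow> (nat \<Rightarrow> real \<Rightarrow> real)
    \<Rightarrow> enat \<Rightarrow> (nat \<Rightarrow> real) \<Rightarrow> (nat \<Rightarrow> real \<Rightarrow> real)
    \<Rightarrow> (real \<Rightarrow> real) \<Rightarrow> (nat \<Rightarrow> ((nat + nat) \<Rightarrow> real) \<Rightarrow> real) \<Rightarrow> nat \<Rightarrow> real \<Rightarrow> real \<Rightarrow> real" where
  "f1N M t0 a b na \<nu> \<phi> nb \<gamma> \<psi> f0 g N x t =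
     (\<integral>z. f0 (x * exp (- K_a M a t0 na \<nu> \<phi> N t z)
              - (LBINT s=t0..t. S_b M b nb \<gamma> \<psi> N s z * exp (- K_a M a t0 na \<nu> \<phi> N s z)))
          * g N z * exp (- K_a M a t0 na \<nu> \<phi> N t z) \<partial>RN (idx_full na nb N))"

definition sol :: "('w \<Rightarrow> real) \<Rightarrow> (real \<Rightarrow> 'w \<Rightarrow> real) \<Rightarrow> (real \<Rightarrow> 'w \<Rightarrow> real) \<Rightarrow> real
    \<Rightarrow> real \<Rightarrow> 'w \<Rightarrow> real" where
  "sol x0 a b t0 t w = x0 w * exp (LBINT s=t0..t. a s w)
     + (LBINT s=t0..t. b s w * exp (LBINT r=s..t. a r w))"

end

theory Submission
  imports Defs
begin

text \<open>
  Put \<open>K s = \<integral>a\<close> over \<open>[t0,s]\<close>, \<open>C = sqrt \<gamma>\<^sub>1 \<integral>\<psi>\<^sub>1 e\<^bsup>-K\<^esup>\<close> and \<open>R = \<integral>(b - sqrt \<gamma>\<^sub>1 \<psi>\<^sub>1 \<eta>\<^sub>1) e\<^bsup>-K\<^esup>\<close>, so that the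
  solution is \<open>e\<^bsup>K t\<^esup> (x0 + R + \<eta>\<^sub>1 C)\<close>, and let \<open>K\<^sub>N, C\<^sub>N, R\<^sub>N\<close> be the same quantities for the truncated
  expansions. Independence and an affine change of variables in \<open>\<eta>\<^sub>1\<close> turn \<open>f\<^sub>1\<^sup>N(x,t)\<close> into the expectation
  of \<open>f\<^sub>\<eta>((x e\<^bsup>-K\<^sub>N\<^esup> - R\<^sub>N - x0) / C\<^sub>N) e\<^bsup>-K\<^sub>N\<^esup> / C\<^sub>N\<close>. By orthonormality of the eigenfunctions,
  boundedness of the \<open>\<xi>\<^sub>j\<close> and summability of the \<open>\<nu>\<^sub>j\<close>, the truncations of \<open>a\<close> are bounded in \<open>L\<^sup>1\<close>
  uniformly in \<open>N\<close> and \<open>\<omega>\<close>; hence \<open>C\<^sub>N\<close> is bounded away from zero. Since a Lipschitz density is bounded,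
  the integrand differs from its limit by at most a multiple of
  \<open>(1 + |x0| + \<integral>|b| + |\<eta>\<^sub>1|) \<integral>|a\<^sub>N - a| + \<integral>|b\<^sub>N - b|\<close>, uniformly for bounded \<open>x\<close>, and this tends to zero
  in mean by Cauchy-Schwarz. The truncated solutions converge to the solution in \<open>L\<^sup>1\<close>, so testing against
  compactly supported Lipschitz functions identifies the limit as the density of the solution; the
  independence of \<open>\<eta>\<^sub>1\<close> from the full limit is never needed.
\<close>

section \<open>Pathwise estimates\<close>

text \<open>The obstacle is that \<open>f0\<close> is merely a density: with no continuity to use,
  the integrals defining \<open>f1N\<close> cannot be compared for different \<open>N\<close>.
  Exchanging the roles of \<open>x0\<close> and \<open>\<eta> 1\<close> moves every
  \<open>N\<close>-dependent quantity into the argument of the Lipschitz \<open>f\<eta>1\<close> and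
  into an explicit weight. The price is a division by the coefficient of \<open>\<eta> 1\<close>,
  and the positivity of \<open>\<psi> 1\<close> together with the bounded \<open>\<xi> j\<close>
  pays for it. The working norm is that of L1 in time: it controls exponents and source integrals
  path by path, and it follows from the L2 statements of the expansions because the interval is
  finite. Paths are therefore treated as integrable functions on the whole line, cut off outside the
  open interval from \<open>t0\<close> to \<open>t\<close>, and the estimates of this first part
  involve no probability. Comparing a truncation with the limit costs products of random factors
  with the L1 error of \<open>a\<close>, so the passage to the mean consumes second moments of
  \<open>x0\<close>, of \<open>\<eta> 1\<close> and of the norm of \<open>b\<close>.\<close>

definition prim :: "(real \<Rightarrow> real) \<Rightarrow> real \<Rightarrow> real" where
  "prim \<alpha> s = (\<integral>r. (if r < s then \<alpha> r else 0) \<partial>lborel)"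

text \<open>The source \<open>\<beta>\<close> integrated against the integrating factor. The
  \<open>R\<close> and \<open>C\<close> of the overview are its values at two different sources, so
  one set of bounds and one difference estimate serve both.\<close>

definition wint :: "(real \<Rightarrow> real) \<Rightarrow> (real \<Rightarrow> real) \<Rightarrow> real" where
  "wint \<alpha> \<beta> = (\<integral>s. \<beta> s * exp (- prim \<alpha> s) \<partial>lborel)"

lemma integrable_cut:
  fixes \<alpha> :: "real \<Rightarrow> real"
  assumes "integrable lborel \<alpha>"
  shows "integrable lborel (\<lambda>r. if r < s then \<alpha> r else 0)"
proof -
  have [measurable]: "\<alpha> \<in> borel_measurable lborel" using assms by auto
  show ?thesis by (rule Bochner_Integration.integrable_bound[OF assms]) auto
qed

lemma measurable_prim[measurable]:
  assumes [measurable]: "\<alpha> \<in> borel_measurable lborel"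
  shows "prim \<alpha> \<in> borel_measurable lborel"
  unfolding prim_def by measurable

lemma prim_diff:
  assumes "integrable lborel \<alpha>" "integrable lborel \<alpha>'"
  shows "\<bar>prim \<alpha> s - prim \<alpha>' s\<bar> \<le> (\<integral>r. \<bar>\<alpha> r - \<alpha>' r\<bar> \<partial>lborel)"
proof -
  have "prim \<alpha> s - prim \<alpha>' s = (\<integral>r. (if r < s then \<alpha> r - \<alpha>' r else 0) \<partial>lborel)"
    unfolding prim_def
    by (subst Bochner_Integration.integral_diff[symmetric])
       (auto intro!: integrable_cut assms Bochner_Integration.integral_cong)
  also have "\<bar>\<dots>\<bar> \<le> (\<integral>r. \<bar>if r < s then \<alpha> r - \<alpha>' r else 0\<bar> \<partial>lborel)"
    by (rule integral_abs_bound)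
  also have "\<dots> \<le> (\<integral>r. \<bar>\<alpha> r - \<alpha>' r\<bar> \<partial>lborel)"
    using assms by (intro integral_mono integrable_abs integrable_cut) auto
  finally show ?thesis .
qed

text \<open>Convexity is enough: \<open>1 + u \<le> exp u\<close> at \<open>u = x - y\<close>,
  scaled by \<open>exp (-x)\<close>, gives a one-sided bound for \<open>x \<le> y\<close>, and
  symmetry does the rest.\<close>

lemma exp_diff_bound:
  fixes x y \<kappa> :: real
  assumes "\<bar>x\<bar> \<le> \<kappa>" "\<bar>y\<bar> \<le> \<kappa>"
  shows "\<bar>exp (-x) - exp (-y)\<bar> \<le> exp \<kappa> * \<bar>x - y\<bar>"
proof -
  have *: "exp (-x) - exp (-y) \<le> exp \<kappa> * \<bar>x - y\<bar>" if "x \<le> y" "\<bar>x\<bar> \<le> \<kappa>" for x y :: real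
  proof -
    have "1 + (x - y) \<le> exp (x - y)" by (rule exp_ge_add_one_self)
    then have "1 - exp (x - y) \<le> y - x" by linarith
    then have "exp (-x) * (1 - exp (x - y)) \<le> exp (-x) * (y - x)"
      by (intro mult_left_mono) auto
    also have "\<dots> \<le> exp \<kappa> * (y - x)"
      using that by (intro mult_right_mono) auto
    finally show ?thesis using that by (simp add: algebra_simps flip: exp_add)
  qed
  show ?thesis
  proof (cases "x \<le> y")
    case True
    then have "exp (-y) \<le> exp (-x)" by simp
    then show ?thesis using *[of x y] True assms by auto
  next
    case False
    then have "exp (-x) \<le> exp (-y)" by simp
    then show ?thesis using *[of y x] False assms by (auto simp: abs_minus_commute)
  qed
qed

lemma prim_abs_le:
  assumes "integrable lborel \<alpha>"
  shows "\<bar>prim \<alpha> s\<bar> \<le> (\<integral>r. \<bar>\<alpha> r\<bar> \<partial>lborel)"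
  using prim_diff[OF assms, of "\<lambda>_. 0" s] by (simp add: prim_def)

lemma wint_integrable:
  assumes a: "integrable lborel \<alpha>" and b: "integrable lborel \<beta>"
  shows "integrable lborel (\<lambda>s. \<beta> s * exp (- prim \<alpha> s))"
proof -
  define \<kappa> where "\<kappa> = (\<integral>r. \<bar>\<alpha> r\<bar> \<partial>lborel)"
  have k: "\<bar>prim \<alpha> s\<bar> \<le> \<kappa>" for s unfolding \<kappa>_def by (rule prim_abs_le[OF a])
  have [measurable]: "\<alpha> \<in> borel_measurable lborel" "\<beta> \<in> borel_measurable lborel" using a b by auto
  have "integrable lborel (\<lambda>s. exp \<kappa> * \<beta> s)" using b by simp
  then show ?thesis
  proof (rule Bochner_Integration.integrable_bound)
    have "exp (- prim \<alpha> s) \<le> exp \<kappa>" for s using k[of s] by (simp add: abs_le_iff)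
    then show "AE s in lborel. norm (\<beta> s * exp (- prim \<alpha> s)) \<le> norm (exp \<kappa> * \<beta> s)"
      by (intro AE_I2) (simp add: abs_mult mult.commute[of "\<bar>\<beta> _\<bar>"] mult_right_mono del: exp_le_cancel_iff)
  qed auto
qed

lemma wint_add:
  assumes a: "integrable lborel \<alpha>" and b: "integrable lborel \<beta>" "integrable lborel q"
  shows "wint \<alpha> (\<lambda>s. \<beta> s + y * q s) = wint \<alpha> \<beta> + y * wint \<alpha> q"
  unfolding wint_def using wint_integrable[OF a b(1)] wint_integrable[OF a b(2)]
  by (simp add: distrib_right mult.assoc)

lemma wint_bound:
  assumes a: "integrable lborel \<alpha>" and b: "integrable lborel \<beta>" and k: "\<And>s. \<bar>prim \<alpha> s\<bar> \<le> \<kappa>"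
  shows "\<bar>wint \<alpha> \<beta>\<bar> \<le> exp \<kappa> * (\<integral>s. \<bar>\<beta> s\<bar> \<partial>lborel)"
proof -
  have "\<bar>wint \<alpha> \<beta>\<bar> \<le> (\<integral>s. \<bar>\<beta> s * exp (- prim \<alpha> s)\<bar> \<partial>lborel)"
    unfolding wint_def by (rule integral_abs_bound)
  also have "\<dots> \<le> (\<integral>s. exp \<kappa> * \<bar>\<beta> s\<bar> \<partial>lborel)"
  proof (rule integral_mono)
    have "exp (- prim \<alpha> s) \<le> exp \<kappa>" for s using k[of s] by (simp add: abs_le_iff)
    then show "\<bar>\<beta> s * exp (- prim \<alpha> s)\<bar> \<le> exp \<kappa> * \<bar>\<beta> s\<bar>" for s
      by (simp add: abs_mult mult.commute[of "\<bar>\<beta> _\<bar>"] mult_right_mono del: exp_le_cancel_iff)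
  qed (use wint_integrable[OF a b] b in auto)
  finally show ?thesis by simp
qed

text \<open>Replacing the exponential by its least value is allowed because \<open>q\<close> is
  nonnegative. This keeps the denominator of \<open>path_density\<close> away from zero by a
  quantity that depends on \<open>\<alpha>\<close> through \<open>\<kappa>\<close> only.\<close>

lemma wint_lower:
  assumes a: "integrable lborel \<alpha>" and q: "integrable lborel q" "\<And>s. 0 \<le> q s"
    and k: "\<And>s. \<bar>prim \<alpha> s\<bar> \<le> \<kappa>"
  shows "exp (-\<kappa>) * (\<integral>s. q s \<partial>lborel) \<le> wint \<alpha> q"
proof -
  have "(\<integral>s. exp (-\<kappa>) * q s \<partial>lborel) \<le> wint \<alpha> q"
    unfolding wint_def
  proof (rule integral_mono)
    have "exp (-\<kappa>) \<le> exp (- prim \<alpha> s)" for s using k[of s] by (simp add: abs_le_iff)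
    then show "exp (-\<kappa>) * q s \<le> q s * exp (- prim \<alpha> s)" for s
      using q(2)[of s] by (subst mult.commute) (intro mult_left_mono, auto)
  qed (use wint_integrable[OF a q(1)] q in auto)
  then show ?thesis by simp
qed

text \<open>Here \<open>\<kappa>\<close> is the L1 norm of the given \<open>\<alpha>\<close> itself,
  so positivity holds for every integrable \<open>\<alpha>\<close>. The change of variables asks for
  it at every coefficient vector, including those where no uniform bound is available.\<close>

lemma wint_pos:
  assumes a: "integrable lborel \<alpha>" and q: "integrable lborel q" "\<And>s. 0 \<le> q s"
    and p: "0 < (\<integral>s. q s \<partial>lborel)"
  shows "0 < wint \<alpha> q"
  using wint_lower[OF a q prim_abs_le[OF a]] p
  by (meson exp_gt_zero less_le_trans mult_pos_pos)

text \<open>The splitting is arranged so that only the norm of \<open>\<beta>'\<close> multiplies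
  the error in \<open>\<alpha>\<close>. In the application the primed pair is the limit, so the
  moment bound concerns a single process and not the whole sequence of truncations.\<close>

lemma wint_diff:
  assumes a: "integrable lborel \<alpha>" "integrable lborel \<alpha>'"
    and b: "integrable lborel \<beta>" "integrable lborel \<beta>'"
    and k: "\<And>s. \<bar>prim \<alpha> s\<bar> \<le> \<kappa>" "\<And>s. \<bar>prim \<alpha>' s\<bar> \<le> \<kappa>"
  shows "\<bar>wint \<alpha> \<beta> - wint \<alpha>' \<beta>'\<bar> \<le> exp \<kappa> * ((\<integral>s. \<bar>\<beta> s - \<beta>' s\<bar> \<partial>lborel)
     + (\<integral>s. \<bar>\<beta>' s\<bar> \<partial>lborel) * (\<integral>s. \<bar>\<alpha> s - \<alpha>' s\<bar> \<partial>lborel))"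
proof -
  define D where "D = (\<integral>s. \<bar>\<alpha> s - \<alpha>' s\<bar> \<partial>lborel)"
  have D: "\<bar>prim \<alpha> s - prim \<alpha>' s\<bar> \<le> D" for s unfolding D_def by (rule prim_diff[OF a])
  have i: "integrable lborel (\<lambda>s. \<beta> s * exp (- prim \<alpha> s))"
     "integrable lborel (\<lambda>s. \<beta>' s * exp (- prim \<alpha>' s))"
    using wint_integrable a b by auto
  have "wint \<alpha> \<beta> - wint \<alpha>' \<beta>' = (\<integral>s. \<beta> s * exp (- prim \<alpha> s) - \<beta>' s * exp (- prim \<alpha>' s) \<partial>lborel)"
    unfolding wint_def using i by simp
  also have "\<bar>\<dots>\<bar> \<le> (\<integral>s. \<bar>\<beta> s * exp (- prim \<alpha> s) - \<beta>' s * exp (- prim \<alpha>' s)\<bar> \<partial>lborel)"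
    by (rule integral_abs_bound)
  also have "\<dots> \<le> (\<integral>s. exp \<kappa> * \<bar>\<beta> s - \<beta>' s\<bar> + exp \<kappa> * D * \<bar>\<beta>' s\<bar> \<partial>lborel)"
  proof (rule integral_mono)
    fix s
    have 1: "exp (- prim \<alpha> s) \<le> exp \<kappa>" using k(1)[of s] by (simp add: abs_le_iff)
    have "\<bar>exp (- prim \<alpha> s) - exp (- prim \<alpha>' s)\<bar> \<le> exp \<kappa> * \<bar>prim \<alpha> s - prim \<alpha>' s\<bar>"
      by (rule exp_diff_bound) (use k in auto)
    also have "\<dots> \<le> exp \<kappa> * D" using D by simp
    finally have 2: "\<bar>exp (- prim \<alpha> s) - exp (- prim \<alpha>' s)\<bar> \<le> exp \<kappa> * D" .
    have "\<beta> s * exp (- prim \<alpha> s) - \<beta>' s * exp (- prim \<alpha>' s)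
      = exp (- prim \<alpha> s) * (\<beta> s - \<beta>' s) + (exp (- prim \<alpha> s) - exp (- prim \<alpha>' s)) * \<beta>' s"
      by (simp add: algebra_simps)
    also have "\<bar>\<dots>\<bar> \<le> exp (- prim \<alpha> s) * \<bar>\<beta> s - \<beta>' s\<bar> + \<bar>exp (- prim \<alpha> s) - exp (- prim \<alpha>' s)\<bar> * \<bar>\<beta>' s\<bar>"
      by (rule order_trans[OF abs_triangle_ineq]) (simp add: abs_mult)
    also have "\<dots> \<le> exp \<kappa> * \<bar>\<beta> s - \<beta>' s\<bar> + exp \<kappa> * D * \<bar>\<beta>' s\<bar>"
      using 1 2 by (intro add_mono mult_right_mono) auto
    finally show "\<bar>\<beta> s * exp (- prim \<alpha> s) - \<beta>' s * exp (- prim \<alpha>' s)\<bar>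
       \<le> exp \<kappa> * \<bar>\<beta> s - \<beta>' s\<bar> + exp \<kappa> * D * \<bar>\<beta>' s\<bar>" .
  qed (use i b in auto)
  also have "\<dots> = exp \<kappa> * (\<integral>s. \<bar>\<beta> s - \<beta>' s\<bar> \<partial>lborel) + exp \<kappa> * D * (\<integral>s. \<bar>\<beta>' s\<bar> \<partial>lborel)"
    using b by simp
  finally show ?thesis unfolding D_def[symmetric] by (simp add: algebra_simps)
qed

text \<open>The density at \<open>x\<close> of \<open>exp (\<integral>\<alpha>) * (u + wint \<alpha> \<beta> + Y * wint \<alpha> q)\<close> when \<open>Y\<close> has
  density \<open>f\<close>.\<close>
definition path_density ::
    "(real \<Rightarrow> real) \<Rightarrow> (real \<Rightarrow> real) \<Rightarrow> (real \<Rightarrow> real) \<Rightarrow> (real \<Rightarrow> real) \<Rightarrow> real \<Rightarrow> real \<Rightarrow> real" where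
  "path_density f \<alpha> \<beta> q u x =
     f ((x * exp (- integral\<^sup>L lborel \<alpha>) - wint \<alpha> \<beta> - u) / wint \<alpha> q)
       * (exp (- integral\<^sup>L lborel \<alpha>) / wint \<alpha> q)"

text \<open>Variation of constants, with the exponential of the integral of \<open>\<alpha>\<close>
  from \<open>s\<close> to the final time split into the total exponential and
  \<open>exp (- prim \<alpha> s)\<close>.\<close>

definition path_value :: "(real \<Rightarrow> real) \<Rightarrow> (real \<Rightarrow> real) \<Rightarrow> real \<Rightarrow> real" where
  "path_value \<alpha> \<beta> u = exp (integral\<^sup>L lborel \<alpha>) * (u + wint \<alpha> \<beta>)"

text \<open>Up to the constant, the right-hand side is the error term of
  \<open>path_density_diff\<close>. A single estimate in mean then yields both the L1 convergence of
  the solutions and the convergence of their densities.\<close>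

lemma path_value_diff:
  assumes a: "integrable lborel \<alpha>" "integrable lborel \<alpha>'"
    and b: "integrable lborel \<beta>" "integrable lborel \<beta>'"
    and \<kappa>: "(\<integral>s. \<bar>\<alpha> s\<bar> \<partial>lborel) \<le> \<kappa>" "(\<integral>s. \<bar>\<alpha>' s\<bar> \<partial>lborel) \<le> \<kappa>"
  shows "\<bar>path_value \<alpha> \<beta> u - path_value \<alpha>' \<beta>' u\<bar> \<le> 2 * (exp \<kappa>)\<^sup>2 *
    ((1 + \<bar>u\<bar> + (\<integral>s. \<bar>\<beta>' s\<bar> \<partial>lborel)) * (\<integral>s. \<bar>\<alpha> s - \<alpha>' s\<bar> \<partial>lborel) + (\<integral>s. \<bar>\<beta> s - \<beta>' s\<bar> \<partial>lborel))"
proof -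
  have k: "\<And>s. \<bar>prim \<alpha> s\<bar> \<le> \<kappa>" "\<And>s. \<bar>prim \<alpha>' s\<bar> \<le> \<kappa>"
    using prim_abs_le[OF a(1)] prim_abs_le[OF a(2)] \<kappa> order_trans by blast+
  have k': "\<bar>integral\<^sup>L lborel \<alpha>\<bar> \<le> \<kappa>" "\<bar>integral\<^sup>L lborel \<alpha>'\<bar> \<le> \<kappa>"
    by (rule order_trans[OF integral_abs_bound \<kappa>(1)], rule order_trans[OF integral_abs_bound \<kappa>(2)])
  define D where "D = (\<integral>s. \<bar>\<alpha> s - \<alpha>' s\<bar> \<partial>lborel)"
  define E where "E = (\<integral>s. \<bar>\<beta> s - \<beta>' s\<bar> \<partial>lborel)"
  define B where "B = (\<integral>s. \<bar>\<beta>' s\<bar> \<partial>lborel)"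
  define e where "e = exp \<kappa>"
  define p where "p = exp (integral\<^sup>L lborel \<alpha>)"
  define p' where "p' = exp (integral\<^sup>L lborel \<alpha>')"
  have nn: "0 \<le> D" "0 \<le> E" "0 \<le> B" unfolding D_def E_def B_def by auto
  have "0 \<le> \<kappa>" using k'(1) by simp
  then have e: "1 \<le> e" unfolding e_def by simp
  have R: "\<bar>wint \<alpha> \<beta> - wint \<alpha>' \<beta>'\<bar> \<le> e * (E + B * D)"
    unfolding D_def E_def B_def e_def by (rule wint_diff[OF a b k])
  have R': "\<bar>wint \<alpha>' \<beta>'\<bar> \<le> e * B"
    unfolding B_def e_def by (rule wint_bound[OF a(2) b(2) k(2)])
  have "integral\<^sup>L lborel \<alpha> - integral\<^sup>L lborel \<alpha>' = (\<integral>s. \<alpha> s - \<alpha>' s \<partial>lborel)"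
    using a by simp
  also have "\<bar>\<dots>\<bar> \<le> D" unfolding D_def by (rule integral_abs_bound)
  finally have dk: "\<bar>integral\<^sup>L lborel \<alpha> - integral\<^sup>L lborel \<alpha>'\<bar> \<le> D" .
  have "\<bar>p - p'\<bar> \<le> e * \<bar>integral\<^sup>L lborel \<alpha> - integral\<^sup>L lborel \<alpha>'\<bar>"
    using exp_diff_bound[of "- integral\<^sup>L lborel \<alpha>" \<kappa> "- integral\<^sup>L lborel \<alpha>'"] k'
    unfolding p_def p'_def e_def by (auto simp: abs_minus_commute)
  also have "\<dots> \<le> e * D" using dk e by auto
  finally have P: "\<bar>p - p'\<bar> \<le> e * D" .
  have p: "0 < p" "p \<le> e" using k' unfolding p_def e_def by auto
  have "path_value \<alpha> \<beta> u - path_value \<alpha>' \<beta>' u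
     = p * (wint \<alpha> \<beta> - wint \<alpha>' \<beta>') + (p - p') * (u + wint \<alpha>' \<beta>')"
    unfolding path_value_def p_def p'_def by (simp add: algebra_simps)
  also have "\<bar>\<dots>\<bar> \<le> p * \<bar>wint \<alpha> \<beta> - wint \<alpha>' \<beta>'\<bar> + \<bar>p - p'\<bar> * \<bar>u + wint \<alpha>' \<beta>'\<bar>"
    using p by (intro order_trans[OF abs_triangle_ineq]) (simp add: abs_mult)
  also have "\<dots> \<le> e * (e * (E + B * D)) + (e * D) * (\<bar>u\<bar> + e * B)"
    using p R R' P nn e by (intro add_mono mult_mono) auto
  \<comment> \<open>Since \<open>1 \<le> e\<close>, a factor \<open>e\<close> may be inserted before
    \<open>\<bar>u\<bar>\<close>, which gives all terms the common factor
    \<open>e\<^sup>2\<close>.\<close>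
  also have "\<dots> \<le> e * (e * (E + B * D)) + (e * D) * (e * \<bar>u\<bar> + e * B)"
    using nn e by (intro add_mono mult_left_mono order_refl) (auto simp: mult_right_mono[of 1 e, simplified])
  also have "\<dots> = e\<^sup>2 * (E + 2 * (B * D) + \<bar>u\<bar> * D)"
    by (simp add: algebra_simps power2_eq_square)
  \<comment> \<open>The mixed term \<open>B * D\<close> arises twice, from the change of the source
    integral and from the change of the outer exponential; the factor 2 covers it.\<close>
  also have "\<dots> \<le> e\<^sup>2 * (2 * ((1 + \<bar>u\<bar> + B) * D + E))"
    using nn by (intro mult_left_mono) (auto simp: algebra_simps)
  finally show ?thesis unfolding D_def E_def B_def e_def by (simp add: algebra_simps)
qed

text \<open>\<open>f\<close> at an argument is multiplied by a weight. The Lipschitz constant pays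
  for the change of the argument, the bound \<open>F\<close> for the change of the weight. In the
  constant, \<open>e\<^sup>2/p\<close> bounds a weight, and the fourth powers stem from the
  difference of the reciprocals of \<open>wint\<close>, which costs \<open>e^3 / p\<close> before it
  is multiplied by a further \<open>e\<close>.\<close>

lemma path_density_diff:
  fixes \<kappa> p L F \<rho> :: real
  defines "e \<equiv> exp \<kappa>"
  assumes a: "integrable lborel \<alpha>" "integrable lborel \<alpha>'"
    and b: "integrable lborel \<beta>" "integrable lborel \<beta>'"
    and \<kappa>: "(\<integral>s. \<bar>\<alpha> s\<bar> \<partial>lborel) \<le> \<kappa>" "(\<integral>s. \<bar>\<alpha>' s\<bar> \<partial>lborel) \<le> \<kappa>"
    and q: "integrable lborel q" "\<And>s. 0 \<le> q s" "p = integral\<^sup>L lborel q" "0 < p"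
    and L: "L-lipschitz_on UNIV f" and F: "\<And>y. \<bar>f y\<bar> \<le> F"
    and x: "\<bar>x\<bar> \<le> \<rho>"
  shows "\<bar>path_density f \<alpha> \<beta> q u x - path_density f \<alpha>' \<beta>' q u x\<bar> \<le>
    (L * (e\<^sup>2/p) * ((\<rho> + 2) * e^2 / p + (\<rho> + 2) * e^4 / p) + F * (e^2/p + e^4/p)) *
    ((1 + \<bar>u\<bar> + (\<integral>s. \<bar>\<beta>' s\<bar> \<partial>lborel)) * (\<integral>s. \<bar>\<alpha> s - \<alpha>' s\<bar> \<partial>lborel) + (\<integral>s. \<bar>\<beta> s - \<beta>' s\<bar> \<partial>lborel))"
proof -
  have k: "\<And>s. \<bar>prim \<alpha> s\<bar> \<le> \<kappa>" "\<And>s. \<bar>prim \<alpha>' s\<bar> \<le> \<kappa>"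
    using prim_abs_le[OF a(1)] prim_abs_le[OF a(2)] \<kappa> order_trans by blast+
  have k': "\<bar>integral\<^sup>L lborel \<alpha>\<bar> \<le> \<kappa>" "\<bar>integral\<^sup>L lborel \<alpha>'\<bar> \<le> \<kappa>"
    by (rule order_trans[OF integral_abs_bound \<kappa>(1)], rule order_trans[OF integral_abs_bound \<kappa>(2)])
  define D where "D = (\<integral>s. \<bar>\<alpha> s - \<alpha>' s\<bar> \<partial>lborel)"
  define E where "E = (\<integral>s. \<bar>\<beta> s - \<beta>' s\<bar> \<partial>lborel)"
  define B where "B = (\<integral>s. \<bar>\<beta>' s\<bar> \<partial>lborel)"
  define G where "G = (1 + \<bar>u\<bar> + B) * D + E"
  define v where "v = exp (- integral\<^sup>L lborel \<alpha>)"
  define v' where "v' = exp (- integral\<^sup>L lborel \<alpha>')"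
  define C where "C = wint \<alpha> q"
  define C' where "C' = wint \<alpha>' q"
  define R where "R = wint \<alpha> \<beta>"
  define R' where "R' = wint \<alpha>' \<beta>'"
  have nn: "0 \<le> D" "0 \<le> E" "0 \<le> B" unfolding D_def E_def B_def by auto
  have L0: "0 \<le> L" using L by (rule lipschitz_on_nonneg)
  have F0: "0 \<le> F" using F[of 0] by simp
  have \<rho>0: "0 \<le> \<rho>" using x by simp
  have "0 \<le> \<kappa>" using k'(1) by simp
  then have e: "1 \<le> e" unfolding e_def by simp
  have e24: "e \<le> e^2" "e^3 \<le> e^4" "0 < e" using e by (auto simp: self_le_power power_increasing)
  have "0 \<le> B * D" "0 \<le> \<bar>u\<bar> * D" using nn by auto
  then have G: "D \<le> G" "E + B * D \<le> G" "(1 + \<bar>u\<bar> + B) * D \<le> G" "0 \<le> G"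
    using nn by (auto simp: G_def algebra_simps)
  have dR: "\<bar>R - R'\<bar> \<le> e * (E + B * D)"
    unfolding R_def R'_def D_def E_def B_def e_def by (rule wint_diff[OF a b k])
  have R': "\<bar>R'\<bar> \<le> e * B"
    unfolding B_def e_def R'_def by (rule wint_bound[OF a(2) b(2) k(2)])
  have "\<bar>C - C'\<bar> \<le> e * ((\<integral>s. \<bar>q s - q s\<bar> \<partial>lborel) + (\<integral>s. \<bar>q s\<bar> \<partial>lborel) * D)"
    unfolding C_def C'_def D_def e_def by (rule wint_diff[OF a q(1,1) k])
  then have dC: "\<bar>C - C'\<bar> \<le> e * p * D" using q by (simp add: mult.assoc)
  have pe: "p / e \<le> C" "p / e \<le> C'"
    using wint_lower[OF a(1) q(1,2) k(1)] wint_lower[OF a(2) q(1,2) k(2)]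
    unfolding e_def C_def C'_def q(3) by (auto simp: exp_minus field_simps)
  have "0 < p / e" using q(4) e24 by simp
  then have C0: "0 < C" "0 < C'" using pe by auto
  have "p \<le> e * C" "p \<le> e * C'" using pe e24 by (auto simp: field_simps)
  then have C: "1 / C \<le> e / p" "1 / C' \<le> e / p"
    using q(4) C0 by (auto simp: field_simps)
  have "integral\<^sup>L lborel \<alpha> - integral\<^sup>L lborel \<alpha>' = (\<integral>s. \<alpha> s - \<alpha>' s \<partial>lborel)"
    using a by simp
  also have "\<bar>\<dots>\<bar> \<le> D" unfolding D_def by (rule integral_abs_bound)
  finally have dk: "\<bar>integral\<^sup>L lborel \<alpha> - integral\<^sup>L lborel \<alpha>'\<bar> \<le> D" .
  have "\<bar>v - v'\<bar> \<le> e * \<bar>integral\<^sup>L lborel \<alpha> - integral\<^sup>L lborel \<alpha>'\<bar>"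
    using exp_diff_bound[OF k'] unfolding v_def v'_def e_def .
  also have "\<dots> \<le> e * D" using dk e by auto
  finally have dv: "\<bar>v - v'\<bar> \<le> e * D" .
  have v: "0 < v" "v \<le> e" "0 < v'" "v' \<le> e" using k' unfolding v_def v'_def e_def by auto
  have "1 / C - 1 / C' = (C' - C) * (1/C) * (1/C')" using C0 by (simp add: field_simps)
  also have "\<bar>\<dots>\<bar> = \<bar>C - C'\<bar> * (1/C) * (1/C')" using C0 by (simp add: abs_mult abs_minus_commute)
  also have "\<dots> \<le> (e * p * D) * (e/p) * (e/p)"
    using dC C C0 nn q e24 by (intro mult_mono) auto
  \<comment> \<open>The factor \<open>p\<close> in the difference of the denominators cancels one of
    the two reciprocals, so the bound scales like \<open>1 / p\<close>.\<close>
  also have "\<dots> = e^3 / p * D" using q(4) by (simp add: field_simps power3_eq_cube)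
  finally have di: "\<bar>1 / C - 1 / C'\<bar> \<le> e^3 / p * D" .
  define U where "U = x * v - R - u"
  define U' where "U' = x * v' - R' - u"
  have "U - U' = x * (v - v') - (R - R')" unfolding U_def U'_def by (simp add: algebra_simps)
  also have "\<bar>\<dots>\<bar> \<le> \<bar>x\<bar> * \<bar>v - v'\<bar> + \<bar>R - R'\<bar>"
    by (rule order_trans[OF abs_triangle_ineq4]) (simp add: abs_mult)
  also have "\<dots> \<le> \<rho> * (e * D) + e * (E + B * D)"
    using x dv dR \<rho>0 by (intro add_mono mult_mono) auto
  also have "\<dots> \<le> \<rho> * (e * G) + e * G"
    using G e \<rho>0 by (intro add_mono mult_left_mono) auto
  also have "\<dots> = (\<rho> + 1) * e * G" by (simp add: algebra_simps)
  finally have dU: "\<bar>U - U'\<bar> \<le> (\<rho> + 1) * e * G" .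
  have "\<bar>U'\<bar> \<le> \<bar>x\<bar> * \<bar>v'\<bar> + \<bar>R'\<bar> + \<bar>u\<bar>" unfolding U'_def abs_mult[symmetric] by linarith
  also have "\<dots> \<le> \<rho> * e + e * B + e * \<bar>u\<bar>"
    using x v R' e \<rho>0 mult_right_mono[of 1 e "\<bar>u\<bar>"] by (intro add_mono mult_mono) auto
  finally have U': "\<bar>U'\<bar> \<le> e * (\<rho> + B + \<bar>u\<bar>)" by (simp add: algebra_simps)
  have "U / C - U' / C' = (U - U') * (1/C) + U' * (1/C - 1/C')" by (simp add: algebra_simps diff_divide_distrib)
  also have "\<bar>\<dots>\<bar> \<le> \<bar>U - U'\<bar> * (1/C) + \<bar>U'\<bar> * \<bar>1/C - 1/C'\<bar>"
    using C0 by (intro order_trans[OF abs_triangle_ineq]) (simp add: abs_mult)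
  also have "\<dots> \<le> ((\<rho> + 1) * e * G) * (e/p) + e * (\<rho> + B + \<bar>u\<bar>) * (e^3 / p * D)"
    using dU C C0 U' di G nn \<rho>0 e24 q(4)
    by (intro add_mono mult_mono) auto
  also have "\<dots> = (\<rho> + 1) * e^2 / p * G + e^4 / p * ((\<rho> + B + \<bar>u\<bar>) * D)"
    using q(4) by (simp add: field_simps power2_eq_square eval_nat_numeral)
  \<comment> \<open>\<open>D\<close> and \<open>(1 + \<bar>u\<bar> + B) * D\<close> are both at most
    \<open>G\<close>, so the path-dependent factors in front of \<open>D\<close> disappear into
    \<open>G\<close> and only the fixed \<open>\<rho>\<close> remains in the constant.\<close>
  also have "\<dots> \<le> (\<rho> + 2) * e^2 / p * G + e^4 / p * ((\<rho> + 2) * G)"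
  proof (intro add_mono mult_right_mono mult_left_mono divide_right_mono)
    have "(\<rho> + B + \<bar>u\<bar>) * D = \<rho> * D + (B + \<bar>u\<bar>) * D" by (simp add: algebra_simps)
    also have "\<dots> \<le> \<rho> * G + 1 * G"
      using G nn \<rho>0 by (intro add_mono mult_left_mono) (auto simp: algebra_simps)
    also have "\<dots> \<le> (\<rho> + 2) * G" using G by (simp add: algebra_simps)
    finally show "(\<rho> + B + \<bar>u\<bar>) * D \<le> (\<rho> + 2) * G" .
  qed (use G q(4) e24 in auto)
  finally have dY: "\<bar>U / C - U' / C'\<bar> \<le> ((\<rho> + 2) * e^2 / p + (\<rho> + 2) * e^4 / p) * G"
    by (simp add: algebra_simps add_divide_distrib)
  have "v / C - v' / C' = (v - v') * (1/C) + v' * (1/C - 1/C')" by (simp add: algebra_simps diff_divide_distrib)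
  also have "\<bar>\<dots>\<bar> \<le> \<bar>v - v'\<bar> * (1/C) + v' * \<bar>1/C - 1/C'\<bar>"
    using C0 v by (intro order_trans[OF abs_triangle_ineq]) (simp add: abs_mult)
  also have "\<dots> \<le> (e * D) * (e/p) + e * (e^3 / p * D)"
    using dv C C0 v di nn e24 q(4) by (intro add_mono mult_mono) auto
  also have "\<dots> = (e^2/p + e^4/p) * D" using q(4) by (simp add: field_simps eval_nat_numeral)
  also have "\<dots> \<le> (e^2/p + e^4/p) * G" using G q(4) e24 by (intro mult_left_mono) auto
  finally have dw: "\<bar>v / C - v' / C'\<bar> \<le> (e^2/p + e^4/p) * G" .
  have vC: "\<bar>v / C\<bar> \<le> e^2 / p"
  proof -
    have "v * (1/C) \<le> e * (e/p)" using v C C0 e24 by (intro mult_mono) auto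
    then show ?thesis using v C0 by (simp add: power2_eq_square)
  qed
  have lip: "\<bar>f (U/C) - f (U'/C')\<bar> \<le> L * \<bar>U / C - U' / C'\<bar>"
    using lipschitz_onD[OF L, of "U/C" "U'/C'"] by (simp add: dist_real_def)
  have "f (U/C) * (v/C) - f (U'/C') * (v'/C')
      = (f (U/C) - f (U'/C')) * (v/C) + f (U'/C') * (v/C - v'/C')" by (simp add: algebra_simps)
  also have "\<bar>\<dots>\<bar> \<le> \<bar>f (U/C) - f (U'/C')\<bar> * \<bar>v/C\<bar> + \<bar>f (U'/C')\<bar> * \<bar>v/C - v'/C'\<bar>"
    by (intro order_trans[OF abs_triangle_ineq]) (simp add: abs_mult)
  also have "\<dots> \<le> (L * (((\<rho> + 2) * e^2 / p + (\<rho> + 2) * e^4 / p) * G)) * (e^2/p) + F * ((e^2/p + e^4/p) * G)"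
    using L0 F0 G q(4) e24 \<rho>0
    by (intro add_mono mult_mono order_trans[OF lip] mult_left_mono dY vC F dw) auto
  also have "\<dots> = (L * (e\<^sup>2/p) * ((\<rho> + 2) * e^2 / p + (\<rho> + 2) * e^4 / p) + F * (e^2/p + e^4/p)) * G"
    by (simp add: algebra_simps)
  finally show ?thesis
    unfolding path_density_def G_def D_def E_def B_def U_def U'_def R_def R'_def C_def C'_def v_def v'_def .
qed

section \<open>Independence and change of variables\<close>

text \<open>A peak of height \<open>m\<close> stays above \<open>m / 2\<close> on an interval of
  radius \<open>d = m / (2 * (L + 1))\<close>, so it carries mass at least \<open>m * d\<close>, and
  this is at most one. Hence \<open>m\<^sup>2 \<le> 2 * (L + 1)\<close>, which for
  \<open>m > 1\<close> bounds \<open>m\<close> itself. With \<open>L + 1\<close> in place of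
  \<open>L\<close> the radius makes sense for \<open>L = 0\<close> too.\<close>

lemma lipschitz_density_bounded:
  fixes f :: "real \<Rightarrow> real"
  assumes L: "L-lipschitz_on UNIV f" and nn: "\<And>x. 0 \<le> f x"
    and int: "(\<integral>\<^sup>+x. ennreal (f x) \<partial>lborel) \<le> 1"
  shows "f y \<le> 2 * L + 3"
proof -
  have L0: "0 \<le> L" using L by (rule lipschitz_on_nonneg)
  define m where "m = f y"
  define d where "d = m / (2 * (L + 1))"
  have m: "0 \<le> m" using nn by (simp add: m_def)
  then have d: "0 \<le> d" using L0 by (simp add: d_def)
  have low: "m / 2 \<le> f x" if "x \<in> {y-d..y+d}" for x
  proof -
    have "\<bar>f x - f y\<bar> \<le> L * \<bar>x - y\<bar>" using lipschitz_onD[OF L, of x y] by (simp add: dist_real_def)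
    also have "\<dots> \<le> (L + 1) * d" using that L0 by (intro mult_mono) auto
    also have "\<dots> = m / 2" using L0 by (simp add: d_def field_simps)
    finally show ?thesis unfolding m_def by linarith
  qed
  have "ennreal (m / 2 * (2 * d)) = (\<integral>\<^sup>+x. ennreal (m / 2) * indicator {y-d..y+d} x \<partial>lborel)"
    using m d by (subst nn_integral_cmult_indicator) (auto simp: ennreal_mult[symmetric])
  also have "\<dots> \<le> (\<integral>\<^sup>+x. ennreal (f x) \<partial>lborel)"
    by (intro nn_integral_mono) (auto simp: indicator_def intro!: ennreal_leI low)
  also have "\<dots> \<le> 1" by (rule int)
  finally have "m * d \<le> 1" by simp
  then have m2: "m * m \<le> 2 * (L + 1)" using L0 by (simp add: d_def field_simps)
  show ?thesis
  proof (cases "m \<le> 1")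
    case False
    then have "m * 1 \<le> m * m" by (intro mult_left_mono) auto
    with m2 show ?thesis unfolding m_def by simp
  qed (use L0 in \<open>simp add: m_def\<close>)
qed

text \<open>This is where completeness of the probability space enters: \<open>sol\<close> is known
  to agree with a measurable function almost surely, and its own measurability rests on null sets
  being measurable.\<close>

lemma (in complete_measure) borel_measurable_AE_cong:
  fixes f g :: "'a \<Rightarrow> real"
  assumes f: "f \<in> borel_measurable M" and ae: "AE x in M. f x = g x"
  shows "g \<in> borel_measurable M"
proof (rule measurableI)
  fix A :: "real set" assume A: "A \<in> sets borel"
  show "g -` A \<inter> space M \<in> sets M"
  proof (rule in_sets_AE[OF _ measurable_sets[OF f A]])
    show "AE x in M. (x \<in> f -` A \<inter> space M) = (x \<in> g -` A \<inter> space M)"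
      using ae by eventually_elim auto
  qed auto
qed simp

lemma indep3_emeasure:
  assumes "prob_space M" and ind: "indep3 M N1 X N2 Y N3 Z"
    and A: "A \<in> sets N1" and B: "B \<in> sets N2" and C: "C \<in> sets N3"
  shows "emeasure M {w \<in> space M. X w \<in> A \<and> Y w \<in> B \<and> Z w \<in> C}
    = emeasure (distr M N1 X) A * emeasure (distr M N2 Y) B * emeasure (distr M N3 Z) C"
proof -
  interpret prob_space M by fact
  have [measurable]: "X \<in> measurable M N1" "Y \<in> measurable M N2" "Z \<in> measurable M N3"
    using ind by (auto simp: indep3_def)
  have iset: "indep_sets (\<lambda>i::nat. if i = 0 then {X -` A \<inter> space M | A. A \<in> sets N1}
                 else if i = 1 then {Y -` A \<inter> space M | A. A \<in> sets N2}
                 else {Z -` A \<inter> space M | A. A \<in> sets N3}) {0, 1, 2}"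
    using ind by (simp add: indep3_def)
  define S where "S i = (if i = 0 then X -` A \<inter> space M else if i = 1 then Y -` B \<inter> space M
      else Z -` C \<inter> space M)" for i :: nat
  have "prob (\<Inter>j\<in>{0,1,2::nat}. S j) = (\<Prod>j\<in>{0,1,2::nat}. prob (S j))"
    by (rule indep_setsD[OF iset]) (use A B C in \<open>auto simp: S_def\<close>)
  moreover have "(\<Inter>j\<in>{0,1,2::nat}. S j) = {w \<in> space M. X w \<in> A \<and> Y w \<in> B \<and> Z w \<in> C}"
    by (auto simp: S_def)
  ultimately have "prob {w \<in> space M. X w \<in> A \<and> Y w \<in> B \<and> Z w \<in> C}
     = prob (X -` A \<inter> space M) * prob (Y -` B \<inter> space M) * prob (Z -` C \<inter> space M)"
    by (simp add: S_def mult.assoc)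
  then have "ennreal (prob {w \<in> space M. X w \<in> A \<and> Y w \<in> B \<and> Z w \<in> C})
     = ennreal (prob (X -` A \<inter> space M)) * ennreal (prob (Y -` B \<inter> space M))
       * ennreal (prob (Z -` C \<inter> space M))"
    by (simp only: ennreal_mult measure_nonneg mult_nonneg_nonneg)
  then show ?thesis using A B C
    by (simp only: emeasure_distr[OF \<open>X \<in> _\<close>] emeasure_distr[OF \<open>Y \<in> _\<close>]
      emeasure_distr[OF \<open>Z \<in> _\<close>] emeasure_eq_measure)
qed

text \<open>Uniqueness for a product with a product inside needs arbitrary measurable
  \<open>B\<close> in the inner factor, while independence speaks of rectangles. For fixed
  \<open>C\<close> both sides are finite measures in \<open>B\<close>, and agreement on rectangles
  extends to all \<open>B\<close>. \<open>Z\<close> comes first so that \<open>X\<close> and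
  \<open>Y\<close> can later be integrated out for a fixed value of \<open>Z\<close>.\<close>

lemma indep3_distr_eq:
  assumes "prob_space M" and ind: "indep3 M N1 X N2 Y N3 Z"
  shows "distr M N3 Z \<Otimes>\<^sub>M (distr M N1 X \<Otimes>\<^sub>M distr M N2 Y)
    = distr M (N3 \<Otimes>\<^sub>M (N1 \<Otimes>\<^sub>M N2)) (\<lambda>w. (Z w, (X w, Y w)))"
proof -
  interpret prob_space M by fact
  have [measurable]: "X \<in> measurable M N1" "Y \<in> measurable M N2" "Z \<in> measurable M N3"
    using ind by (auto simp: indep3_def)
  interpret PX: prob_space "distr M N1 X" by (rule prob_space_distr) measurable
  interpret PY: prob_space "distr M N2 Y" by (rule prob_space_distr) measurable
  interpret PZ: prob_space "distr M N3 Z" by (rule prob_space_distr) measurable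
  interpret PXY: pair_prob_space "distr M N1 X" "distr M N2 Y" ..
  show ?thesis
  proof (rule pair_measure_eqI)
    fix C B assume C': "C \<in> sets (distr M N3 Z)" and B: "B \<in> sets (distr M N1 X \<Otimes>\<^sub>M distr M N2 Y)"
    from C' have C[measurable]: "C \<in> sets N3" by simp
    define c where "c = emeasure (distr M N3 Z) C"
    \<comment> \<open>\<open>P\<close> is the product law scaled by the probability that
      \<open>Z\<close> lies in \<open>C\<close>; \<open>Q\<close> is the joint law of
      \<open>X\<close> and \<open>Y\<close> restricted to that event, without normalisation.\<close>
    define P where "P = scale_measure c (distr M N1 X \<Otimes>\<^sub>M distr M N2 Y)"
    define Q where "Q = distr (density M (indicator (Z -` C \<inter> space M))) (N1 \<Otimes>\<^sub>M N2) (\<lambda>w. (X w, Y w))"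
    let ?E = "{a \<times> b | a b. a \<in> sets N1 \<and> b \<in> sets N2}"
    have Qe: "emeasure Q D = emeasure M {w \<in> space M. Z w \<in> C \<and> (X w, Y w) \<in> D}"
      if [measurable]: "D \<in> sets (N1 \<Otimes>\<^sub>M N2)" for D
    proof -
      have "emeasure Q D = (\<integral>\<^sup>+w. indicator (Z -` C \<inter> space M) w *
          indicator ((\<lambda>w. (X w, Y w)) -` D \<inter> space M) w \<partial>M)"
        unfolding Q_def by (simp add: emeasure_distr emeasure_density)
      also have "\<dots> = (\<integral>\<^sup>+w. indicator {w \<in> space M. Z w \<in> C \<and> (X w, Y w) \<in> D} w \<partial>M)"
        by (intro nn_integral_cong) (auto simp: indicator_def)
      also have "\<dots> = emeasure M {w \<in> space M. Z w \<in> C \<and> (X w, Y w) \<in> D}"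
        by (rule nn_integral_indicator) measurable
      finally show ?thesis .
    qed
    have "P = Q"
    proof (rule measure_eqI_generator_eq[OF Int_stable_pair_measure_generator[of N1 N2],
          where \<Omega>="space N1 \<times> space N2" and A="\<lambda>_. space N1 \<times> space N2"])
      show "?E \<subseteq> Pow (space N1 \<times> space N2)"
        using sets.space_closed[of N1] sets.space_closed[of N2] by auto
      show "sets P = sigma_sets (space N1 \<times> space N2) ?E"
        "sets Q = sigma_sets (space N1 \<times> space N2) ?E"
        unfolding P_def Q_def sets_scale_measure sets_distr sets_pair_measure by simp_all
      fix R assume "R \<in> ?E"
      then obtain a b where R: "R = a \<times> b" and [measurable]: "a \<in> sets N1" "b \<in> sets N2" by auto
      have "emeasure P R = c * (emeasure (distr M N1 X) a * emeasure (distr M N2 Y) b)"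
        unfolding P_def R by (simp add: PY.emeasure_pair_measure_Times)
      also have "\<dots> = emeasure M {w \<in> space M. X w \<in> a \<and> Y w \<in> b \<and> Z w \<in> C}"
        unfolding c_def by (subst indep3_emeasure[OF assms]) (auto simp: ac_simps)
      also have "\<dots> = emeasure Q R"
        by (subst Qe) (auto simp: R intro!: arg_cong[where f="emeasure M"])
      finally show "emeasure P R = emeasure Q R" .
    next
      have "space (distr M N1 X \<Otimes>\<^sub>M distr M N2 Y) = space N1 \<times> space N2"
        by (simp add: space_pair_measure)
      then have "emeasure (distr M N1 X \<Otimes>\<^sub>M distr M N2 Y) (space N1 \<times> space N2) = 1"
        using PXY.emeasure_space_1 by simp
      then show "emeasure P (space N1 \<times> space N2) \<noteq> \<infinity>"
        using PZ.emeasure_finite[of C] by (simp add: P_def c_def)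
    qed auto
    have Bs[measurable]: "B \<in> sets (N1 \<Otimes>\<^sub>M N2)" using B by simp
    have "emeasure (distr M N3 Z) C * emeasure (distr M N1 X \<Otimes>\<^sub>M distr M N2 Y) B = emeasure P B"
      by (simp add: P_def c_def)
    also have "\<dots> = emeasure M {w \<in> space M. Z w \<in> C \<and> (X w, Y w) \<in> B}"
      unfolding \<open>P = Q\<close> by (rule Qe[OF Bs])
    also have "{w \<in> space M. Z w \<in> C \<and> (X w, Y w) \<in> B}
        = (\<lambda>w. (Z w, (X w, Y w))) -` (C \<times> B) \<inter> space M" by auto
    also have "emeasure M \<dots> = emeasure (distr M (N3 \<Otimes>\<^sub>M (N1 \<Otimes>\<^sub>M N2)) (\<lambda>w. (Z w, (X w, Y w)))) (C \<times> B)"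
      by (rule emeasure_distr[symmetric]) measurable
    finally show "emeasure (distr M N3 Z) C * emeasure (distr M N1 X \<Otimes>\<^sub>M distr M N2 Y) B
       = emeasure (distr M (N3 \<Otimes>\<^sub>M (N1 \<Otimes>\<^sub>M N2)) (\<lambda>w. (Z w, (X w, Y w)))) (C \<times> B)" .
  next
    show "sigma_finite_measure (distr M N3 Z)" ..
    show "sigma_finite_measure (distr M N1 X \<Otimes>\<^sub>M distr M N2 Y)" ..
  qed (simp cong: sets_pair_measure_cong)
qed

text \<open>Only \<open>X\<close> and \<open>Y\<close> are replaced by their densities.
  \<open>Z\<close> stays inside an expectation over \<open>M\<close>, so that the substitutions in
  \<open>u\<close> and \<open>y\<close> and the later comparisons can be made for each
  \<open>w\<close> separately.\<close>

lemma nn_integral_indep3: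
  fixes X Y :: "'w \<Rightarrow> real"
  assumes M: "prob_space M" and ind: "indep3 M lborel X lborel Y N Z"
    and X: "distributed M lborel X f" and Y: "distributed M lborel Y h"
    and H[measurable]: "H \<in> borel_measurable (N \<Otimes>\<^sub>M (lborel \<Otimes>\<^sub>M lborel))"
  shows "(\<integral>\<^sup>+w. H (Z w, (X w, Y w)) \<partial>M)
    = (\<integral>\<^sup>+w. (\<integral>\<^sup>+u. f u * (\<integral>\<^sup>+y. h y * H (Z w, (u, y)) \<partial>lborel) \<partial>lborel) \<partial>M)"
proof -
  interpret prob_space M by fact
  have [measurable]: "X \<in> measurable M lborel" "Y \<in> measurable M lborel" "Z \<in> measurable M N"
    using ind by (auto simp: indep3_def)
  have [measurable]: "f \<in> borel_measurable lborel" "h \<in> borel_measurable lborel"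
    using X Y by (auto simp: distributed_def)
  interpret PX: prob_space "distr M lborel X" by (rule prob_space_distr) measurable
  interpret PY: prob_space "distr M lborel Y" by (rule prob_space_distr) measurable
  interpret PZ: prob_space "distr M N Z" by (rule prob_space_distr) measurable
  interpret PXY: pair_prob_space "distr M lborel X" "distr M lborel Y" ..
  have dX: "distr M lborel X = density lborel f" and dY: "distr M lborel Y = density lborel h"
    using X Y by (auto simp: distributed_distr_eq_density)
  have "(\<integral>\<^sup>+w. H (Z w, (X w, Y w)) \<partial>M)
     = (\<integral>\<^sup>+v. H v \<partial>distr M (N \<Otimes>\<^sub>M (lborel \<Otimes>\<^sub>M lborel)) (\<lambda>w. (Z w, (X w, Y w))))"
    by (simp add: nn_integral_distr)
  also have "\<dots> = (\<integral>\<^sup>+v. H v \<partial>(distr M N Z \<Otimes>\<^sub>M (distr M lborel X \<Otimes>\<^sub>M distr M lborel Y)))"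
    by (simp add: indep3_distr_eq[OF M ind])
  also have "\<dots> = (\<integral>\<^sup>+z. (\<integral>\<^sup>+v. H (z, v) \<partial>(distr M lborel X \<Otimes>\<^sub>M distr M lborel Y)) \<partial>distr M N Z)"
    by (rule PXY.P.nn_integral_fst[symmetric]) measurable
  also have "\<dots> = (\<integral>\<^sup>+z. (\<integral>\<^sup>+u. (\<integral>\<^sup>+y. H (z, (u, y)) \<partial>distr M lborel Y) \<partial>distr M lborel X) \<partial>distr M N Z)"
  proof (rule nn_integral_cong)
    fix z assume "z \<in> space (distr M N Z)"
    then have [measurable]: "z \<in> space N" by simp
    show "(\<integral>\<^sup>+v. H (z, v) \<partial>(distr M lborel X \<Otimes>\<^sub>M distr M lborel Y))
        = (\<integral>\<^sup>+u. (\<integral>\<^sup>+y. H (z, (u, y)) \<partial>distr M lborel Y) \<partial>distr M lborel X)"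
      by (rule PY.nn_integral_fst[symmetric]) measurable
  qed
  also have "\<dots> = (\<integral>\<^sup>+w. (\<integral>\<^sup>+u. (\<integral>\<^sup>+y. H (Z w, (u, y)) \<partial>density lborel h) \<partial>density lborel f) \<partial>M)"
    unfolding dX[symmetric] dY[symmetric]
    by (subst nn_integral_distr) measurable
  also have "\<dots> = (\<integral>\<^sup>+w. (\<integral>\<^sup>+u. f u * (\<integral>\<^sup>+y. h y * H (Z w, (u, y)) \<partial>lborel) \<partial>lborel) \<partial>M)"
  proof (intro nn_integral_cong)
    fix w assume "w \<in> space M"
    then have [measurable]: "Z w \<in> space N" using measurable_space[of Z M N] by auto
    have "(\<integral>\<^sup>+u. (\<integral>\<^sup>+y. H (Z w, (u, y)) \<partial>density lborel h) \<partial>density lborel f)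
       = (\<integral>\<^sup>+u. (\<integral>\<^sup>+y. h y * H (Z w, (u, y)) \<partial>lborel) \<partial>density lborel f)"
      by (intro nn_integral_cong, subst nn_integral_density) auto
    also have "\<dots> = (\<integral>\<^sup>+u. f u * (\<integral>\<^sup>+y. h y * H (Z w, (u, y)) \<partial>lborel) \<partial>lborel)"
      by (subst nn_integral_density) auto
    finally show "(\<integral>\<^sup>+u. (\<integral>\<^sup>+y. H (Z w, (u, y)) \<partial>density lborel h) \<partial>density lborel f)
       = (\<integral>\<^sup>+u. f u * (\<integral>\<^sup>+y. h y * H (Z w, (u, y)) \<partial>lborel) \<partial>lborel)" .
  qed
  finally show ?thesis .
qed

text \<open>The substitution \<open>u = v - y * c\<close>. Afterwards the irregular \<open>f\<close>
  is evaluated at the bare integration variable, and all parameters sit in \<open>h\<close>, which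
  may be Lipschitz.\<close>

lemma nn_integral_affine_swap:
  fixes f h :: "real \<Rightarrow> real"
  assumes [measurable]: "f \<in> borel_measurable borel" "h \<in> borel_measurable borel"
    and nn: "\<And>x. 0 \<le> f x" "\<And>x. 0 \<le> h x" "0 \<le> e" and c: "0 < c"
  shows "(\<integral>\<^sup>+y. ennreal (h y) * ennreal (f (v - y * c) * e) \<partial>lborel)
    = (\<integral>\<^sup>+u. ennreal (f u) * ennreal (h ((v - u) / c) * (e / c)) \<partial>lborel)"
proof -
  have "(\<integral>\<^sup>+y. ennreal (h y) * ennreal (f (v - y * c) * e) \<partial>lborel)
     = ennreal \<bar>-1/c\<bar> * (\<integral>\<^sup>+u. ennreal (h (v/c + (-1/c) * u)) * ennreal (f (v - (v/c + (-1/c) * u) * c) * e) \<partial>lborel)"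
    using c by (intro nn_integral_real_affine) auto
  also have "\<dots> = (\<integral>\<^sup>+u. ennreal \<bar>-1/c\<bar> * (ennreal (h (v/c + (-1/c) * u)) * ennreal (f (v - (v/c + (-1/c) * u) * c) * e)) \<partial>lborel)"
    by (rule nn_integral_cmult[symmetric]) measurable
  also have "\<dots> = (\<integral>\<^sup>+u. ennreal (f u) * ennreal (h ((v - u) / c) * (e / c)) \<partial>lborel)"
  proof (rule nn_integral_cong)
    fix u
    have 1: "v - (v/c + (-1/c) * u) * c = u" using c by (simp add: field_simps)
    have 2: "v/c + (-1/c) * u = (v - u) / c" by (simp add: diff_divide_distrib)
    show "ennreal \<bar>-1/c\<bar> * (ennreal (h (v/c + (-1/c) * u)) * ennreal (f (v - (v/c + (-1/c) * u) * c) * e))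
        = ennreal (f u) * ennreal (h ((v - u) / c) * (e / c))"
      unfolding 1 2 using c nn by (simp add: ennreal_mult[symmetric] field_simps)
  qed
  finally show ?thesis .
qed

text \<open>The image of the density \<open>h\<close> under an increasing affine map of slope
  \<open>exp k * c\<close>; the factor \<open>exp (-k) / c\<close> is the reciprocal slope.\<close>

lemma nn_integral_affine_image:
  fixes h :: "real \<Rightarrow> real" and \<Phi> :: "real \<Rightarrow> ennreal"
  assumes [measurable]: "\<Phi> \<in> borel_measurable borel" "h \<in> borel_measurable borel"
    and nn: "\<And>x. 0 \<le> h x" and c: "0 < c"
  shows "(\<integral>\<^sup>+y. ennreal (h y) * \<Phi> (exp k * (u + r + y * c)) \<partial>lborel)
    = (\<integral>\<^sup>+x. \<Phi> x * ennreal (h ((x * exp (-k) - r - u) / c) * (exp (-k) / c)) \<partial>lborel)"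
proof -
  let ?d = "exp (-k) / c" let ?t = "- (r + u) / c"
  have "(\<integral>\<^sup>+y. ennreal (h y) * \<Phi> (exp k * (u + r + y * c)) \<partial>lborel)
     = ennreal \<bar>?d\<bar> * (\<integral>\<^sup>+x. ennreal (h (?t + ?d * x)) * \<Phi> (exp k * (u + r + (?t + ?d * x) * c)) \<partial>lborel)"
    using c by (intro nn_integral_real_affine) auto
  also have "\<dots> = (\<integral>\<^sup>+x. ennreal \<bar>?d\<bar> * (ennreal (h (?t + ?d * x)) * \<Phi> (exp k * (u + r + (?t + ?d * x) * c))) \<partial>lborel)"
    by (rule nn_integral_cmult[symmetric]) measurable
  also have "\<dots> = (\<integral>\<^sup>+x. \<Phi> x * ennreal (h ((x * exp (-k) - r - u) / c) * (exp (-k) / c)) \<partial>lborel)"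
  proof (rule nn_integral_cong)
    fix x
    have "u + r + (?t + ?d * x) * c = exp (-k) * x" using c by (simp add: field_simps)
    then have 1: "exp k * (u + r + (?t + ?d * x) * c) = x" by (simp add: exp_minus)
    have 2: "?t + ?d * x = (x * exp (-k) - r - u) / c"
      by (simp add: diff_divide_distrib add_divide_distrib)
    show "ennreal \<bar>?d\<bar> * (ennreal (h (?t + ?d * x)) * \<Phi> (exp k * (u + r + (?t + ?d * x) * c)))
      = \<Phi> x * ennreal (h ((x * exp (-k) - r - u) / c) * (exp (-k) / c))"
      unfolding 1 unfolding 2 using c nn by (subst ennreal_mult) (auto simp: mult_ac)
  qed
  finally show ?thesis .
qed

text \<open>In the application \<open>X\<close> is \<open>x0\<close>, \<open>Y\<close> is
  \<open>\<eta> 1\<close> and \<open>Z\<close> collects the remaining coefficients. The random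
  variable studied is \<open>exp (k Z) * (X + r Z + Y * c Z)\<close>, affine in both
  \<open>X\<close> and \<open>Y\<close>, so either one can be integrated out against its
  density.\<close>

locale affine_mixture =
  fixes M :: "'w measure" and X Y :: "'w \<Rightarrow> real" and Z :: "'w \<Rightarrow> 'z" and N :: "'z measure"
    and f h :: "real \<Rightarrow> real" and k r c :: "'z \<Rightarrow> real"
  assumes M: "prob_space M" and ind: "indep3 M lborel X lborel Y N Z"
    and X: "distributed M lborel X (\<lambda>x. ennreal (f x))" and Y: "distributed M lborel Y (\<lambda>x. ennreal (h x))"
    and f: "\<And>x. 0 \<le> f x" and h: "\<And>x. 0 \<le> h x"
    and krc[measurable]: "k \<in> borel_measurable N" "r \<in> borel_measurable N" "c \<in> borel_measurable N"
    and c: "\<And>z. z \<in> space N \<Longrightarrow> 0 < c z"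
begin

lemma XYZ_measurable[measurable]:
  "X \<in> borel_measurable M" "Y \<in> borel_measurable M" "Z \<in> measurable M N"
  using ind by (auto simp: indep3_def)

text \<open>\<open>distributed\<close> provides measurability of the \<open>ennreal\<close> versions
  only; by nonnegativity \<open>enn2real\<close> recovers the real functions.\<close>

lemma density_measurable[measurable]: "f \<in> borel_measurable borel" "h \<in> borel_measurable borel"
proof -
  have "(\<lambda>x. enn2real (ennreal (f x))) \<in> borel_measurable lborel"
    "(\<lambda>x. enn2real (ennreal (h x))) \<in> borel_measurable lborel"
    using X Y by (auto simp: distributed_def)
  then show "f \<in> borel_measurable borel" "h \<in> borel_measurable borel" using f h by auto
qed

lemma density_total: "(\<integral>\<^sup>+x. ennreal (f x) \<partial>lborel) = 1" "(\<integral>\<^sup>+x. ennreal (h x) \<partial>lborel) = 1"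
  using distributed_nn_integral[OF X, of "\<lambda>_. 1"] distributed_nn_integral[OF Y, of "\<lambda>_. 1"]
    prob_space.emeasure_space_1[OF M] by auto

lemma nn_integral_conditional:
  assumes [measurable]: "H \<in> borel_measurable (N \<Otimes>\<^sub>M lborel)"
  shows "(\<integral>\<^sup>+w. H (Z w, X w) \<partial>M) = (\<integral>\<^sup>+w. (\<integral>\<^sup>+u. ennreal (f u) * H (Z w, u) \<partial>lborel) \<partial>M)"
proof -
  have "(\<integral>\<^sup>+w. H (Z w, X w) \<partial>M)
     = (\<integral>\<^sup>+w. (\<lambda>(z,(u,y)). H (z, u)) (Z w, (X w, Y w)) \<partial>M)" by simp
  also have "\<dots> = (\<integral>\<^sup>+w. (\<integral>\<^sup>+u. ennreal (f u) * (\<integral>\<^sup>+y. ennreal (h y) * H (Z w, u) \<partial>lborel) \<partial>lborel) \<partial>M)"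
    by (subst nn_integral_indep3[OF M ind X Y]) auto
  also have "\<dots> = (\<integral>\<^sup>+w. (\<integral>\<^sup>+u. ennreal (f u) * H (Z w, u) \<partial>lborel) \<partial>M)"
    by (simp add: nn_integral_multc density_total)
  finally show ?thesis .
qed

text \<open>The left side conditions on everything except \<open>X\<close> and so contains the
  density of \<open>X\<close>; the right side conditions on everything except \<open>Y\<close>. Both
  compute the density at \<open>x\<close> of the same random variable, and this exchange is what
  moves the analysis from \<open>f\<close> to \<open>h\<close>.\<close>

lemma nn_integral_exchange_density:
  "(\<integral>\<^sup>+w. ennreal (f (x * exp (- k (Z w)) - (r (Z w) + Y w * c (Z w))) * exp (- k (Z w))) \<partial>M)
   = (\<integral>\<^sup>+w. ennreal (h ((x * exp (- k (Z w)) - r (Z w) - X w) / c (Z w)) * (exp (- k (Z w)) / c (Z w))) \<partial>M)"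
proof -
  have "(\<integral>\<^sup>+w. ennreal (f (x * exp (- k (Z w)) - (r (Z w) + Y w * c (Z w))) * exp (- k (Z w))) \<partial>M)
    = (\<integral>\<^sup>+w. (\<lambda>(z,(u,y)). ennreal (f (x * exp (- k z) - (r z + y * c z)) * exp (- k z))) (Z w, (X w, Y w)) \<partial>M)"
    by simp
  also have "\<dots> = (\<integral>\<^sup>+w. (\<integral>\<^sup>+u. ennreal (f u) *
      (\<integral>\<^sup>+y. ennreal (h y) * ennreal (f (x * exp (- k (Z w)) - (r (Z w) + y * c (Z w))) * exp (- k (Z w))) \<partial>lborel) \<partial>lborel) \<partial>M)"
    by (subst nn_integral_indep3[OF M ind X Y]) auto
  \<comment> \<open>The inner integral does not depend on \<open>u\<close>, so \<open>f\<close>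
    integrates out to one. The substitution then brings \<open>f\<close> back with a new meaning of
    \<open>u\<close>.\<close>
  also have "\<dots> = (\<integral>\<^sup>+w. (\<integral>\<^sup>+y. ennreal (h y) * ennreal (f (x * exp (- k (Z w)) - (r (Z w) + y * c (Z w))) * exp (- k (Z w))) \<partial>lborel) \<partial>M)"
    by (simp add: nn_integral_multc density_total)
  also have "\<dots> = (\<integral>\<^sup>+w. (\<integral>\<^sup>+u. ennreal (f u) * ennreal (h ((x * exp (- k (Z w)) - r (Z w) - u) / c (Z w)) * (exp (- k (Z w)) / c (Z w))) \<partial>lborel) \<partial>M)"
  proof (rule nn_integral_cong)
    fix w assume "w \<in> space M"
    then have "0 < c (Z w)" using c measurable_space[OF XYZ_measurable(3)] by auto
    from nn_integral_affine_swap[OF density_measurable f h _ this, of "exp (- k (Z w))" "x * exp (- k (Z w)) - r (Z w)"]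
    show "(\<integral>\<^sup>+y. ennreal (h y) * ennreal (f (x * exp (- k (Z w)) - (r (Z w) + y * c (Z w))) * exp (- k (Z w))) \<partial>lborel)
      = (\<integral>\<^sup>+u. ennreal (f u) * ennreal (h ((x * exp (- k (Z w)) - r (Z w) - u) / c (Z w)) * (exp (- k (Z w)) / c (Z w))) \<partial>lborel)"
      by (simp add: diff_diff_eq)
  qed
  \<comment> \<open>The integration variable \<open>u\<close>, weighted by \<open>f\<close>, is
    turned back into the random variable \<open>X\<close>.\<close>
  also have "\<dots> = (\<integral>\<^sup>+w. (\<lambda>(z,u). ennreal (h ((x * exp (- k z) - r z - u) / c z) * (exp (- k z) / c z))) (Z w, X w) \<partial>M)"
    by (subst nn_integral_conditional) auto
  finally show ?thesis by simp
qed

text \<open>Identifies the right side of \<open>nn_integral_exchange_density\<close> as a density of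
  \<open>exp (k Z) * (X + r Z + Y * c Z)\<close>, in the form of test functions, which is the form
  the limit argument consumes.\<close>

lemma nn_integral_test_function:
  fixes \<Phi> :: "real \<Rightarrow> ennreal"
  assumes [measurable]: "\<Phi> \<in> borel_measurable borel"
  shows "(\<integral>\<^sup>+w. \<Phi> (exp (k (Z w)) * (X w + (r (Z w) + Y w * c (Z w)))) \<partial>M)
   = (\<integral>\<^sup>+x. \<Phi> x * (\<integral>\<^sup>+w. ennreal (h ((x * exp (- k (Z w)) - r (Z w) - X w) / c (Z w)) * (exp (- k (Z w)) / c (Z w))) \<partial>M) \<partial>lborel)"
proof -
  interpret prob_space M by (rule M)
  interpret pair_sigma_finite M lborel ..
  have "(\<integral>\<^sup>+w. \<Phi> (exp (k (Z w)) * (X w + (r (Z w) + Y w * c (Z w)))) \<partial>M)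
    = (\<integral>\<^sup>+w. (\<lambda>(z,(u,y)). \<Phi> (exp (k z) * (u + (r z + y * c z)))) (Z w, (X w, Y w)) \<partial>M)" by simp
  also have "\<dots> = (\<integral>\<^sup>+w. (\<integral>\<^sup>+u. ennreal (f u) *
      (\<integral>\<^sup>+y. ennreal (h y) * \<Phi> (exp (k (Z w)) * (u + (r (Z w) + y * c (Z w)))) \<partial>lborel) \<partial>lborel) \<partial>M)"
    by (subst nn_integral_indep3[OF M ind X Y]) auto
  also have "\<dots> = (\<integral>\<^sup>+w. (\<integral>\<^sup>+u. ennreal (f u) * (\<lambda>(z,u). \<integral>\<^sup>+x. \<Phi> x * ennreal (h ((x * exp (- k z) - r z - u) / c z) * (exp (- k z) / c z)) \<partial>lborel) (Z w, u) \<partial>lborel) \<partial>M)"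
  proof (intro nn_integral_cong arg_cong2[where f="(*)"] refl)
    fix w u assume "w \<in> space M"
    then have "0 < c (Z w)" using c measurable_space[OF XYZ_measurable(3)] by auto
    from nn_integral_affine_image[OF assms density_measurable(2) h this, of "k (Z w)" u "r (Z w)"]
    show "(\<integral>\<^sup>+y. ennreal (h y) * \<Phi> (exp (k (Z w)) * (u + (r (Z w) + y * c (Z w)))) \<partial>lborel)
      = (\<lambda>(z,u). \<integral>\<^sup>+x. \<Phi> x * ennreal (h ((x * exp (- k z) - r z - u) / c z) * (exp (- k z) / c z)) \<partial>lborel) (Z w, u)"
      by (simp add: add.assoc)
  qed
  also have "\<dots> = (\<integral>\<^sup>+w. (\<lambda>(z,u). \<integral>\<^sup>+x. \<Phi> x * ennreal (h ((x * exp (- k z) - r z - u) / c z) * (exp (- k z) / c z)) \<partial>lborel) (Z w, X w) \<partial>M)"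
    by (rule nn_integral_conditional[symmetric]) measurable
  also have "\<dots> = (\<integral>\<^sup>+w. \<integral>\<^sup>+x. \<Phi> x * ennreal (h ((x * exp (- k (Z w)) - r (Z w) - X w) / c (Z w)) * (exp (- k (Z w)) / c (Z w))) \<partial>lborel \<partial>M)"
    by simp
  also have "\<dots> = (\<integral>\<^sup>+x. \<integral>\<^sup>+w. \<Phi> x * ennreal (h ((x * exp (- k (Z w)) - r (Z w) - X w) / c (Z w)) * (exp (- k (Z w)) / c (Z w))) \<partial>M \<partial>lborel)"
    by (rule Fubini'[symmetric]) measurable
  also have "\<dots> = (\<integral>\<^sup>+x. \<Phi> x * (\<integral>\<^sup>+w. ennreal (h ((x * exp (- k (Z w)) - r (Z w) - X w) / c (Z w)) * (exp (- k (Z w)) / c (Z w))) \<partial>M) \<partial>lborel)"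
    by (intro nn_integral_cong nn_integral_cmult) measurable
  finally show ?thesis .
qed

end

section \<open>Recognising a density by Lipschitz test functions\<close>

lemma distributed_if_intervals:
  fixes X :: "'w \<Rightarrow> real" and p :: "real \<Rightarrow> ennreal"
  assumes M: "prob_space M" and [measurable]: "X \<in> borel_measurable M" "p \<in> borel_measurable borel"
    and eq: "\<And>l u. l < u \<Longrightarrow>
       (\<integral>\<^sup>+w. indicator {l<..<u} (X w) \<partial>M) = (\<integral>\<^sup>+x. indicator {l<..<u} x * p x \<partial>lborel)"
  shows "distributed M lborel X p"
proof -
  interpret prob_space M by (rule M)
  have [measurable]: "X \<in> measurable M lborel" by simp
  interpret PX: prob_space "distr M lborel X" by (rule prob_space_distr) measurable
  let ?E = "range (\<lambda>(a, b). {a<..<b::real})"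
  have "distr M lborel X = density lborel p"
  proof (rule measure_eqI_generator_eq[where E="?E" and \<Omega>=UNIV and A="\<lambda>n. {- real n<..<real n}"])
    show "Int_stable ?E"
    proof (rule Int_stableI_image)
      fix i j :: "real \<times> real"
      have "(case i of (a, b) \<Rightarrow> {a<..<b}) \<inter> (case j of (a, b) \<Rightarrow> {a<..<b})
         = (case (max (fst i) (fst j), min (snd i) (snd j)) of (a, b) \<Rightarrow> {a<..<b})"
        by (auto split: prod.splits)
      then show "\<exists>k\<in>UNIV. (case i of (a, b) \<Rightarrow> {a<..<b}) \<inter> (case j of (a, b) \<Rightarrow> {a<..<b})
         = (case k of (a, b) \<Rightarrow> {a<..<b})" by blast
    qed
    have "(\<lambda>(a, b). box a b) = (\<lambda>(a, b). {a<..<b::real})" by (auto simp: fun_eq_iff box_real)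
    moreover have "sets (borel::real measure) = sigma_sets UNIV (range (\<lambda>(a, b). box a b))"
      by (subst borel_eq_box) simp
    ultimately have "sets (borel::real measure) = sigma_sets UNIV ?E" by (simp only:)
    then show "sets (distr M lborel X) = sigma_sets UNIV ?E" "sets (density lborel p) = sigma_sets UNIV ?E"
      by simp_all
    fix R assume "R \<in> ?E"
    then obtain l u where R: "R = {l<..<u}" by auto
    show "emeasure (distr M lborel X) R = emeasure (density lborel p) R"
    proof (cases "l < u")
      case True
      have "emeasure (distr M lborel X) R = (\<integral>\<^sup>+x. indicator R x \<partial>distr M lborel X)"
        by (simp add: R)
      also have "\<dots> = (\<integral>\<^sup>+w. indicator R (X w) \<partial>M)"
        unfolding R by (rule nn_integral_distr) measurable
      also have "\<dots> = (\<integral>\<^sup>+x. p x * indicator R x \<partial>lborel)"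
        unfolding R eq[OF True] by (simp add: mult.commute)
      also have "\<dots> = emeasure (density lborel p) R"
        unfolding R by (rule emeasure_density[symmetric]) measurable
      finally show ?thesis .
    qed (simp add: R)
  next
    show "(\<Union>n. {- real n<..<real n}) = UNIV"
    proof (intro equalityI subsetI)
      fix x :: real
      obtain n :: nat where "\<bar>x\<bar> < real n" using reals_Archimedean2 by blast
      then show "x \<in> (\<Union>n. {- real n<..<real n})" by (auto intro!: exI[of _ n])
    qed simp
  qed (auto simp: PX.emeasure_finite)
  then show ?thesis by (auto simp: distributed_def)
qed

text \<open>Being Lipschitz, these functions respect L1 convergence of random variables; vanishing
  off a bounded interval, they need convergence of densities on bounded sets only. They increase
  with \<open>n\<close> to the indicator of the open interval.\<close>

definition trapezoid :: "real \<Rightarrow> real \<Rightarrow> nat \<Rightarrow> real \<Rightarrow> real" where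
  "trapezoid l u n x = min 1 (real n * max 0 (min (x - l) (u - x)))"

lemma trapezoid_props:
  shows trapezoid_nonneg: "0 \<le> trapezoid l u n x"
    and trapezoid_le_indicator: "trapezoid l u n x \<le> indicator {l<..<u} x"
    and trapezoid_lipschitz: "\<bar>trapezoid l u n x - trapezoid l u n y\<bar> \<le> real n * \<bar>x - y\<bar>"
    and trapezoid_mono: "m \<le> n \<Longrightarrow> trapezoid l u m x \<le> trapezoid l u n x"
proof -
  show "0 \<le> trapezoid l u n x" by (simp add: trapezoid_def)
  show "trapezoid l u n x \<le> indicator {l<..<u} x"
    by (auto simp: trapezoid_def indicator_def min_def max_def)
  have "\<bar>max 0 (min (x - l) (u - x)) - max 0 (min (y - l) (u - y))\<bar> \<le> \<bar>x - y\<bar>" by linarith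
  then have "real n * \<bar>max 0 (min (x - l) (u - x)) - max 0 (min (y - l) (u - y))\<bar> \<le> real n * \<bar>x - y\<bar>"
    by (rule mult_left_mono) simp
  moreover have "\<bar>trapezoid l u n x - trapezoid l u n y\<bar>
      \<le> \<bar>real n * max 0 (min (x - l) (u - x)) - real n * max 0 (min (y - l) (u - y))\<bar>"
    unfolding trapezoid_def by linarith
  ultimately show "\<bar>trapezoid l u n x - trapezoid l u n y\<bar> \<le> real n * \<bar>x - y\<bar>"
    by (simp add: right_diff_distrib[symmetric] abs_mult)
  assume "m \<le> n"
  then have "real m * max 0 (min (x - l) (u - x)) \<le> real n * max 0 (min (x - l) (u - x))"
    by (intro mult_right_mono) auto
  then show "trapezoid l u m x \<le> trapezoid l u n x" unfolding trapezoid_def by linarith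
qed

lemma trapezoid_measurable[measurable]: "trapezoid l u n \<in> borel_measurable borel"
  unfolding trapezoid_def by measurable

lemma trapezoid_SUP: "(SUP n. ennreal (trapezoid l u n x)) = indicator {l<..<u} x"
proof (cases "x \<in> {l<..<u}")
  case True
  define d where "d = min (x - l) (u - x)"
  have d: "0 < d" using True by (auto simp: d_def)
  obtain n :: nat where "1 / d \<le> real n" using real_arch_simple by blast
  then have "1 \<le> real n * d" using d by (simp add: field_simps)
  then have "trapezoid l u n x = 1" using d unfolding trapezoid_def d_def[symmetric] by simp
  then have "1 \<le> (SUP n. ennreal (trapezoid l u n x))"
    by (intro SUP_upper2[of n]) auto
  moreover have "(SUP n. ennreal (trapezoid l u n x)) \<le> 1"
    using trapezoid_le_indicator[of l u _ x] True by (intro SUP_least) (auto simp: ennreal_le_1)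
  ultimately show ?thesis using True by auto
next
  case False
  then have "trapezoid l u n x = 0" for n
    using trapezoid_le_indicator[of l u n x] trapezoid_nonneg[of l u n x] by auto
  then show ?thesis using False by simp
qed

text \<open>For a fixed trapezoid, the expectation is carried to the limit by \<open>L1\<close> and
  the Lipschitz property, and the integral against the density by \<open>unif\<close> on the
  interval. The two limits agree because \<open>test\<close> equates them along the sequence;
  monotone convergence in \<open>n\<close> then reaches the indicator.\<close>

lemma distributed_limit:
  fixes X :: "'w \<Rightarrow> real" and XN :: "nat \<Rightarrow> 'w \<Rightarrow> real" and p :: "real \<Rightarrow> real"
  assumes M: "prob_space M" and [measurable]: "X \<in> borel_measurable M" "\<And>N. XN N \<in> borel_measurable M"
      "p \<in> borel_measurable borel" "\<And>N. pN N \<in> borel_measurable borel"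
    and nn: "\<And>x. 0 \<le> p x" "\<And>N x. 0 \<le> pN N x"
    and L1: "(\<lambda>N. \<integral>\<^sup>+w. ennreal \<bar>XN N w - X w\<bar> \<partial>M) \<longlonglongrightarrow> 0"
    and test: "\<And>N \<Phi>. 1 \<le> N \<Longrightarrow> \<Phi> \<in> borel_measurable borel \<Longrightarrow>
       (\<integral>\<^sup>+w. \<Phi> (XN N w) \<partial>M) = (\<integral>\<^sup>+x. \<Phi> x * ennreal (pN N x) \<partial>lborel)"
    and unif: "\<And>\<rho>. \<exists>c :: nat \<Rightarrow> ennreal. c \<longlonglongrightarrow> 0 \<and>
       (\<forall>N x. \<bar>x\<bar> \<le> \<rho> \<longrightarrow> ennreal \<bar>pN N x - p x\<bar> \<le> c N)"
  shows "distributed M lborel X (\<lambda>x. ennreal (p x))"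
proof (rule distributed_if_intervals[OF M])
  fix l u :: real assume lu: "l < u"
  obtain c where c0: "c \<longlonglongrightarrow> 0"
    and c: "\<And>N x. \<bar>x\<bar> \<le> max \<bar>l\<bar> \<bar>u\<bar> \<Longrightarrow> ennreal \<bar>pN N x - p x\<bar> \<le> c N"
    using unif[of "max \<bar>l\<bar> \<bar>u\<bar>"] by auto
  define d where "d N = (\<integral>\<^sup>+w. ennreal \<bar>XN N w - X w\<bar> \<partial>M)" for N
  define \<tau> where "\<tau> n x = ennreal (trapezoid l u n x)" for n x
  have [measurable]: "\<tau> n \<in> borel_measurable borel" for n unfolding \<tau>_def by measurable
  have \<tau>_ind: "\<tau> n x \<le> indicator {l<..<u} x" for n x
    using trapezoid_le_indicator[of l u n x] unfolding \<tau>_def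
    by (auto simp: indicator_def ennreal_le_1 ennreal_eq_0_iff split: if_splits)
  have lip: "\<tau> n x \<le> \<tau> n y + of_nat n * ennreal \<bar>x - y\<bar>" for n x y
  proof -
    have "trapezoid l u n x \<le> trapezoid l u n y + real n * \<bar>x - y\<bar>"
      using trapezoid_lipschitz[of l u n x y] by linarith
    then show ?thesis unfolding \<tau>_def
      by (simp add: ennreal_of_nat_eq_real_of_nat ennreal_mult[symmetric] ennreal_plus[symmetric]
          trapezoid_nonneg ennreal_leI del: ennreal_plus)
  qed
  \<comment> \<open>Values are compared in \<open>ennreal\<close>, where subtraction is awkward, so
    closeness is expressed by a pair of inequalities with an added error. The indicator keeps the
    integral of that error finite.\<close>
  have dens: "\<tau> n x * ennreal (p x) \<le> \<tau> n x * ennreal (pN N x) + c N * indicator {l<..<u} x"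
       "\<tau> n x * ennreal (pN N x) \<le> \<tau> n x * ennreal (p x) + c N * indicator {l<..<u} x" for n N x
  proof -
    have *: "\<tau> n x * A \<le> \<tau> n x * B + c N * indicator {l<..<u} x" if "x \<in> {l<..<u} \<Longrightarrow> A \<le> B + c N" for A B
    proof (cases "x \<in> {l<..<u}")
      case True
      have "\<tau> n x * A \<le> \<tau> n x * B + \<tau> n x * c N"
        unfolding distrib_left[symmetric] by (rule mult_left_mono[OF that[OF True]]) simp
      also have "\<dots> \<le> \<tau> n x * B + 1 * c N"
        using \<tau>_ind[of n x] True by (intro add_left_mono mult_right_mono) auto
      finally show ?thesis using True by simp
    next
      case False
      then have "\<tau> n x = 0" using \<tau>_ind[of n x] by simp
      then show ?thesis by simp
    qed
    have **: "ennreal A \<le> ennreal B + c N" if "ennreal \<bar>A - B\<bar> \<le> c N" "0 \<le> B" for A B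
    proof -
      have "ennreal A \<le> ennreal (B + \<bar>A - B\<bar>)" by (rule ennreal_leI) linarith
      also have "\<dots> = ennreal B + ennreal \<bar>A - B\<bar>" using that by simp
      also have "\<dots> \<le> ennreal B + c N" using that by (intro add_left_mono) auto
      finally show ?thesis .
    qed
    have "\<bar>x\<bar> \<le> max \<bar>l\<bar> \<bar>u\<bar>" if "x \<in> {l<..<u}" using that by auto
    note cx = c[OF this, of N]
    show "\<tau> n x * ennreal (p x) \<le> \<tau> n x * ennreal (pN N x) + c N * indicator {l<..<u} x"
      by (intro * **) (use cx nn in \<open>auto simp: abs_minus_commute\<close>)
    show "\<tau> n x * ennreal (pN N x) \<le> \<tau> n x * ennreal (p x) + c N * indicator {l<..<u} x"
      by (intro * **) (use cx nn in auto)
  qed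
  have eq_\<tau>: "(\<integral>\<^sup>+w. \<tau> n (X w) \<partial>M) = (\<integral>\<^sup>+x. \<tau> n x * ennreal (p x) \<partial>lborel)" for n
  proof -
    \<comment> \<open>Error of the densities times the length of the interval, plus the Lipschitz
      constant of the trapezoid times the L1 distance.\<close>
    define e where "e N = c N * ennreal (u - l) + of_nat n * d N" for N
    have "e \<longlonglongrightarrow> 0 * ennreal (u - l) + of_nat n * 0"
      unfolding e_def d_def
      by (intro tendsto_add ennreal_tendsto_cmult tendsto_mult_ennreal c0 L1 tendsto_const) (auto simp: of_nat_less_top)
    then have e0: "e \<longlonglongrightarrow> 0" by simp
    have X1: "(\<integral>\<^sup>+w. \<tau> n (X w) \<partial>M) \<le> (\<integral>\<^sup>+w. \<tau> n (XN N w) \<partial>M) + of_nat n * d N" for N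
    proof -
      have "(\<integral>\<^sup>+w. \<tau> n (X w) \<partial>M) \<le> (\<integral>\<^sup>+w. \<tau> n (XN N w) + of_nat n * ennreal \<bar>XN N w - X w\<bar> \<partial>M)"
        by (intro nn_integral_mono) (subst abs_minus_commute, rule lip)
      then show ?thesis unfolding d_def by (simp add: nn_integral_add nn_integral_cmult)
    qed
    have X2: "(\<integral>\<^sup>+w. \<tau> n (XN N w) \<partial>M) \<le> (\<integral>\<^sup>+w. \<tau> n (X w) \<partial>M) + of_nat n * d N" for N
    proof -
      have "(\<integral>\<^sup>+w. \<tau> n (XN N w) \<partial>M) \<le> (\<integral>\<^sup>+w. \<tau> n (X w) + of_nat n * ennreal \<bar>XN N w - X w\<bar> \<partial>M)"
        by (intro nn_integral_mono) (rule lip)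
      then show ?thesis unfolding d_def by (simp add: nn_integral_add nn_integral_cmult)
    qed
    have C: "(\<integral>\<^sup>+x. c N * indicator {l<..<u} x \<partial>lborel) = c N * ennreal (u - l)" for N
      using lu by (subst nn_integral_cmult_indicator) auto
    have P1: "(\<integral>\<^sup>+x. \<tau> n x * ennreal (p x) \<partial>lborel) \<le> (\<integral>\<^sup>+x. \<tau> n x * ennreal (pN N x) \<partial>lborel) + c N * ennreal (u - l)" for N
      unfolding C[symmetric] by (subst nn_integral_add[symmetric]) (auto intro!: nn_integral_mono dens)
    have P2: "(\<integral>\<^sup>+x. \<tau> n x * ennreal (pN N x) \<partial>lborel) \<le> (\<integral>\<^sup>+x. \<tau> n x * ennreal (p x) \<partial>lborel) + c N * ennreal (u - l)" for N
      unfolding C[symmetric] by (subst nn_integral_add[symmetric]) (auto intro!: nn_integral_mono dens)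
    \<comment> \<open>An inequality for all large \<open>N\<close> is enough, so the index 0, about
      which \<open>test\<close> says nothing, does no harm.\<close>
    have lim: "A \<le> B" if "\<And>N. 1 \<le> N \<Longrightarrow> A \<le> B + e N" for A B :: ennreal
    proof (rule tendsto_lowerbound)
      show "(\<lambda>N. B + e N) \<longlonglongrightarrow> B" using tendsto_add[OF tendsto_const[of B] e0] by simp
      show "\<forall>\<^sub>F N in sequentially. A \<le> B + e N"
        using eventually_ge_at_top[of 1] by eventually_elim (rule that)
    qed simp
    show ?thesis
    proof (rule antisym)
      show "(\<integral>\<^sup>+w. \<tau> n (X w) \<partial>M) \<le> (\<integral>\<^sup>+x. \<tau> n x * ennreal (p x) \<partial>lborel)"
      proof (rule lim)
        fix N :: nat assume "1 \<le> N"
        note X1[of N]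
        also have "(\<integral>\<^sup>+w. \<tau> n (XN N w) \<partial>M) = (\<integral>\<^sup>+x. \<tau> n x * ennreal (pN N x) \<partial>lborel)"
          using \<open>1 \<le> N\<close> by (rule test) simp
        also note P2[of N]
        finally show "(\<integral>\<^sup>+w. \<tau> n (X w) \<partial>M) \<le> (\<integral>\<^sup>+x. \<tau> n x * ennreal (p x) \<partial>lborel) + e N"
          by (simp add: e_def add.assoc add_right_mono)
      qed
      show "(\<integral>\<^sup>+x. \<tau> n x * ennreal (p x) \<partial>lborel) \<le> (\<integral>\<^sup>+w. \<tau> n (X w) \<partial>M)"
      proof (rule lim)
        fix N :: nat assume "1 \<le> N"
        note P1[of N]
        also have "(\<integral>\<^sup>+x. \<tau> n x * ennreal (pN N x) \<partial>lborel) = (\<integral>\<^sup>+w. \<tau> n (XN N w) \<partial>M)"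
          using test[OF \<open>1 \<le> N\<close>, of "\<tau> n"] by simp
        also note X2[of N]
        finally show "(\<integral>\<^sup>+x. \<tau> n x * ennreal (p x) \<partial>lborel) \<le> (\<integral>\<^sup>+w. \<tau> n (X w) \<partial>M) + e N"
          by (simp add: e_def add_ac add_right_mono)
      qed
    qed
  qed
  have inc: "incseq (\<lambda>n. \<tau> n)" unfolding \<tau>_def
    by (intro incseq_SucI le_funI ennreal_leI trapezoid_mono) simp
  have sup: "indicator {l<..<u} x = (SUP n. \<tau> n x)" for x
    unfolding \<tau>_def by (rule trapezoid_SUP[symmetric])
  have "(\<integral>\<^sup>+w. indicator {l<..<u} (X w) \<partial>M) = (SUP n. \<integral>\<^sup>+w. \<tau> n (X w) \<partial>M)"
    unfolding sup using inc
    by (intro nn_integral_monotone_convergence_SUP) (auto simp: incseq_def le_fun_def)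
  also have "\<dots> = (SUP n. \<integral>\<^sup>+x. \<tau> n x * ennreal (p x) \<partial>lborel)" by (simp add: eq_\<tau>)
  also have "\<dots> = (\<integral>\<^sup>+x. (SUP n. \<tau> n x * ennreal (p x)) \<partial>lborel)"
    using inc by (intro nn_integral_monotone_convergence_SUP[symmetric])
      (auto simp: incseq_def le_fun_def intro!: mult_right_mono)
  also have "\<dots> = (\<integral>\<^sup>+x. indicator {l<..<u} x * ennreal (p x) \<partial>lborel)"
    unfolding sup SUP_mult_right_ennreal ..
  finally show "(\<integral>\<^sup>+w. indicator {l<..<u} (X w) \<partial>M) = (\<integral>\<^sup>+x. indicator {l<..<u} x * ennreal (p x) \<partial>lborel)" .
qed measurable

section \<open>Passage to the limit\<close>

lemma ennreal_tendsto_0_if_square: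
  fixes x :: "nat \<Rightarrow> ennreal"
  assumes "(\<lambda>N. (x N)\<^sup>2) \<longlonglongrightarrow> 0"
  shows "x \<longlonglongrightarrow> 0"
proof (rule order_tendstoI)
  fix a :: ennreal assume "0 < a"
  then have "0 < a\<^sup>2" by (simp add: zero_less_iff_neq_zero)
  with assms have "\<forall>\<^sub>F N in sequentially. (x N)\<^sup>2 < a\<^sup>2" by (rule order_tendstoD)
  then show "\<forall>\<^sub>F N in sequentially. x N < a"
    by eventually_elim (meson linorder_not_le power_mono zero_le)
qed simp

text \<open>Cauchy-Schwarz: a fixed square-integrable weight \<open>g\<close> does not spoil
  convergence to zero in mean square. It serves for the weights \<open>1\<close>,
  \<open>\<bar>x0\<bar>\<close>, \<open>\<bar>\<eta> 1\<bar>\<close> and the L1 norm of the path of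
  \<open>b\<close>.\<close>

lemma tendsto_nn_integral_mult_0:
  assumes [measurable]: "g \<in> borel_measurable M" "\<And>N. D N \<in> borel_measurable M"
    and g: "(\<integral>\<^sup>+w. (g w)\<^sup>2 \<partial>M) < \<infinity>" and D: "(\<lambda>N. \<integral>\<^sup>+w. (D N w)\<^sup>2 \<partial>M) \<longlonglongrightarrow> 0"
  shows "(\<lambda>N. \<integral>\<^sup>+w. g w * D N w \<partial>M) \<longlonglongrightarrow> 0"
proof (rule ennreal_tendsto_0_if_square, rule tendsto_sandwich[where f="\<lambda>_. 0"])
  show "(\<lambda>N. (\<integral>\<^sup>+w. (g w)\<^sup>2 \<partial>M) * (\<integral>\<^sup>+w. (D N w)\<^sup>2 \<partial>M)) \<longlonglongrightarrow> 0"
    using ennreal_tendsto_cmult[OF _ D, of "\<integral>\<^sup>+w. (g w)\<^sup>2 \<partial>M"] g by simp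
  show "\<forall>\<^sub>F N in sequentially. (\<integral>\<^sup>+w. g w * D N w \<partial>M)\<^sup>2 \<le> (\<integral>\<^sup>+w. (g w)\<^sup>2 \<partial>M) * (\<integral>\<^sup>+w. (D N w)\<^sup>2 \<partial>M)"
    by (intro always_eventually allI Cauchy_Schwarz_nn_integral) measurable
qed auto

lemma wint_measurable_param:
  assumes [measurable]: "(\<lambda>(w,s). \<alpha> w s) \<in> borel_measurable (M \<Otimes>\<^sub>M lborel)"
    "(\<lambda>(w,s). \<beta> w s) \<in> borel_measurable (M \<Otimes>\<^sub>M lborel)"
  shows "(\<lambda>w. wint (\<alpha> w) (\<beta> w)) \<in> borel_measurable M"
  unfolding wint_def prim_def by measurable

lemma integral_measurable_param:
  fixes \<alpha> :: "'w \<Rightarrow> real \<Rightarrow> real"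
  assumes [measurable]: "(\<lambda>(w,s). \<alpha> w s) \<in> borel_measurable (M \<Otimes>\<^sub>M lborel)"
  shows "(\<lambda>w. integral\<^sup>L lborel (\<alpha> w)) \<in> borel_measurable M"
proof -
  have "(\<lambda>w. \<integral>s. \<alpha> w s \<partial>lborel) \<in> borel_measurable M" by measurable
  then show ?thesis by simp
qed

lemma path_density_nonneg:
  assumes "\<And>y. 0 \<le> f y" "\<And>s. 0 \<le> q s"
  shows "0 \<le> path_density f \<alpha> \<beta> q u x"
proof -
  have "0 \<le> wint \<alpha> q" unfolding wint_def using assms by (intro integral_nonneg_AE) auto
  then show ?thesis unfolding path_density_def using assms by auto
qed

text \<open>A constant bound, the same for all \<open>x\<close>, \<open>u\<close> and sources
  \<open>\<beta>\<close>: on a probability space this settles integrability of the random densities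
  without any moment.\<close>

lemma path_density_le:
  assumes a: "integrable lborel \<alpha>" and \<kappa>: "(\<integral>s. \<bar>\<alpha> s\<bar> \<partial>lborel) \<le> \<kappa>"
    and q: "integrable lborel q" "\<And>s. 0 \<le> q s" "0 < integral\<^sup>L lborel q"
    and f: "\<And>y. 0 \<le> f y" "\<And>y. f y \<le> F"
  shows "path_density f \<alpha> \<beta> q u x \<le> F * (exp \<kappa> / (exp (-\<kappa>) * integral\<^sup>L lborel q))"
proof -
  have k: "\<bar>prim \<alpha> s\<bar> \<le> \<kappa>" for s using prim_abs_le[OF a, of s] \<kappa> by linarith
  have "exp (-\<kappa>) * integral\<^sup>L lborel q \<le> wint \<alpha> q" by (rule wint_lower[OF a q(1,2) k])
  moreover have "- integral\<^sup>L lborel \<alpha> \<le> \<kappa>"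
    using integral_abs_bound[of lborel \<alpha>] \<kappa> by linarith
  moreover have "0 < exp (-\<kappa>) * integral\<^sup>L lborel q" using q by simp
  moreover have "0 \<le> F" using f[of 0] by linarith
  ultimately show ?thesis unfolding path_density_def
    by (intro mult_mono frac_le f) auto
qed

lemma path_density_measurable:
  assumes [measurable]: "(\<lambda>(w,s). \<alpha> w s) \<in> borel_measurable (M \<Otimes>\<^sub>M lborel)"
    "(\<lambda>(w,s). \<beta> w s) \<in> borel_measurable (M \<Otimes>\<^sub>M lborel)" "q \<in> borel_measurable lborel"
    "u \<in> borel_measurable M" "f \<in> borel_measurable borel"
  shows "(\<lambda>(x,w). path_density f (\<alpha> w) (\<beta> w) q (u w) x) \<in> borel_measurable (borel \<Otimes>\<^sub>M M)"
proof -
  have [measurable]: "(\<lambda>w. wint (\<alpha> w) (\<beta> w)) \<in> borel_measurable M" "(\<lambda>w. wint (\<alpha> w) q) \<in> borel_measurable M"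
    "(\<lambda>w. integral\<^sup>L lborel (\<alpha> w)) \<in> borel_measurable M"
    by (intro wint_measurable_param integral_measurable_param; measurable)+
  show ?thesis unfolding path_density_def by measurable
qed

text \<open>The analytic core, detached from Karhunen-Loeve expansions. The error \<open>Dn\<close>
  of \<open>a\<close> gets multiplied by random weights and must vanish in mean square, whereas
  \<open>En\<close> stands alone and only its mean matters. The bound \<open>\<kappa>\<close> must
  be uniform in \<open>w\<close> because it ends up in an exponent. Premise \<open>test\<close>
  starts at \<open>1 \<le> N\<close>, since the empty truncation contains no term in
  \<open>\<eta> 1\<close>.\<close>

lemma limit_density:
  fixes M :: "'w measure" and \<alpha> b :: "nat \<Rightarrow> 'w \<Rightarrow> real \<Rightarrow> real" and \<alpha>' b' :: "'w \<Rightarrow> real \<Rightarrow> real"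
    and X Y :: "'w \<Rightarrow> real" and q f :: "real \<Rightarrow> real"
  defines "pd N x w \<equiv> path_density f (\<alpha> N w) (\<lambda>s. b N w s - Y w * q s) q (X w) x"
  defines "Dn N w \<equiv> (\<integral>\<^sup>+s. ennreal \<bar>\<alpha> N w s - \<alpha>' w s\<bar> \<partial>lborel)"
    and "En N w \<equiv> (\<integral>\<^sup>+s. ennreal \<bar>b N w s - b' w s\<bar> \<partial>lborel)"
    and "Bn w \<equiv> (\<integral>\<^sup>+s. ennreal \<bar>b' w s\<bar> \<partial>lborel)"
  assumes M: "prob_space M"
    and \<alpha>[measurable]: "\<And>N. (\<lambda>(w,s). \<alpha> N w s) \<in> borel_measurable (M \<Otimes>\<^sub>M lborel)"
       "(\<lambda>(w,s). \<alpha>' w s) \<in> borel_measurable (M \<Otimes>\<^sub>M lborel)"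
    and b[measurable]: "\<And>N. (\<lambda>(w,s). b N w s) \<in> borel_measurable (M \<Otimes>\<^sub>M lborel)"
       "(\<lambda>(w,s). b' w s) \<in> borel_measurable (M \<Otimes>\<^sub>M lborel)"
    and XY[measurable]: "X \<in> borel_measurable M" "Y \<in> borel_measurable M"
    and q: "integrable lborel q" "\<And>s. 0 \<le> q s" "0 < integral\<^sup>L lborel q"
    and f: "L-lipschitz_on UNIV f" "\<And>y. 0 \<le> f y" "\<And>y. f y \<le> F"
    and \<kappa>: "0 \<le> \<kappa>"
    and A1: "AE w in M. \<forall>N. (\<integral>\<^sup>+s. ennreal \<bar>\<alpha> N w s\<bar> \<partial>lborel) \<le> ennreal \<kappa>"
    and A2: "(\<lambda>N. \<integral>\<^sup>+w. (Dn N w)\<^sup>2 \<partial>M) \<longlonglongrightarrow> 0"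
    and B1: "(\<lambda>N. \<integral>\<^sup>+w. En N w \<partial>M) \<longlonglongrightarrow> 0"
    and B2: "(\<integral>\<^sup>+w. (Bn w)\<^sup>2 \<partial>M) < \<infinity>"
    and B3: "AE w in M. \<forall>N. (\<integral>\<^sup>+s. ennreal \<bar>b N w s\<bar> \<partial>lborel) < \<infinity>"
    and X2: "integrable M (\<lambda>w. (X w)\<^sup>2)" and Y2: "integrable M (\<lambda>w. (Y w)\<^sup>2)"
    and test: "\<And>N \<Phi>. 1 \<le> N \<Longrightarrow> \<Phi> \<in> borel_measurable borel \<Longrightarrow>
       (\<integral>\<^sup>+w. \<Phi> (path_value (\<alpha> N w) (b N w) (X w)) \<partial>M) = (\<integral>\<^sup>+x. \<Phi> x * (\<integral>\<^sup>+w. ennreal (pd N x w) \<partial>M) \<partial>lborel)"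
  shows "\<exists>p. (\<forall>x. 0 \<le> p x) \<and> p \<in> borel_measurable borel \<and>
     distributed M lborel (\<lambda>w. path_value (\<alpha>' w) (b' w) (X w)) (\<lambda>x. ennreal (p x)) \<and>
     (\<forall>N. (\<lambda>x. \<integral>w. pd N x w \<partial>M) \<in> borel_measurable borel) \<and>
     (\<forall>\<rho>. \<exists>c :: nat \<Rightarrow> ennreal. c \<longlonglongrightarrow> 0 \<and>
       (\<forall>N x. \<bar>x\<bar> \<le> \<rho> \<longrightarrow> ennreal \<bar>(\<integral>w. pd N x w \<partial>M) - p x\<bar> \<le> c N))"
proof -
  interpret prob_space M by (rule M)
  have [measurable]: "f \<in> borel_measurable borel"
    using lipschitz_on_continuous_on[OF f(1)] by (rule borel_measurable_continuous_onI)
  have [measurable]: "q \<in> borel_measurable borel" using q(1) by auto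
  define pd' where "pd' x w = path_density f (\<alpha>' w) (\<lambda>s. b' w s - Y w * q s) q (X w) x" for x w
  define P where "P = integral\<^sup>L lborel q"
  define p where "p x = (\<integral>w. pd' x w \<partial>M)" for x
  \<comment> \<open>The error term of \<open>path_density_diff\<close> with source
    \<open>b' w s - Y w * q s\<close>, whose L1 norm is at most \<open>Bn w\<close> plus
    \<open>\<bar>Y w\<bar> * P\<close>.\<close>
  define gap where "gap N w = (1 + ennreal \<bar>X w\<bar> + Bn w + ennreal (\<bar>Y w\<bar> * P)) * Dn N w + En N w" for N w
  have [measurable]: "Dn N \<in> borel_measurable M" "En N \<in> borel_measurable M" "Bn \<in> borel_measurable M" for N
    unfolding Dn_def En_def Bn_def by measurable
  have [measurable]: "gap N \<in> borel_measurable M" for N unfolding gap_def by measurable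
  have pd_m[measurable]: "(\<lambda>(x,w). pd N x w) \<in> borel_measurable (borel \<Otimes>\<^sub>M M)" for N
    unfolding pd_def by (intro path_density_measurable) measurable
  have pd'_m[measurable]: "(\<lambda>(x,w). pd' x w) \<in> borel_measurable (borel \<Otimes>\<^sub>M M)"
    unfolding pd'_def by (intro path_density_measurable) measurable
  have pd0: "0 \<le> pd N x w" "0 \<le> pd' x w" for N x w
    unfolding pd_def pd'_def by (intro path_density_nonneg f q)+
  have P0: "0 < P" using q by (simp add: P_def)

  have sq: "(\<integral>\<^sup>+w. (ennreal \<bar>V w\<bar>)\<^sup>2 \<partial>M) < \<infinity>" if "integrable M (\<lambda>w. (V w)\<^sup>2)" for V :: "'w \<Rightarrow> real"
    using that by (simp add: integrable_iff_bounded ennreal_power)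
  have D1: "(\<lambda>N. \<integral>\<^sup>+w. 1 * Dn N w \<partial>M) \<longlonglongrightarrow> 0"
    by (rule tendsto_nn_integral_mult_0[OF _ _ _ A2]) (auto simp: emeasure_space_1)
  have D2: "(\<lambda>N. \<integral>\<^sup>+w. ennreal \<bar>X w\<bar> * Dn N w \<partial>M) \<longlonglongrightarrow> 0"
    by (rule tendsto_nn_integral_mult_0[OF _ _ sq[OF X2] A2]) auto
  have D3: "(\<lambda>N. \<integral>\<^sup>+w. Bn w * Dn N w \<partial>M) \<longlonglongrightarrow> 0"
    by (rule tendsto_nn_integral_mult_0[OF _ _ B2 A2]) auto
  have D4: "(\<lambda>N. \<integral>\<^sup>+w. ennreal \<bar>Y w * P\<bar> * Dn N w \<partial>M) \<longlonglongrightarrow> 0"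
    using Y2 by (intro tendsto_nn_integral_mult_0[OF _ _ sq A2]) (auto simp: power_mult_distrib)
  have gap_int: "(\<integral>\<^sup>+w. gap N w \<partial>M) = (\<integral>\<^sup>+w. 1 * Dn N w \<partial>M) + (\<integral>\<^sup>+w. ennreal \<bar>X w\<bar> * Dn N w \<partial>M)
     + (\<integral>\<^sup>+w. Bn w * Dn N w \<partial>M) + (\<integral>\<^sup>+w. ennreal \<bar>Y w * P\<bar> * Dn N w \<partial>M) + (\<integral>\<^sup>+w. En N w \<partial>M)" for N
    unfolding gap_def using P0 by (simp add: distrib_right nn_integral_add abs_mult)
  have gap0: "(\<lambda>N. \<integral>\<^sup>+w. gap N w \<partial>M) \<longlonglongrightarrow> 0"
    using tendsto_add[OF tendsto_add[OF tendsto_add[OF tendsto_add[OF D1 D2] D3] D4] B1]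
    unfolding gap_int by simp

  \<comment> \<open>The limit path must inherit the bound \<open>\<kappa>\<close>. The infimum over
    \<open>N\<close> of \<open>Dn N\<close> has mean zero, hence vanishes almost surely; this does
    the work of an almost surely convergent subsequence.\<close>
  have "(\<integral>\<^sup>+w. (INF N. Dn N w) \<partial>M) \<le> 0"
  proof (rule tendsto_lowerbound[OF D1])
    show "\<forall>\<^sub>F N in sequentially. (\<integral>\<^sup>+w. (INF N. Dn N w) \<partial>M) \<le> (\<integral>\<^sup>+w. 1 * Dn N w \<partial>M)"
      by (intro always_eventually allI nn_integral_mono) (auto intro: INF_lower)
  qed simp
  then have inf0: "AE w in M. (INF N. Dn N w) = 0"
    by (subst (asm) le_zero_eq, subst (asm) nn_integral_0_iff_AE) auto
  have \<alpha>': "AE w in M. (\<integral>\<^sup>+s. ennreal \<bar>\<alpha>' w s\<bar> \<partial>lborel) \<le> ennreal \<kappa>"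
    using inf0 A1 AE_space
  proof eventually_elim
    case (elim w)
    note [measurable] = elim(3)
    have "(\<integral>\<^sup>+s. ennreal \<bar>\<alpha>' w s\<bar> \<partial>lborel) \<le> ennreal \<kappa> + Dn N w" for N
    proof -
      have "(\<integral>\<^sup>+s. ennreal \<bar>\<alpha>' w s\<bar> \<partial>lborel) \<le> (\<integral>\<^sup>+s. ennreal \<bar>\<alpha> N w s\<bar> + ennreal \<bar>\<alpha> N w s - \<alpha>' w s\<bar> \<partial>lborel)"
        by (intro nn_integral_mono) (simp add: ennreal_plus[symmetric] ennreal_leI del: ennreal_plus)
      also have "\<dots> = (\<integral>\<^sup>+s. ennreal \<bar>\<alpha> N w s\<bar> \<partial>lborel) + Dn N w"
        unfolding Dn_def by (rule nn_integral_add) measurable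
      also have "\<dots> \<le> ennreal \<kappa> + Dn N w" using elim(2) by (intro add_right_mono) auto
      finally show ?thesis .
    qed
    then have "(\<integral>\<^sup>+s. ennreal \<bar>\<alpha>' w s\<bar> \<partial>lborel) \<le> (INF N. ennreal \<kappa> + Dn N w)" by (rule INF_greatest)
    also have "\<dots> = ennreal \<kappa> + (INF N. Dn N w)" by (rule INF_ennreal_const_add) 
    finally show ?case using elim(1) by simp
  qed
  have "(\<integral>\<^sup>+w. (Bn w)\<^sup>2 \<partial>M) \<noteq> \<infinity>" using B2 by simp
  then have "AE w in M. (Bn w)\<^sup>2 \<noteq> \<infinity>" by (intro nn_integral_noteq_infinite) auto
  then have b'i: "AE w in M. Bn w < \<infinity>" by eventually_elim (auto simp: less_top[symmetric] power_eq_top_ennreal)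

  have int_iff: "integrable lborel h" "(\<integral>\<^sup>+s. ennreal \<bar>h s\<bar> \<partial>lborel) = ennreal (\<integral>s. \<bar>h s\<bar> \<partial>lborel)"
    if [measurable]: "h \<in> borel_measurable borel" and "(\<integral>\<^sup>+s. ennreal \<bar>h s\<bar> \<partial>lborel) < \<infinity>" for h :: "real \<Rightarrow> real"
  proof -
    show "integrable lborel h" using that by (simp add: integrable_iff_bounded)
    then show "(\<integral>\<^sup>+s. ennreal \<bar>h s\<bar> \<partial>lborel) = ennreal (\<integral>s. \<bar>h s\<bar> \<partial>lborel)"
      by (intro nn_integral_eq_integral) auto
  qed
  \<comment> \<open>A single event of full measure on which the pathwise lemmas apply for all
    \<open>N\<close> at once.\<close>
  define good where "good w \<longleftrightarrow> w \<in> space M \<and>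
     (\<forall>N. integrable lborel (\<alpha> N w) \<and> (\<integral>s. \<bar>\<alpha> N w s\<bar> \<partial>lborel) \<le> \<kappa> \<and> integrable lborel (b N w)) \<and>
     integrable lborel (\<alpha>' w) \<and> (\<integral>s. \<bar>\<alpha>' w s\<bar> \<partial>lborel) \<le> \<kappa> \<and> integrable lborel (b' w)" for w
  have good: "AE w in M. good w"
    using A1 \<alpha>' b'i B3 AE_space
  proof eventually_elim
    case (elim w)
    note [measurable] = elim(5)
    have h: "integrable lborel h \<and> (\<integral>s. \<bar>h s\<bar> \<partial>lborel) \<le> \<kappa>"
      if [measurable]: "h \<in> borel_measurable borel" and le: "(\<integral>\<^sup>+s. ennreal \<bar>h s\<bar> \<partial>lborel) \<le> ennreal \<kappa>" for h :: "real \<Rightarrow> real"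
    proof -
      have fin: "(\<integral>\<^sup>+s. ennreal \<bar>h s\<bar> \<partial>lborel) < \<infinity>" using le ennreal_less_top[of \<kappa>] by (metis infinity_ennreal_def le_less_trans)
      show ?thesis using le int_iff[OF that(1) fin] \<kappa> by simp
    qed
    have m: "\<alpha> N w \<in> borel_measurable borel" "\<alpha>' w \<in> borel_measurable borel"
      "b N w \<in> borel_measurable borel" "b' w \<in> borel_measurable borel" for N
      using measurable_Pair2[OF \<alpha>(1) elim(5), of N] measurable_Pair2[OF \<alpha>(2) elim(5)]
        measurable_Pair2[OF b(1) elim(5), of N] measurable_Pair2[OF b(2) elim(5)] by simp_all
    have "integrable lborel (b N w)" for N using elim(4) int_iff(1)[OF m(3)] by blast
    moreover have "integrable lborel (b' w)" using elim(3) int_iff(1)[OF m(4)] unfolding Bn_def by blast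
    ultimately show ?case unfolding good_def using elim(1,2,5) h[OF m(1)] h[OF m(2)] by blast
  qed
  have gap_real: "ennreal ((1 + \<bar>X w\<bar> + (\<integral>s. \<bar>b' w s\<bar> \<partial>lborel) + \<bar>Y w\<bar> * P) * (\<integral>s. \<bar>\<alpha> N w s - \<alpha>' w s\<bar> \<partial>lborel)
       + (\<integral>s. \<bar>b N w s - b' w s\<bar> \<partial>lborel)) = gap N w" if "good w" for N w
  proof -
    have 1: "Dn N w = ennreal (\<integral>s. \<bar>\<alpha> N w s - \<alpha>' w s\<bar> \<partial>lborel)" "En N w = ennreal (\<integral>s. \<bar>b N w s - b' w s\<bar> \<partial>lborel)"
       "Bn w = ennreal (\<integral>s. \<bar>b' w s\<bar> \<partial>lborel)"
      using that unfolding Dn_def En_def Bn_def good_def by (auto intro!: nn_integral_eq_integral)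
    show ?thesis unfolding gap_def 1 using P0
      by (simp add: ennreal_mult)
  qed
  \<comment> \<open>The constant depends on \<open>\<rho>\<close> alone, not on \<open>w\<close>,
    \<open>N\<close> or \<open>x\<close>: this is the source of uniformity on bounded sets. For
    negative \<open>\<rho>\<close> no \<open>x\<close> qualifies and any constant will do.\<close>
  have bound: "\<exists>c\<ge>0. \<forall>w N x. good w \<longrightarrow> \<bar>x\<bar> \<le> \<rho> \<longrightarrow> ennreal \<bar>pd N x w - pd' x w\<bar> \<le> ennreal c * gap N w" for \<rho>
  proof (cases "0 \<le> \<rho>")
    case True
    define e where "e = exp \<kappa>"
    define c where "c = L * (e\<^sup>2/P) * ((\<rho> + 2) * e^2 / P + (\<rho> + 2) * e^4 / P) + F * (e^2/P + e^4/P)"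
    have "0 \<le> F" using f(2,3)[of 0] by linarith
    then have c: "0 \<le> c" unfolding c_def using lipschitz_on_nonneg[OF f(1)] P0 True
      by (intro add_nonneg_nonneg mult_nonneg_nonneg divide_nonneg_pos) (auto simp: e_def)
    have "ennreal \<bar>pd N x w - pd' x w\<bar> \<le> ennreal c * gap N w" if w: "good w" and x: "\<bar>x\<bar> \<le> \<rho>" for N x w
    proof -
      have ib: "integrable lborel (\<lambda>s. b N w s - Y w * q s)" "integrable lborel (\<lambda>s. b' w s - Y w * q s)"
        using w q(1) unfolding good_def by auto
      have F: "\<bar>f y\<bar> \<le> F" for y using f(2,3)[of y] by simp
      have "\<bar>pd N x w - pd' x w\<bar> \<le> c * ((1 + \<bar>X w\<bar> + (\<integral>s. \<bar>b' w s - Y w * q s\<bar> \<partial>lborel)) * (\<integral>s. \<bar>\<alpha> N w s - \<alpha>' w s\<bar> \<partial>lborel)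
        + (\<integral>s. \<bar>b N w s - Y w * q s - (b' w s - Y w * q s)\<bar> \<partial>lborel))"
        unfolding c_def e_def pd_def pd'_def
        using w unfolding good_def
        by (intro path_density_diff[OF _ _ ib _ _ q(1,2) P_def P0 f(1) F x]) auto
      \<comment> \<open>The term in \<open>Y w * q s\<close> is common to both sources and cancels
        from their difference; it survives only in the norm of the limit source.\<close>
      also have "\<dots> \<le> c * ((1 + \<bar>X w\<bar> + (\<integral>s. \<bar>b' w s\<bar> \<partial>lborel) + \<bar>Y w\<bar> * P) * (\<integral>s. \<bar>\<alpha> N w s - \<alpha>' w s\<bar> \<partial>lborel)
        + (\<integral>s. \<bar>b N w s - b' w s\<bar> \<partial>lborel))"
      proof (rule mult_left_mono[OF add_mono[OF mult_right_mono] c])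
        have "(\<integral>s. \<bar>b' w s - Y w * q s\<bar> \<partial>lborel) \<le> (\<integral>s. \<bar>b' w s\<bar> + \<bar>Y w\<bar> * q s \<partial>lborel)"
        proof (rule integral_mono)
          show "\<bar>b' w s - Y w * q s\<bar> \<le> \<bar>b' w s\<bar> + \<bar>Y w\<bar> * q s" for s
            using abs_triangle_ineq4[of "b' w s" "Y w * q s"] q(2)[of s] by (simp add: abs_mult)
        qed (use ib w q(1) in \<open>auto simp: good_def\<close>)
        also have "\<dots> = (\<integral>s. \<bar>b' w s\<bar> \<partial>lborel) + \<bar>Y w\<bar> * P"
          using w q(1) unfolding P_def good_def by simp
        finally show "1 + \<bar>X w\<bar> + (\<integral>s. \<bar>b' w s - Y w * q s\<bar> \<partial>lborel) \<le> 1 + \<bar>X w\<bar> + (\<integral>s. \<bar>b' w s\<bar> \<partial>lborel) + \<bar>Y w\<bar> * P"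
          by simp
      qed auto
      finally show ?thesis
        unfolding gap_real[OF w, symmetric] using c by (subst ennreal_mult[symmetric]) (auto intro!: ennreal_leI add_nonneg_nonneg mult_nonneg_nonneg simp: P0 less_imp_le)
    qed
    then show ?thesis using c by blast
  qed (auto intro!: exI[of _ 0])
  have int_pd: "integrable M (pd N x)" "integrable M (pd' x)" for N x
  proof -
    let ?C = "F * (exp \<kappa> / (exp (- \<kappa>) * P))"
    have le: "pd N x w \<le> ?C \<and> pd' x w \<le> ?C" if "good w" for w
      unfolding pd_def pd'_def P_def using that unfolding good_def
      by (intro conjI path_density_le q f) blast+
    have "AE w in M. norm (pd N x w) \<le> ?C" "AE w in M. norm (pd' x w) \<le> ?C"
      using good by (eventually_elim, use le pd0 in auto)+
    then show "integrable M (pd N x)" "integrable M (pd' x)" by (auto intro!: integrable_const_bound)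
  qed
  have unif: "\<exists>c :: nat \<Rightarrow> ennreal. c \<longlonglongrightarrow> 0 \<and>
       (\<forall>N x. \<bar>x\<bar> \<le> \<rho> \<longrightarrow> ennreal \<bar>(\<integral>w. pd N x w \<partial>M) - p x\<bar> \<le> c N)" for \<rho>
  proof -
    obtain c where c: "\<And>w N x. good w \<Longrightarrow> \<bar>x\<bar> \<le> \<rho> \<Longrightarrow> ennreal \<bar>pd N x w - pd' x w\<bar> \<le> ennreal c * gap N w"
      using bound[of \<rho>] by blast
    have "(\<lambda>N. ennreal c * (\<integral>\<^sup>+w. gap N w \<partial>M)) \<longlonglongrightarrow> 0"
      using ennreal_tendsto_cmult[OF ennreal_less_top gap0] by simp
    moreover have "ennreal \<bar>(\<integral>w. pd N x w \<partial>M) - p x\<bar> \<le> ennreal c * (\<integral>\<^sup>+w. gap N w \<partial>M)" if x: "\<bar>x\<bar> \<le> \<rho>" for N x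
    proof -
      have "(\<integral>w. pd N x w \<partial>M) - p x = (\<integral>w. pd N x w - pd' x w \<partial>M)"
        unfolding p_def using int_pd by simp
      then have "ennreal \<bar>(\<integral>w. pd N x w \<partial>M) - p x\<bar> \<le> (\<integral>\<^sup>+w. ennreal \<bar>pd N x w - pd' x w\<bar> \<partial>M)"
        using integral_norm_bound_ennreal[of M "\<lambda>w. pd N x w - pd' x w"] int_pd by simp
      also have "\<dots> \<le> (\<integral>\<^sup>+w. ennreal c * gap N w \<partial>M)"
        by (rule nn_integral_mono_AE, rule AE_mp[OF good]) (auto intro: c[OF _ x])
      finally show ?thesis by (simp add: nn_integral_cmult)
    qed
    ultimately show ?thesis by blast
  qed
  have p_nn: "0 \<le> p x" for x unfolding p_def by (intro integral_nonneg_AE) (simp add: pd0)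
  have [measurable]: "p \<in> borel_measurable borel" "(\<lambda>x. \<integral>w. pd N x w \<partial>M) \<in> borel_measurable borel" for N
    unfolding p_def by measurable
  have pv[measurable]: "(\<lambda>w. path_value (A w) (B w) (X w)) \<in> borel_measurable M"
    if [measurable]: "(\<lambda>(w,s). A w s) \<in> borel_measurable (M \<Otimes>\<^sub>M lborel)" "(\<lambda>(w,s). B w s) \<in> borel_measurable (M \<Otimes>\<^sub>M lborel)"
    for A B
  proof -
    have [measurable]: "(\<lambda>w. wint (A w) (B w)) \<in> borel_measurable M"
      "(\<lambda>w. integral\<^sup>L lborel (A w)) \<in> borel_measurable M"
      by (intro wint_measurable_param integral_measurable_param; measurable)+
    show ?thesis unfolding path_value_def by measurable
  qed
  have "distributed M lborel (\<lambda>w. path_value (\<alpha>' w) (b' w) (X w)) (\<lambda>x. ennreal (p x))"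
  proof (rule distributed_limit[OF M, where pN="\<lambda>N x. \<integral>w. pd N x w \<partial>M" and XN="\<lambda>N w. path_value (\<alpha> N w) (b N w) (X w)"])
    show "0 \<le> (\<integral>w. pd N x w \<partial>M)" for N x by (intro integral_nonneg_AE) (simp add: pd0)
    show "(\<integral>\<^sup>+w. \<Phi> (path_value (\<alpha> N w) (b N w) (X w)) \<partial>M) = (\<integral>\<^sup>+x. \<Phi> x * ennreal (\<integral>w. pd N x w \<partial>M) \<partial>lborel)"
      if "1 \<le> N" "\<Phi> \<in> borel_measurable borel" for N \<Phi>
      using test[OF that] by (simp add: nn_integral_eq_integral int_pd pd0)
    define c where "c = 2 * (exp \<kappa>)\<^sup>2"
    have le: "ennreal \<bar>path_value (\<alpha> N w) (b N w) (X w) - path_value (\<alpha>' w) (b' w) (X w)\<bar> \<le> ennreal c * gap N w" if w: "good w" for N w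
    proof -
      have "\<bar>path_value (\<alpha> N w) (b N w) (X w) - path_value (\<alpha>' w) (b' w) (X w)\<bar>
        \<le> c * ((1 + \<bar>X w\<bar> + (\<integral>s. \<bar>b' w s\<bar> \<partial>lborel)) * (\<integral>s. \<bar>\<alpha> N w s - \<alpha>' w s\<bar> \<partial>lborel)
        + (\<integral>s. \<bar>b N w s - b' w s\<bar> \<partial>lborel))"
        unfolding c_def using w unfolding good_def by (intro path_value_diff) auto
      also have "\<dots> \<le> c * ((1 + \<bar>X w\<bar> + (\<integral>s. \<bar>b' w s\<bar> \<partial>lborel) + \<bar>Y w\<bar> * P) * (\<integral>s. \<bar>\<alpha> N w s - \<alpha>' w s\<bar> \<partial>lborel)
        + (\<integral>s. \<bar>b N w s - b' w s\<bar> \<partial>lborel))"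
        using P0 by (intro mult_left_mono add_right_mono mult_right_mono) (auto simp: c_def)
      finally show ?thesis
        unfolding gap_real[OF w, symmetric]
        by (subst ennreal_mult[symmetric]) (auto intro!: ennreal_leI add_nonneg_nonneg mult_nonneg_nonneg simp: P0 less_imp_le c_def)
    qed
    show "(\<lambda>N. \<integral>\<^sup>+w. ennreal \<bar>path_value (\<alpha> N w) (b N w) (X w) - path_value (\<alpha>' w) (b' w) (X w)\<bar> \<partial>M) \<longlonglongrightarrow> 0"
    proof (rule tendsto_sandwich[where h="\<lambda>N. ennreal c * (\<integral>\<^sup>+w. gap N w \<partial>M)" and f="\<lambda>_. 0"])
      show "(\<lambda>N. ennreal c * (\<integral>\<^sup>+w. gap N w \<partial>M)) \<longlonglongrightarrow> 0"
        using ennreal_tendsto_cmult[OF ennreal_less_top gap0] by simp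
      show "\<forall>\<^sub>F N in sequentially. (\<integral>\<^sup>+w. ennreal \<bar>path_value (\<alpha> N w) (b N w) (X w) - path_value (\<alpha>' w) (b' w) (X w)\<bar> \<partial>M)
         \<le> ennreal c * (\<integral>\<^sup>+w. gap N w \<partial>M)"
      proof (intro always_eventually allI)
        fix N
        have "AE w in M. ennreal \<bar>path_value (\<alpha> N w) (b N w) (X w) - path_value (\<alpha>' w) (b' w) (X w)\<bar> \<le> ennreal c * gap N w"
          by (rule AE_mp[OF good]) (auto intro: le)
        then show "(\<integral>\<^sup>+w. ennreal \<bar>path_value (\<alpha> N w) (b N w) (X w) - path_value (\<alpha>' w) (b' w) (X w)\<bar> \<partial>M)
         \<le> ennreal c * (\<integral>\<^sup>+w. gap N w \<partial>M)"
          by (subst nn_integral_cmult[symmetric], measurable) (rule nn_integral_mono_AE)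
      qed
    qed auto
  qed (use unif p_nn in auto)
  then show ?thesis using unif p_nn by (intro exI[of _ p]) auto
qed

section \<open>Truncated Karhunen-Loeve expansions\<close>

lemma ennreal_le_if_square_le:
  fixes x :: ennreal
  assumes "x\<^sup>2 \<le> ennreal (y\<^sup>2)" "0 \<le> y"
  shows "x \<le> ennreal y"
proof (cases x)
  case (real r)
  then have "ennreal (r\<^sup>2) \<le> ennreal (y\<^sup>2)" using assms(1) by (simp add: ennreal_power)
  then have "r\<^sup>2 \<le> y\<^sup>2" by simp
  then have "r \<le> y" using assms(2) power2_le_imp_le by blast
  then show ?thesis using real by (simp add: ennreal_leI)
next
  case top
  then show ?thesis using assms(1) by (simp add: top_unique)
qed

text \<open>Cauchy-Schwarz in time with the indicator as second factor: the passage from the L2 norm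
  of the expansions to the L1 norm of the pathwise estimates. Measurability is asked of the cut-off
  product, because means and paths are known to be measurable on the time interval only.\<close>

lemma nn_integral_abs_indicator_square:
  fixes h :: "real \<Rightarrow> real"
  assumes [measurable]: "(\<lambda>s. indicator {l<..<u} s * h s) \<in> borel_measurable lborel"
    and lu: "l \<le> u" "u \<le> v"
  shows "(\<integral>\<^sup>+s. ennreal \<bar>indicator {l<..<u} s * h s\<bar> \<partial>lborel)\<^sup>2
    \<le> ennreal (u - l) * (\<integral>\<^sup>+s. ennreal ((h s)\<^sup>2) * indicator {l..v} s \<partial>lborel)"
proof -
  define k where "k s = indicator {l<..<u} s * h s" for s
  have [measurable]: "k \<in> borel_measurable lborel" unfolding k_def by measurable
  have "(\<integral>\<^sup>+s. ennreal \<bar>k s\<bar> \<partial>lborel) = (\<integral>\<^sup>+s. indicator {l<..<u} s * ennreal \<bar>k s\<bar> \<partial>lborel)"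
    by (intro nn_integral_cong) (auto simp: k_def indicator_def)
  then have "(\<integral>\<^sup>+s. ennreal \<bar>k s\<bar> \<partial>lborel)\<^sup>2 \<le> (\<integral>\<^sup>+s. (indicator {l<..<u} s)\<^sup>2 \<partial>lborel) * (\<integral>\<^sup>+s. (ennreal \<bar>k s\<bar>)\<^sup>2 \<partial>lborel)"
    by (simp only:) (rule Cauchy_Schwarz_nn_integral; measurable)
  also have "(\<integral>\<^sup>+s. (indicator {l<..<u} s)\<^sup>2 \<partial>lborel) = (\<integral>\<^sup>+s. indicator {l<..<u} s \<partial>lborel)"
    by (intro nn_integral_cong) (auto simp: indicator_def)
  also have "\<dots> = ennreal (u - l)" using lu by simp
  also have "ennreal (u - l) * (\<integral>\<^sup>+s. (ennreal \<bar>k s\<bar>)\<^sup>2 \<partial>lborel)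
     \<le> ennreal (u - l) * (\<integral>\<^sup>+s. ennreal ((h s)\<^sup>2) * indicator {l..v} s \<partial>lborel)"
    using lu by (intro mult_left_mono nn_integral_mono) (auto simp: k_def indicator_def ennreal_power)
  finally show ?thesis unfolding k_def .
qed

section \<open>Measurability and Fubini on the product of time and probability space\<close>

lemma sigma_finite_time: "sigma_finite_measure (restrict_space lborel {t0..T::real})"
proof -
  interpret finite_measure "restrict_space lborel {t0..T}"
    by (rule finite_measureI) (simp add: emeasure_restrict_space space_restrict_space emeasure_lborel_Icc_eq)
  show ?thesis ..
qed

lemma nn_integral_time_prod:
  assumes M: "prob_space M" and F: "F \<in> borel_measurable (time_prod t0 T M)"
  shows "(\<integral>\<^sup>+v. F v \<partial>time_prod t0 T M) = (\<integral>\<^sup>+w. (\<integral>\<^sup>+s. F (s, w) * indicator {t0..T} s \<partial>lborel) \<partial>M)"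
proof -
  interpret prob_space M by (rule M)
  interpret R: sigma_finite_measure "restrict_space lborel {t0..T}" by (rule sigma_finite_time)
  interpret pair_sigma_finite "restrict_space lborel {t0..T}" M ..
  have "(\<integral>\<^sup>+v. F v \<partial>time_prod t0 T M) = (\<integral>\<^sup>+w. (\<integral>\<^sup>+s. F (s, w) \<partial>restrict_space lborel {t0..T}) \<partial>M)"
    using F unfolding time_prod_def by (intro nn_integral_snd[symmetric]) simp
  also have "\<dots> = (\<integral>\<^sup>+w. (\<integral>\<^sup>+s. F (s, w) * indicator {t0..T} s \<partial>lborel) \<partial>M)"
    by (intro nn_integral_cong nn_integral_restrict_space) simp
  finally show ?thesis .
qed

lemma time_section_measurable:
  fixes F :: "real \<times> 'w \<Rightarrow> ennreal"
  assumes F: "F \<in> borel_measurable (time_prod t0 T M)"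
  shows "(\<lambda>w. \<integral>\<^sup>+s. F (s, w) * indicator {t0..T} s \<partial>lborel) \<in> borel_measurable M"
proof -
  interpret R: sigma_finite_measure "restrict_space lborel {t0..T}" by (rule sigma_finite_time)
  have [measurable]: "(\<lambda>(w,s). F (s, w)) \<in> borel_measurable (M \<Otimes>\<^sub>M restrict_space lborel {t0..T})"
    using measurable_pair_swap[OF F[unfolded time_prod_def]] .
  have "(\<lambda>w. \<integral>\<^sup>+s. F (s, w) \<partial>restrict_space lborel {t0..T}) \<in> borel_measurable M" by measurable
  also have "(\<lambda>w. \<integral>\<^sup>+s. F (s, w) \<partial>restrict_space lborel {t0..T}) = (\<lambda>w. \<integral>\<^sup>+s. F (s, w) * indicator {t0..T} s \<partial>lborel)"
    by (intro ext nn_integral_restrict_space) simp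
  finally show ?thesis .
qed

text \<open>\<open>F\<close> is measurable only over the restricted interval. Composition with a map
  \<open>g\<close> of the line into that interval makes it measurable everywhere, and the indicator
  hides the times that \<open>g\<close> has moved.\<close>

lemma time_prod_measurable_extend:
  fixes F :: "real \<times> 'w \<Rightarrow> real"
  assumes F: "F \<in> borel_measurable (time_prod t0 T M)" and t: "t0 < t" "t \<le> T"
  shows "(\<lambda>(w,s). indicator {t0<..<t} s * F (s, w)) \<in> borel_measurable (M \<Otimes>\<^sub>M lborel)"
proof -
  define g where "g s = (if s \<in> {t0<..<t} then s else t0)" for s
  have g: "g \<in> measurable lborel (restrict_space lborel {t0..T})"
    using t unfolding g_def by (intro measurable_restrict_space2) (auto simp: measurable_If)
  have "(\<lambda>v. (g (snd v), fst v)) \<in> measurable (M \<Otimes>\<^sub>M lborel) (time_prod t0 T M)"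
    unfolding time_prod_def using measurable_compose[OF measurable_snd g] by (intro measurable_Pair) auto
  from measurable_compose[OF this F]
  have [measurable]: "(\<lambda>v. F (g (snd v), fst v)) \<in> borel_measurable (M \<Otimes>\<^sub>M lborel)" by simp
  have "(\<lambda>v. indicator {t0<..<t} (snd v) * F (g (snd v), fst v)) \<in> borel_measurable (M \<Otimes>\<^sub>M lborel)"
    by measurable
  also have "(\<lambda>v. indicator {t0<..<t} (snd v) * F (g (snd v), fst v)) = (\<lambda>(w,s). indicator {t0<..<t} s * F (s, w))"
    by (auto simp: fun_eq_iff g_def indicator_def)
  finally show ?thesis .
qed

lemma L2_interval_integrable_mult:
  assumes "L2_interval t0 T f" "L2_interval t0 T g"
  shows "set_integrable lborel {t0..T} (\<lambda>s. f s * g s)"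
proof -
  have [measurable]: "f \<in> borel_measurable lborel" "g \<in> borel_measurable lborel"
    using assms by (auto simp: L2_interval_def)
  have "set_integrable lborel {t0..T} (\<lambda>s. (f s)\<^sup>2 + (g s)\<^sup>2)"
    using assms by (intro set_integral_add) (auto simp: L2_interval_def)
  then show ?thesis unfolding set_integrable_def
  proof (rule Bochner_Integration.integrable_bound)
    have "\<bar>x * y\<bar> \<le> x\<^sup>2 + y\<^sup>2" for x y :: real
    proof -
      have "0 \<le> (\<bar>x\<bar> - \<bar>y\<bar>)\<^sup>2" "0 \<le> x\<^sup>2" "0 \<le> y\<^sup>2" by auto
      moreover have "0 \<le> \<bar>x\<bar> * \<bar>y\<bar>" by simp
      ultimately show ?thesis unfolding power2_diff abs_mult power2_abs by linarith
    qed
    then show "AE s in lborel. norm (indicat_real {t0..T} s *\<^sub>R (f s * g s)) \<le> norm (indicat_real {t0..T} s *\<^sub>R ((f s)\<^sup>2 + (g s)\<^sup>2))"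
      by (intro AE_I2) (auto simp: indicator_def)
  qed simp
qed

lemma orthonormal_pythagoras:
  assumes J: "finite J" and L2: "\<And>j. j \<in> J \<Longrightarrow> L2_interval t0 T (\<phi> j)"
    and on: "\<And>i j. i \<in> J \<Longrightarrow> j \<in> J \<Longrightarrow> (\<integral>s\<in>{t0..T}. \<phi> i s * \<phi> j s \<partial>lborel) = (if i = j then 1 else 0)"
  shows "(\<integral>\<^sup>+s. ennreal ((\<Sum>j\<in>J. c j * \<phi> j s)\<^sup>2) * indicator {t0..T} s \<partial>lborel) = ennreal (\<Sum>j\<in>J. (c j)\<^sup>2)"
proof -
  have sq: "(\<Sum>j\<in>J. c j * \<phi> j s)\<^sup>2 = (\<Sum>i\<in>J. \<Sum>j\<in>J. c i * c j * (\<phi> i s * \<phi> j s))" for s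
    by (simp add: power2_eq_square sum_product mult_ac)
  have i: "integrable lborel (\<lambda>s. indicator {t0..T} s * (\<phi> i s * \<phi> j s))" if "i \<in> J" "j \<in> J" for i j
    using L2_interval_integrable_mult[OF L2[OF that(1)] L2[OF that(2)]] by (simp add: set_integrable_def)
  have eq: "indicator {t0..T} s * (\<Sum>j\<in>J. c j * \<phi> j s)\<^sup>2
     = (\<Sum>i\<in>J. \<Sum>j\<in>J. c i * c j * (indicator {t0..T} s * (\<phi> i s * \<phi> j s)))" for s
    unfolding sq sum_distrib_left by (simp add: mult_ac)
  have int: "integrable lborel (\<lambda>s. indicator {t0..T} s * (\<Sum>j\<in>J. c j * \<phi> j s)\<^sup>2)"
    unfolding eq using i by (intro Bochner_Integration.integrable_sum integrable_mult_right) auto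
  have "(\<integral>\<^sup>+s. ennreal ((\<Sum>j\<in>J. c j * \<phi> j s)\<^sup>2) * indicator {t0..T} s \<partial>lborel)
      = (\<integral>\<^sup>+s. ennreal (indicator {t0..T} s * (\<Sum>j\<in>J. c j * \<phi> j s)\<^sup>2) \<partial>lborel)"
    by (intro nn_integral_cong) (auto simp: indicator_def)
  also have "\<dots> = ennreal (\<integral>s. indicator {t0..T} s * (\<Sum>j\<in>J. c j * \<phi> j s)\<^sup>2 \<partial>lborel)"
    by (intro nn_integral_eq_integral[OF int]) auto
  also have "(\<integral>s. indicator {t0..T} s * (\<Sum>j\<in>J. c j * \<phi> j s)\<^sup>2 \<partial>lborel)
     = (\<Sum>i\<in>J. \<Sum>j\<in>J. c i * c j * (\<integral>s. indicator {t0..T} s * (\<phi> i s * \<phi> j s) \<partial>lborel))"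
    unfolding eq using i by (subst Bochner_Integration.integral_sum; (intro Bochner_Integration.integrable_sum integrable_mult_right)?)
      (auto intro!: sum.cong simp: Bochner_Integration.integral_sum)
  also have "\<dots> = (\<Sum>i\<in>J. \<Sum>j\<in>J. c i * c j * (if i = j then 1 else 0))"
    using on by (intro sum.cong) (auto simp: set_lebesgue_integral_def)
  also have "\<dots> = (\<Sum>i\<in>J. (c i)\<^sup>2)" using J by (simp add: power2_eq_square if_distrib cong: if_cong)
  finally show ?thesis .
qed

lemma KL_idxN_props: "finite (KL_idxN n N)" "KL_idxN n N \<subseteq> KL_idx n" "N \<le> N' \<Longrightarrow> KL_idxN n N \<subseteq> KL_idxN n N'"
proof -
  have "KL_idxN n N \<subseteq> {..N}" by (auto simp: KL_idxN_def)
  then show "finite (KL_idxN n N)" by (rule finite_subset) simp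
qed (auto simp: KL_idxN_def KL_idx_def)

text \<open>Instantiated twice, for \<open>a\<close> and for \<open>b\<close>. The final time
  \<open>t\<close> is fixed here because the cut-off is part of the paths.\<close>

locale KL_process =
  fixes M :: "'w measure" and t0 T t :: real and a :: "real \<Rightarrow> 'w \<Rightarrow> real" and n :: enat
    and \<nu> :: "nat \<Rightarrow> real" and \<phi> :: "nat \<Rightarrow> real \<Rightarrow> real" and \<xi> :: "nat \<Rightarrow> 'w \<Rightarrow> real"
  assumes prob: "prob_space M" and t: "t0 < t" "t \<le> T"
    and L2: "L2_process M t0 T a" and KL: "KL_expansion M t0 T a n \<nu> \<phi> \<xi>"
begin

sublocale prob_space M by (rule prob)

definition full :: "'w \<Rightarrow> real \<Rightarrow> real" where
  "full w s = indicator {t0<..<t} s * a s w"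

text \<open>The coefficients are an arbitrary real sequence. Random coefficients give the truncated
  process, and the integration variables of \<open>f1N\<close> give the functions inside the density
  formula.\<close>

definition trunc :: "nat \<Rightarrow> (nat \<Rightarrow> real) \<Rightarrow> real \<Rightarrow> real" where
  "trunc N c s = indicator {t0<..<t} s *
     (mean_fun M a s + (\<Sum>j\<in>KL_idxN n N. sqrt (\<nu> j) * \<phi> j s * c j))"

lemma a_measurable: "(\<lambda>(s,w). a s w) \<in> borel_measurable (time_prod t0 T M)"
  using L2 by (simp add: L2_process_def)

lemma a_section: "s \<in> {t0..T} \<Longrightarrow> a s \<in> borel_measurable M"
  using measurable_Pair2[OF a_measurable[unfolded time_prod_def], of s] by (simp add: space_restrict_space)

lemma a_L2: "(\<integral>\<^sup>+v. ennreal ((case v of (s,w) \<Rightarrow> a s w)\<^sup>2) \<partial>time_prod t0 T M) < \<infinity>"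
  using L2 by (auto simp: L2_process_def integrable_iff_bounded split_beta')

lemma full_measurable[measurable]: "(\<lambda>(w,s). full w s) \<in> borel_measurable (M \<Otimes>\<^sub>M lborel)"
  using time_prod_measurable_extend[OF a_measurable t] unfolding full_def by simp

lemma mean_measurable[measurable]: "mean_fun M a \<in> borel_measurable (restrict_space lborel {t0..T})"
proof -
  have [measurable]: "(\<lambda>(s,w). a s w) \<in> borel_measurable (restrict_space lborel {t0..T} \<Otimes>\<^sub>M M)"
    using a_measurable by (simp add: time_prod_def)
  show ?thesis unfolding mean_fun_def[abs_def] by measurable
qed

lemma mean_time_prod[measurable]: "(\<lambda>v. mean_fun M a (fst v)) \<in> borel_measurable (time_prod t0 T M)"
  unfolding time_prod_def by (rule measurable_compose[OF measurable_fst mean_measurable])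

lemma mean_indicator_measurable[measurable]: "(\<lambda>s. indicator {t0<..<t} s * mean_fun M a s) \<in> borel_measurable borel"
proof -
  obtain w where "w \<in> space M" using not_empty by auto
  from measurable_Pair2[OF time_prod_measurable_extend[OF mean_time_prod t] this]
  show ?thesis by simp
qed

lemma mean_square_le:
  assumes s: "s \<in> {t0..T}"
  shows "ennreal ((mean_fun M a s)\<^sup>2) \<le> (\<integral>\<^sup>+w. ennreal ((a s w)\<^sup>2) \<partial>M)"
proof (cases "integrable M (a s)")
  case True
  note [measurable] = a_section[OF s]
  have "ennreal \<bar>mean_fun M a s\<bar> \<le> (\<integral>\<^sup>+w. 1 * ennreal \<bar>a s w\<bar> \<partial>M)"
    using integral_norm_bound_ennreal[OF True] by (simp add: mean_fun_def)
  then have "(ennreal \<bar>mean_fun M a s\<bar>)\<^sup>2 \<le> (\<integral>\<^sup>+w. 1 * ennreal \<bar>a s w\<bar> \<partial>M)\<^sup>2"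
    by (rule power_mono) simp
  also have "\<dots> \<le> (\<integral>\<^sup>+w. 1\<^sup>2 \<partial>M) * (\<integral>\<^sup>+w. (ennreal \<bar>a s w\<bar>)\<^sup>2 \<partial>M)"
    by (rule Cauchy_Schwarz_nn_integral) measurable
  finally show ?thesis by (simp add: emeasure_space_1 ennreal_power)
\<comment> \<open>At a time where \<open>a s\<close> is not integrable the Bochner integral is 0 by
  convention, so the inequality is trivial.\<close>
qed (simp add: mean_fun_def not_integrable_integral_eq)

lemma mean_L2: "(\<integral>\<^sup>+s. ennreal ((mean_fun M a s)\<^sup>2) * indicator {t0..T} s \<partial>lborel) < \<infinity>"
proof -
  have "(\<integral>\<^sup>+s. ennreal ((mean_fun M a s)\<^sup>2) * indicator {t0..T} s \<partial>lborel)
     \<le> (\<integral>\<^sup>+s. (\<integral>\<^sup>+w. ennreal ((a s w)\<^sup>2) \<partial>M) * indicator {t0..T} s \<partial>lborel)"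
    by (intro nn_integral_mono) (auto simp: indicator_def mean_square_le)
  also have "\<dots> = (\<integral>\<^sup>+s. (\<integral>\<^sup>+w. ennreal ((a s w)\<^sup>2) \<partial>M) \<partial>restrict_space lborel {t0..T})"
    by (rule nn_integral_restrict_space[symmetric]) simp
  also have "\<dots> = (\<integral>\<^sup>+v. ennreal ((case v of (s,w) \<Rightarrow> a s w)\<^sup>2) \<partial>time_prod t0 T M)"
    using nn_integral_fst[of "\<lambda>v. ennreal ((case v of (s,w) \<Rightarrow> a s w)\<^sup>2)" "restrict_space lborel {t0..T}"] a_measurable
    by (simp add: time_prod_def)
  finally show ?thesis using a_L2 by simp
qed

lemma integrable_indicator_if_L2:
  fixes h :: "real \<Rightarrow> real"
  assumes [measurable]: "(\<lambda>s. indicator {t0<..<t} s * h s) \<in> borel_measurable borel"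
    and h: "(\<integral>\<^sup>+s. ennreal ((h s)\<^sup>2) * indicator {t0..T} s \<partial>lborel) < \<infinity>"
  shows "integrable lborel (\<lambda>s. indicator {t0<..<t} s * h s)"
proof -
  have "(\<integral>\<^sup>+s. ennreal \<bar>indicator {t0<..<t} s * h s\<bar> \<partial>lborel)\<^sup>2
     \<le> ennreal (t - t0) * (\<integral>\<^sup>+s. ennreal ((h s)\<^sup>2) * indicator {t0..T} s \<partial>lborel)"
    using t by (intro nn_integral_abs_indicator_square) auto
  also have "\<dots> < \<infinity>" using h by (simp add: ennreal_mult_less_top)
  finally have "(\<integral>\<^sup>+s. ennreal \<bar>indicator {t0<..<t} s * h s\<bar> \<partial>lborel) < \<infinity>"
    by (simp add: power_less_top_ennreal)
  then show ?thesis by (simp add: integrable_iff_bounded)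
qed

lemma mean_integrable: "integrable lborel (\<lambda>s. indicator {t0<..<t} s * mean_fun M a s)"
  by (rule integrable_indicator_if_L2[OF mean_indicator_measurable mean_L2])

lemma \<phi>_measurable: "j \<in> KL_idx n \<Longrightarrow> \<phi> j \<in> borel_measurable borel"
  using KL by (auto simp: KL_expansion_def L2_interval_def)

lemma \<phi>_L2: "j \<in> KL_idx n \<Longrightarrow> L2_interval t0 T (\<phi> j)"
  using KL by (auto simp: KL_expansion_def)

lemma \<nu>_pos: "j \<in> KL_idx n \<Longrightarrow> 0 < \<nu> j"
  using KL by (auto simp: KL_expansion_def)

lemma \<xi>_measurable: "j \<in> KL_idx n \<Longrightarrow> \<xi> j \<in> borel_measurable M"
  using KL by (auto simp: KL_expansion_def)

lemma \<xi>_square: "j \<in> KL_idx n \<Longrightarrow> integrable M (\<lambda>w. (\<xi> j w)\<^sup>2)" "j \<in> KL_idx n \<Longrightarrow> (\<integral>w. (\<xi> j w)\<^sup>2 \<partial>M) = 1"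
  using KL by (auto simp: KL_expansion_def)

lemma in_idx: "j \<in> KL_idxN n N \<Longrightarrow> j \<in> KL_idx n"
  using KL_idxN_props(2) by blast

lemma \<phi>_integrable:
  assumes j: "j \<in> KL_idx n"
  shows "integrable lborel (\<lambda>s. indicator {t0<..<t} s * \<phi> j s)"
proof (rule integrable_indicator_if_L2)
  note [measurable] = \<phi>_measurable[OF j]
  show "(\<lambda>s. indicator {t0<..<t} s * \<phi> j s) \<in> borel_measurable borel" by measurable
  have "integrable lborel (\<lambda>s. indicator {t0..T} s * (\<phi> j s)\<^sup>2)"
    using \<phi>_L2[OF j] by (simp add: L2_interval_def set_integrable_def)
  then have "(\<integral>\<^sup>+s. ennreal (indicator {t0..T} s * (\<phi> j s)\<^sup>2) \<partial>lborel) < \<infinity>"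
    by (simp add: integrable_iff_bounded)
  also have "(\<integral>\<^sup>+s. ennreal (indicator {t0..T} s * (\<phi> j s)\<^sup>2) \<partial>lborel)
     = (\<integral>\<^sup>+s. ennreal ((\<phi> j s)\<^sup>2) * indicator {t0..T} s \<partial>lborel)"
    by (intro nn_integral_cong) (auto simp: indicator_def)
  finally show "(\<integral>\<^sup>+s. ennreal ((\<phi> j s)\<^sup>2) * indicator {t0..T} s \<partial>lborel) < \<infinity>" .
qed

text \<open>Attaching the indicator to each summand produces functions that are integrable on the
  whole line one by one.\<close>

lemma trunc_alt: "trunc N c = (\<lambda>s. indicator {t0<..<t} s * mean_fun M a s
    + (\<Sum>j\<in>KL_idxN n N. sqrt (\<nu> j) * c j * (indicator {t0<..<t} s * \<phi> j s)))"
  unfolding trunc_def by (simp add: fun_eq_iff distrib_left sum_distrib_left mult_ac)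

lemma trunc_integrable: "integrable lborel (trunc N c)"
  unfolding trunc_alt
  by (intro Bochner_Integration.integrable_add mean_integrable Bochner_Integration.integrable_sum
      integrable_mult_right \<phi>_integrable in_idx)

lemma trunc_measurable:
  assumes "\<And>j. j \<in> KL_idxN n N \<Longrightarrow> (\<lambda>z. c z j) \<in> borel_measurable K"
  shows "(\<lambda>(z,s). trunc N (c z) s) \<in> borel_measurable (K \<Otimes>\<^sub>M lborel)"
proof -
  have "(\<lambda>v. \<Sum>j\<in>KL_idxN n N. sqrt (\<nu> j) * c (fst v) j * (indicator {t0<..<t} (snd v) * \<phi> j (snd v)))
      \<in> borel_measurable (K \<Otimes>\<^sub>M lborel)"
  proof (rule borel_measurable_sum)
    fix j assume j: "j \<in> KL_idxN n N"
    note [measurable] = assms[OF j] \<phi>_measurable[OF in_idx[OF j]]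
    show "(\<lambda>v. sqrt (\<nu> j) * c (fst v) j * (indicator {t0<..<t} (snd v) * \<phi> j (snd v)))
      \<in> borel_measurable (K \<Otimes>\<^sub>M lborel)" by measurable
  qed
  moreover have "(\<lambda>v. indicator {t0<..<t} (snd v) * mean_fun M a (snd v)) \<in> borel_measurable (K \<Otimes>\<^sub>M lborel)"
    using measurable_compose[OF measurable_snd mean_indicator_measurable, of K] by simp
  ultimately show ?thesis unfolding trunc_alt split_beta' by (rule borel_measurable_add[rotated])
qed

definition residual :: "nat \<Rightarrow> ennreal" where
  "residual N = (\<integral>\<^sup>+ (s,w). ennreal ((a s w - mean_fun M a s
     - (\<Sum>j\<in>KL_idxN n N. sqrt (\<nu> j) * \<phi> j s * \<xi> j w))\<^sup>2) \<partial>time_prod t0 T M)"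

lemma residual_tendsto: "residual \<longlonglongrightarrow> 0"
  using KL unfolding KL_expansion_def residual_def[abs_def] by blast

lemma sum_time_prod:
  "(\<lambda>v. \<Sum>j\<in>KL_idxN n N. sqrt (\<nu> j) * \<phi> j (fst v) * \<xi> j (snd v)) \<in> borel_measurable (time_prod t0 T M)"
proof (rule borel_measurable_sum)
  fix j assume j: "j \<in> KL_idxN n N"
  have [measurable]: "\<phi> j \<in> borel_measurable (restrict_space lborel {t0..T})"
    using \<phi>_measurable[OF in_idx[OF j]] by (intro measurable_restrict_space1) simp
  note [measurable] = \<xi>_measurable[OF in_idx[OF j]]
  show "(\<lambda>v. sqrt (\<nu> j) * \<phi> j (fst v) * \<xi> j (snd v)) \<in> borel_measurable (time_prod t0 T M)"
    unfolding time_prod_def by measurable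
qed

lemma residual_measurable[measurable]:
  "(\<lambda>v. ennreal ((a (fst v) (snd v) - mean_fun M a (fst v)
     - (\<Sum>j\<in>KL_idxN n N. sqrt (\<nu> j) * \<phi> j (fst v) * \<xi> j (snd v)))\<^sup>2)) \<in> borel_measurable (time_prod t0 T M)"
proof -
  note [measurable] = sum_time_prod[of N]
  have [measurable]: "(\<lambda>v. a (fst v) (snd v)) \<in> borel_measurable (time_prod t0 T M)"
    using a_measurable by (simp add: split_beta')
  show ?thesis by measurable
qed

lemma residual_eq:
  "residual N = (\<integral>\<^sup>+w. (\<integral>\<^sup>+s. ennreal ((a s w - mean_fun M a s
     - (\<Sum>j\<in>KL_idxN n N. sqrt (\<nu> j) * \<phi> j s * \<xi> j w))\<^sup>2) * indicator {t0..T} s \<partial>lborel) \<partial>M)"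
proof -
  from nn_integral_time_prod[OF prob residual_measurable[of N]] show ?thesis unfolding residual_def by (simp add: split_beta')
qed

lemma full_square_integral:
  "(\<integral>\<^sup>+w. (\<integral>\<^sup>+s. ennreal \<bar>full w s\<bar> \<partial>lborel)\<^sup>2 \<partial>M) < \<infinity>"
proof -
  have am[measurable]: "(\<lambda>v. ennreal ((a (fst v) (snd v))\<^sup>2)) \<in> borel_measurable (time_prod t0 T M)"
    using a_measurable by (simp add: split_beta')
  have "(\<integral>\<^sup>+w. (\<integral>\<^sup>+s. ennreal \<bar>full w s\<bar> \<partial>lborel)\<^sup>2 \<partial>M)
     \<le> (\<integral>\<^sup>+w. ennreal (t - t0) * (\<integral>\<^sup>+s. ennreal ((a s w)\<^sup>2) * indicator {t0..T} s \<partial>lborel) \<partial>M)"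
  proof (rule nn_integral_mono)
    fix w assume "w \<in> space M"
    from measurable_Pair2[OF full_measurable this]
    show "(\<integral>\<^sup>+s. ennreal \<bar>full w s\<bar> \<partial>lborel)\<^sup>2
       \<le> ennreal (t - t0) * (\<integral>\<^sup>+s. ennreal ((a s w)\<^sup>2) * indicator {t0..T} s \<partial>lborel)"
      unfolding full_def using t by (intro nn_integral_abs_indicator_square) auto
  qed
  also have "\<dots> = ennreal (t - t0) * (\<integral>\<^sup>+w. (\<integral>\<^sup>+s. ennreal ((a s w)\<^sup>2) * indicator {t0..T} s \<partial>lborel) \<partial>M)"
    using time_section_measurable[OF am]
    by (intro nn_integral_cmult) simp
  also have "\<dots> = ennreal (t - t0) * (\<integral>\<^sup>+v. ennreal ((case v of (s,w) \<Rightarrow> a s w)\<^sup>2) \<partial>time_prod t0 T M)"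
    using nn_integral_time_prod[OF prob am] by (simp add: split_beta')
  also have "\<dots> < \<infinity>" using a_L2 by (simp add: ennreal_mult_less_top)
  finally show ?thesis .
qed

text \<open>For each path the squared L1 error is at most \<open>t - t0\<close> times the squared L2
  error, whose mean is \<open>residual N\<close>.\<close>

lemma trunc_error_tendsto:
  "(\<lambda>N. \<integral>\<^sup>+w. (\<integral>\<^sup>+s. ennreal \<bar>trunc N (\<lambda>j. \<xi> j w) s - full w s\<bar> \<partial>lborel)\<^sup>2 \<partial>M) \<longlonglongrightarrow> 0"
proof (rule tendsto_sandwich[where f="\<lambda>_. 0" and h="\<lambda>N. ennreal (t - t0) * residual N"])
  show "(\<lambda>N. ennreal (t - t0) * residual N) \<longlonglongrightarrow> 0"
    using ennreal_tendsto_cmult[OF ennreal_less_top residual_tendsto] by simp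
  show "\<forall>\<^sub>F N in sequentially. (\<integral>\<^sup>+w. (\<integral>\<^sup>+s. ennreal \<bar>trunc N (\<lambda>j. \<xi> j w) s - full w s\<bar> \<partial>lborel)\<^sup>2 \<partial>M)
     \<le> ennreal (t - t0) * residual N"
  proof (intro always_eventually allI)
    fix N
    define r where "r w s = a s w - mean_fun M a s - (\<Sum>j\<in>KL_idxN n N. sqrt (\<nu> j) * \<phi> j s * \<xi> j w)" for w s
    have eq: "full w s - trunc N (\<lambda>j. \<xi> j w) s = indicator {t0<..<t} s * r w s" for w s
      by (simp add: full_def trunc_def r_def algebra_simps)
    have tm: "(\<lambda>(w,s). trunc N (\<lambda>j. \<xi> j w) s) \<in> borel_measurable (M \<Otimes>\<^sub>M lborel)"
      by (intro trunc_measurable \<xi>_measurable in_idx)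
    have "(\<integral>\<^sup>+w. (\<integral>\<^sup>+s. ennreal \<bar>trunc N (\<lambda>j. \<xi> j w) s - full w s\<bar> \<partial>lborel)\<^sup>2 \<partial>M)
       \<le> (\<integral>\<^sup>+w. ennreal (t - t0) * (\<integral>\<^sup>+s. ennreal ((r w s)\<^sup>2) * indicator {t0..T} s \<partial>lborel) \<partial>M)"
    proof (rule nn_integral_mono)
      fix w assume w: "w \<in> space M"
      have [measurable]: "(\<lambda>s. trunc N (\<lambda>j. \<xi> j w) s) \<in> borel_measurable lborel"
        "(\<lambda>s. full w s) \<in> borel_measurable lborel"
        using measurable_Pair2[OF tm w] measurable_Pair2[OF full_measurable w] by simp_all
      have "(\<lambda>s. full w s - trunc N (\<lambda>j. \<xi> j w) s) \<in> borel_measurable lborel" by measurable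
      then have "(\<integral>\<^sup>+s. ennreal \<bar>indicator {t0<..<t} s * r w s\<bar> \<partial>lborel)\<^sup>2
         \<le> ennreal (t - t0) * (\<integral>\<^sup>+s. ennreal ((r w s)\<^sup>2) * indicator {t0..T} s \<partial>lborel)"
        unfolding eq using t by (intro nn_integral_abs_indicator_square) auto
      then show "(\<integral>\<^sup>+s. ennreal \<bar>trunc N (\<lambda>j. \<xi> j w) s - full w s\<bar> \<partial>lborel)\<^sup>2
         \<le> ennreal (t - t0) * (\<integral>\<^sup>+s. ennreal ((r w s)\<^sup>2) * indicator {t0..T} s \<partial>lborel)"
        unfolding eq[symmetric] by (simp add: abs_minus_commute)
    qed
    also have "\<dots> = ennreal (t - t0) * residual N"
      using time_section_measurable[OF residual_measurable[of N]] unfolding residual_eq r_def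
      by (intro nn_integral_cmult) simp
    finally show "(\<integral>\<^sup>+w. (\<integral>\<^sup>+s. ennreal \<bar>trunc N (\<lambda>j. \<xi> j w) s - full w s\<bar> \<partial>lborel)\<^sup>2 \<partial>M)
     \<le> ennreal (t - t0) * residual N" .
  qed
qed auto

lemma KL_sum_square:
  "(\<integral>\<^sup>+s. ennreal ((\<Sum>j\<in>KL_idxN n N. sqrt (\<nu> j) * \<phi> j s * c j)\<^sup>2) * indicator {t0..T} s \<partial>lborel)
    = ennreal (\<Sum>j\<in>KL_idxN n N. \<nu> j * (c j)\<^sup>2)"
proof -
  have on: "(\<integral>s\<in>{t0..T}. \<phi> i s * \<phi> j s \<partial>lborel) = (if i = j then 1 else 0)"
    if "i \<in> KL_idxN n N" "j \<in> KL_idxN n N" for i j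
    using that[THEN in_idx] KL unfolding KL_expansion_def by blast
  have "(\<integral>\<^sup>+s. ennreal ((\<Sum>j\<in>KL_idxN n N. (sqrt (\<nu> j) * c j) * \<phi> j s)\<^sup>2) * indicator {t0..T} s \<partial>lborel)
     = ennreal (\<Sum>j\<in>KL_idxN n N. (sqrt (\<nu> j) * c j)\<^sup>2)"
    by (rule orthonormal_pythagoras[OF KL_idxN_props(1) \<phi>_L2[OF in_idx] on])
  also have "(\<Sum>j\<in>KL_idxN n N. (sqrt (\<nu> j) * c j)\<^sup>2) = (\<Sum>j\<in>KL_idxN n N. \<nu> j * (c j)\<^sup>2)"
    using \<nu>_pos in_idx by (intro sum.cong) (auto simp: power_mult_distrib less_imp_le)
  finally show ?thesis by (simp add: mult_ac)
qed

text \<open>A bound on the trace of the covariance operator that never touches its kernel. For each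
  path the squared L2 norm of a partial sum is the sum of
  \<open>\<nu> j * (\<xi> j w)\<^sup>2\<close>, whose mean is the sum of the \<open>\<nu> j\<close>.
  The partial sum is also \<open>a\<close> minus its mean minus the remainder, and the second
  moments of these three are under control.\<close>

lemma eigenvalue_sum_bounded: "\<exists>V\<ge>0. \<forall>N. (\<Sum>j\<in>KL_idxN n N. \<nu> j) \<le> V"
proof -
  define Sa where "Sa = (\<integral>\<^sup>+v. ennreal ((a (fst v) (snd v))\<^sup>2) \<partial>time_prod t0 T M)"
  define Sm where "Sm = (\<integral>\<^sup>+v. ennreal ((mean_fun M a (fst v))\<^sup>2) \<partial>time_prod t0 T M)"
  have [measurable]: "(\<lambda>v. a (fst v) (snd v)) \<in> borel_measurable (time_prod t0 T M)"
    using a_measurable by (simp add: split_beta')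
  have Sa: "Sa < \<infinity>" using a_L2 by (simp add: Sa_def split_beta')
  have "Sm = (\<integral>\<^sup>+w. (\<integral>\<^sup>+s. ennreal ((mean_fun M a s)\<^sup>2) * indicator {t0..T} s \<partial>lborel) \<partial>M)"
    unfolding Sm_def by (subst nn_integral_time_prod[OF prob]) auto
  also have "\<dots> < \<infinity>" using mean_L2 by (simp add: emeasure_space_1)
  finally have Sm: "Sm < \<infinity>" .
  have key: "ennreal (\<Sum>j\<in>KL_idxN n N. \<nu> j) \<le> 2 * residual N + (4 * Sa + 4 * Sm)" for N
  proof -
    note [measurable] = sum_time_prod[of N]
    define S where "S v = (\<Sum>j\<in>KL_idxN n N. sqrt (\<nu> j) * \<phi> j (fst v) * \<xi> j (snd v))" for v
    have [measurable]: "S \<in> borel_measurable (time_prod t0 T M)" unfolding S_def by measurable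
    have "(\<integral>\<^sup>+w. ennreal (\<Sum>j\<in>KL_idxN n N. \<nu> j * (\<xi> j w)\<^sup>2) \<partial>M) = (\<integral>\<^sup>+v. ennreal ((S v)\<^sup>2) \<partial>time_prod t0 T M)"
      by (subst nn_integral_time_prod[OF prob]) (auto simp: S_def KL_sum_square)
    also have "\<dots> \<le> (\<integral>\<^sup>+v. 2 * ennreal ((a (fst v) (snd v) - mean_fun M a (fst v) - S v)\<^sup>2)
        + (4 * ennreal ((a (fst v) (snd v))\<^sup>2) + 4 * ennreal ((mean_fun M a (fst v))\<^sup>2)) \<partial>time_prod t0 T M)"
    proof (rule nn_integral_mono)
      fix v
      define y m x where "y = a (fst v) (snd v)" and "m = mean_fun M a (fst v)" and "x = S v"
      have "0 \<le> (2 * (y - m) - x)\<^sup>2" "0 \<le> (y + m)\<^sup>2" by auto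
      then have "x\<^sup>2 \<le> 2 * (y - m - x)\<^sup>2 + (4 * y\<^sup>2 + 4 * m\<^sup>2)"
        by (simp add: power2_eq_square algebra_simps)
      then have "ennreal (x\<^sup>2) \<le> ennreal (2 * (y - m - x)\<^sup>2 + (4 * y\<^sup>2 + 4 * m\<^sup>2))" by (rule ennreal_leI)
      then show "ennreal ((S v)\<^sup>2) \<le> 2 * ennreal ((a (fst v) (snd v) - mean_fun M a (fst v) - S v)\<^sup>2)
        + (4 * ennreal ((a (fst v) (snd v))\<^sup>2) + 4 * ennreal ((mean_fun M a (fst v))\<^sup>2))"
        by (simp add: y_def m_def x_def ennreal_mult)
    qed
    also have "\<dots> = 2 * residual N + (4 * Sa + 4 * Sm)"
      unfolding residual_def Sa_def Sm_def split_beta' S_def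
      by (simp add: nn_integral_add nn_integral_cmult)
    also have "(\<integral>\<^sup>+w. ennreal (\<Sum>j\<in>KL_idxN n N. \<nu> j * (\<xi> j w)\<^sup>2) \<partial>M) = ennreal (\<integral>w. (\<Sum>j\<in>KL_idxN n N. \<nu> j * (\<xi> j w)\<^sup>2) \<partial>M)"
      using \<nu>_pos in_idx \<xi>_square(1)
      by (intro nn_integral_eq_integral Bochner_Integration.integrable_sum integrable_mult_right AE_I2 sum_nonneg)
         (auto simp: less_imp_le)
    also have "(\<integral>w. (\<Sum>j\<in>KL_idxN n N. \<nu> j * (\<xi> j w)\<^sup>2) \<partial>M) = (\<Sum>j\<in>KL_idxN n N. \<nu> j)"
      using in_idx \<xi>_square by (subst Bochner_Integration.integral_sum) auto
    finally show ?thesis .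
  qed
  define V where "V = enn2real (2 * 1 + (4 * Sa + 4 * Sm))"
  have fin: "2 * 1 + (4 * Sa + 4 * Sm) < \<infinity>" using Sa Sm by (simp add: ennreal_mult_less_top)
  \<comment> \<open>Convergence bounds \<open>residual N\<close> for late indices only. The sums of
    eigenvalues increase with \<open>N\<close>, so an early index may be replaced by
    \<open>max N N0\<close>.\<close>
  have "\<forall>\<^sub>F N in sequentially. residual N < 1" using residual_tendsto by (rule order_tendstoD) simp
  then obtain N0 where N0: "\<And>N. N0 \<le> N \<Longrightarrow> residual N < 1" by (auto simp: eventually_sequentially)
  have "(\<Sum>j\<in>KL_idxN n N. \<nu> j) \<le> V" for N
  proof -
    have "(\<Sum>j\<in>KL_idxN n N. \<nu> j) \<le> (\<Sum>j\<in>KL_idxN n (max N N0). \<nu> j)"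
      using \<nu>_pos in_idx by (intro sum_mono2 KL_idxN_props) (auto intro: less_imp_le)
    moreover have "ennreal (\<Sum>j\<in>KL_idxN n (max N N0). \<nu> j) \<le> 2 * 1 + (4 * Sa + 4 * Sm)"
      using N0[of "max N N0"] by (intro order_trans[OF key] add_right_mono mult_left_mono) auto
    then have "(\<Sum>j\<in>KL_idxN n (max N N0). \<nu> j) \<le> V"
      unfolding V_def using enn2real_mono[OF _ fin[unfolded infinity_ennreal_def]] \<nu>_pos in_idx
      by (metis enn2real_ennreal less_imp_le sum_nonneg)
    ultimately show ?thesis by simp
  qed
  moreover have "0 \<le> V" by (simp add: V_def)
  ultimately show ?thesis by blast
qed

text \<open>The eigenfunctions need not be bounded, so nothing can be said at a single time; the
  estimate appears only after integration. Of the two parts of the bound, \<open>m\<close> is the L1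
  norm of the mean, and \<open>y\<close> is what Cauchy-Schwarz makes of the squared L2 bound
  \<open>A\<^sup>2 * V\<close> of the centred sum.\<close>

lemma trunc_bounded:
  assumes A: "0 < A" "\<And>j. j \<in> KL_idx n \<Longrightarrow> AE w in M. \<xi> j w \<in> {-A..A}"
  shows "\<exists>\<kappa>\<ge>0. AE w in M. \<forall>N. (\<integral>\<^sup>+s. ennreal \<bar>trunc N (\<lambda>j. \<xi> j w) s\<bar> \<partial>lborel) \<le> ennreal \<kappa>"
proof -
  obtain V where V: "0 \<le> V" "\<And>N. (\<Sum>j\<in>KL_idxN n N. \<nu> j) \<le> V" using eigenvalue_sum_bounded by auto
  define m where "m = (\<integral>s. \<bar>indicator {t0<..<t} s * mean_fun M a s\<bar> \<partial>lborel)"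
  define y where "y = sqrt ((t - t0) * (A\<^sup>2 * V))"
  have m: "0 \<le> m" "(\<integral>\<^sup>+s. ennreal \<bar>indicator {t0<..<t} s * mean_fun M a s\<bar> \<partial>lborel) = ennreal m"
    unfolding m_def using mean_integrable by (auto intro!: nn_integral_eq_integral)
  have y: "0 \<le> y" "y\<^sup>2 = (t - t0) * (A\<^sup>2 * V)" using t V by (auto simp: y_def)
  \<comment> \<open>There are countably many coefficients, so one null set serves them all, and with
    them every \<open>N\<close>.\<close>
  have "AE w in M. \<forall>j\<in>KL_idx n. \<xi> j w \<in> {-A..A}"
    using A by (intro AE_ball_countable[THEN iffD2]) auto
  then have "AE w in M. \<forall>N. (\<integral>\<^sup>+s. ennreal \<bar>trunc N (\<lambda>j. \<xi> j w) s\<bar> \<partial>lborel) \<le> ennreal (m + y)"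
  proof eventually_elim
    case (elim w)
    show ?case
    proof
      fix N
      define S where "S s = (\<Sum>j\<in>KL_idxN n N. sqrt (\<nu> j) * \<phi> j s * \<xi> j w)" for s
      have "(\<lambda>s. \<Sum>j\<in>KL_idxN n N. sqrt (\<nu> j) * \<phi> j s * \<xi> j w) \<in> borel_measurable borel"
        using \<phi>_measurable in_idx by (intro borel_measurable_sum borel_measurable_times) auto
      then have [measurable]: "S \<in> borel_measurable borel" unfolding S_def[abs_def] .
      have "(\<integral>\<^sup>+s. ennreal \<bar>indicator {t0<..<t} s * S s\<bar> \<partial>lborel)\<^sup>2
         \<le> ennreal (t - t0) * (\<integral>\<^sup>+s. ennreal ((S s)\<^sup>2) * indicator {t0..T} s \<partial>lborel)"
        using t by (intro nn_integral_abs_indicator_square) auto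
      also have "\<dots> = ennreal (t - t0) * ennreal (\<Sum>j\<in>KL_idxN n N. \<nu> j * (\<xi> j w)\<^sup>2)"
        unfolding S_def KL_sum_square ..
      also have "\<dots> \<le> ennreal (t - t0) * ennreal (A\<^sup>2 * V)"
      proof (intro mult_left_mono ennreal_leI)
        have "(\<Sum>j\<in>KL_idxN n N. \<nu> j * (\<xi> j w)\<^sup>2) \<le> (\<Sum>j\<in>KL_idxN n N. \<nu> j * A\<^sup>2)"
        proof (intro sum_mono mult_left_mono)
          fix j assume j: "j \<in> KL_idxN n N"
          then show "0 \<le> \<nu> j" using \<nu>_pos in_idx less_imp_le by blast
          have "\<bar>\<xi> j w\<bar> \<le> A" using elim in_idx[OF j] by fastforce
          then show "(\<xi> j w)\<^sup>2 \<le> A\<^sup>2" using A by (simp add: abs_le_square_iff[symmetric])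
        qed
        also have "\<dots> = A\<^sup>2 * (\<Sum>j\<in>KL_idxN n N. \<nu> j)" by (simp add: sum_distrib_left mult.commute[of _ "A\<^sup>2"])
        also have "\<dots> \<le> A\<^sup>2 * V" using V by (intro mult_left_mono) auto
        finally show "(\<Sum>j\<in>KL_idxN n N. \<nu> j * (\<xi> j w)\<^sup>2) \<le> A\<^sup>2 * V" .
      qed simp
      also have "\<dots> = ennreal (y\<^sup>2)" unfolding y(2) using t V by (intro ennreal_mult[symmetric]) auto
      finally have S: "(\<integral>\<^sup>+s. ennreal \<bar>indicator {t0<..<t} s * S s\<bar> \<partial>lborel) \<le> ennreal y"
        using y(1) by (rule ennreal_le_if_square_le)
      have "(\<integral>\<^sup>+s. ennreal \<bar>trunc N (\<lambda>j. \<xi> j w) s\<bar> \<partial>lborel)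
        \<le> (\<integral>\<^sup>+s. ennreal \<bar>indicator {t0<..<t} s * mean_fun M a s\<bar> + ennreal \<bar>indicator {t0<..<t} s * S s\<bar> \<partial>lborel)"
        unfolding trunc_def S_def[symmetric]
        by (intro nn_integral_mono) (simp add: ennreal_plus[symmetric] distrib_left ennreal_leI abs_triangle_ineq del: ennreal_plus)
      also have "\<dots> = ennreal m + (\<integral>\<^sup>+s. ennreal \<bar>indicator {t0<..<t} s * S s\<bar> \<partial>lborel)"
        unfolding m(2)[symmetric] using mean_indicator_measurable by (intro nn_integral_add) auto
      also have "\<dots> \<le> ennreal m + ennreal y" using S by (rule add_left_mono)
      also have "\<dots> = ennreal (m + y)" using m y by simp
      finally show "(\<integral>\<^sup>+s. ennreal \<bar>trunc N (\<lambda>j. \<xi> j w) s\<bar> \<partial>lborel) \<le> ennreal (m + y)" .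
    qed
  qed
  then show ?thesis using m y by (intro exI[of _ "m + y"]) auto
qed

end

section \<open>The random linear equation\<close>

locale KL_equation =
  A: KL_process M t0 T t a na \<nu> \<phi> \<xi> + B: KL_process M t0 T t b nb \<gamma> \<psi> \<eta>
  for M :: "'w measure" and t0 T t :: real and a :: "real \<Rightarrow> 'w \<Rightarrow> real" and na \<nu> \<phi> \<xi>
    and b :: "real \<Rightarrow> 'w \<Rightarrow> real" and nb \<gamma> \<psi> \<eta> +
  fixes x0 :: "'w \<Rightarrow> real" and f0 f\<eta>1 :: "real \<Rightarrow> real" and g :: "nat \<Rightarrow> ((nat + nat) \<Rightarrow> real) \<Rightarrow> real"
  assumes x0_rv: "x0 \<in> borel_measurable M"
    and nb1: "1 \<le> nb"
    and f0_nonneg: "\<And>x. 0 \<le> f0 x"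
    and f0_dens: "distributed M lborel x0 (\<lambda>x. ennreal (f0 x))"
    and f\<eta>1_nonneg: "\<And>x. 0 \<le> f\<eta>1 x"
    and f\<eta>1_dens: "distributed M lborel (\<eta> 1) (\<lambda>x. ennreal (f\<eta>1 x))"
    and g_nonneg: "\<And>N z. 0 \<le> g N z"
    and g_dens: "\<And>N. 1 \<le> N \<Longrightarrow> distributed M (RN (idx_full na nb N))
                   (xieta_vec \<xi> \<eta> (idx_full na nb N)) (\<lambda>z. ennreal (g N z))"
    and x0_square: "integrable M (\<lambda>w. (x0 w)\<^sup>2)"
    and indep: "\<And>N. 1 \<le> N \<Longrightarrow> indep3 M lborel x0 lborel (\<eta> 1)
                 (RN (idx_rest na nb N)) (xieta_vec \<xi> \<eta> (idx_rest na nb N))"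
    and lipschitz: "\<exists>L. L-lipschitz_on UNIV f\<eta>1"
    and \<xi>_bounded: "\<exists>A>0. \<forall>j\<in>KL_idx na. AE w in M. \<xi> j w \<in> {-A..A}"
    and \<psi>_pos: "\<forall>s\<in>{t0<..<T}. \<psi> 1 s > 0"
begin

text \<open>The interval integral runs over the open interval from \<open>t0\<close> to
  \<open>s\<close>. The strict cut in \<open>prim\<close> and the open indicator in
  \<open>trunc\<close> reproduce it exactly, so the integrands agree at every point.\<close>

lemma K_a_eq_prim:
  assumes "t0 \<le> s" "s \<le> t"
  shows "K_a M a t0 na \<nu> \<phi> N s z = prim (A.trunc N (\<lambda>j. z (Inl j))) s"
  unfolding K_a_def prim_def interval_lebesgue_integral_def set_lebesgue_integral_def A.trunc_def
  using assms by (auto intro!: Bochner_Integration.integral_cong simp: einterval_eq indicator_def)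

lemma K_a_eq_integral: "K_a M a t0 na \<nu> \<phi> N t z = integral\<^sup>L lborel (A.trunc N (\<lambda>j. z (Inl j)))"
  unfolding K_a_def interval_lebesgue_integral_def set_lebesgue_integral_def A.trunc_def
  using A.t by (auto intro!: Bochner_Integration.integral_cong simp: einterval_eq indicator_def)

lemma S_b_eq_wint:
  "(LBINT s=t0..t. S_b M b nb \<gamma> \<psi> N s z * exp (- K_a M a t0 na \<nu> \<phi> N s z))
    = wint (A.trunc N (\<lambda>j. z (Inl j))) (B.trunc N (\<lambda>i. z (Inr i)))"
  unfolding wint_def interval_lebesgue_integral_def set_lebesgue_integral_def B.trunc_def S_b_def
  using A.t by (auto intro!: Bochner_Integration.integral_cong simp: einterval_eq indicator_def K_a_eq_prim)

lemma AE_full_integrable: "AE w in M. integrable lborel (A.full w)"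
proof -
  have "AE w in M. (\<integral>\<^sup>+s. ennreal \<bar>A.full w s\<bar> \<partial>lborel)\<^sup>2 \<noteq> \<infinity>"
    using A.full_square_integral by (intro nn_integral_noteq_infinite) auto
  then show ?thesis using AE_space
  proof eventually_elim
    case (elim w)
    have "A.full w \<in> borel_measurable lborel" using measurable_Pair2[OF A.full_measurable elim(2)] by simp
    moreover have "(\<integral>\<^sup>+s. ennreal \<bar>A.full w s\<bar> \<partial>lborel) < \<infinity>"
      using elim(1) by (auto simp: less_top[symmetric] power_eq_top_ennreal)
    ultimately show ?case by (simp add: integrable_iff_bounded)
  qed
qed

text \<open>The integral of \<open>a\<close> from \<open>s\<close> to \<open>t\<close> is split as a
  difference of primitives, which requires the path to be integrable; this is why the two forms of
  the solution are identified only almost surely.\<close>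

lemma sol_eq_path_value:
  assumes i: "integrable lborel (A.full w)"
  shows "sol x0 a b t0 t w = path_value (A.full w) (B.full w) (x0 w)"
proof -
  define K where "K = integral\<^sup>L lborel (A.full w)"
  have 1: "(LBINT s=t0..t. a s w) = K"
    unfolding K_def interval_lebesgue_integral_def set_lebesgue_integral_def A.full_def
    using A.t by (auto intro!: Bochner_Integration.integral_cong simp: einterval_eq indicator_def)
  have 2: "(LBINT r=s..t. a r w) = K - prim (A.full w) s" if s: "s \<in> {t0<..<t}" for s
  proof -
    have "K - prim (A.full w) s = (\<integral>r. A.full w r - (if r < s then A.full w r else 0) \<partial>lborel)"
      unfolding K_def prim_def using i integrable_cut[OF i] by simp
    also have "\<dots> = (\<integral>r. indicator {s<..<t} r * A.full w r \<partial>lborel)"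
    \<comment> \<open>The difference includes the point \<open>r = s\<close>, the open interval does
      not.\<close>
    proof (rule integral_cong_AE)
      have [measurable]: "A.full w \<in> borel_measurable borel" using i by auto
      show "(\<lambda>r. A.full w r - (if r < s then A.full w r else 0)) \<in> borel_measurable lborel"
        "(\<lambda>r. indicator {s<..<t} r * A.full w r) \<in> borel_measurable lborel" by measurable
      show "AE r in lborel. A.full w r - (if r < s then A.full w r else 0) = indicator {s<..<t} r * A.full w r"
        using AE_lborel_singleton[of s] by eventually_elim (auto simp: A.full_def indicator_def)
    qed
    also have "\<dots> = (LBINT r=s..t. a r w)"
      unfolding interval_lebesgue_integral_def set_lebesgue_integral_def A.full_def
      using s by (auto intro!: Bochner_Integration.integral_cong simp: einterval_eq indicator_def)
    finally show ?thesis by simp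
  qed
  have "(LBINT s=t0..t. b s w * exp (LBINT r=s..t. a r w)) = (\<integral>s. exp K * (B.full w s * exp (- prim (A.full w) s)) \<partial>lborel)"
    unfolding interval_lebesgue_integral_def[of _ "ereal t0"] set_lebesgue_integral_def B.full_def
    using A.t by (auto intro!: Bochner_Integration.integral_cong simp: einterval_eq indicator_def 2 exp_diff exp_minus field_simps)
  then show ?thesis
    unfolding sol_def path_value_def wint_def 1 K_def[symmetric] by (simp add: algebra_simps)
qed

section \<open>Splitting off the first coefficient of b and identifying the approximating
  densities\<close>

definition q :: "real \<Rightarrow> real" where
  "q s = sqrt (\<gamma> 1) * (indicator {t0<..<t} s * \<psi> 1 s)"

lemma one_in_idx: "1 \<in> KL_idx nb" and one_in_idxN: "1 \<le> N \<Longrightarrow> 1 \<in> KL_idxN nb N"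
  using nb1 by (auto simp: KL_idx_def KL_idxN_def one_enat_def)

lemma q_integrable: "integrable lborel q"
  unfolding q_def using B.\<phi>_integrable[OF one_in_idx] by simp

lemma q_nonneg: "0 \<le> q s"
  using \<psi>_pos A.t B.\<nu>_pos[OF one_in_idx] by (auto simp: q_def indicator_def less_imp_le)

lemma q_integral_pos: "0 < integral\<^sup>L lborel q"
proof (rule ccontr)
  assume "\<not> ?thesis"
  then have "integral\<^sup>L lborel q = 0" using integral_nonneg_AE[of q lborel] q_nonneg by (simp add: antisym)
  then have "AE s in lborel. q s = 0"
    using integral_nonneg_eq_0_iff_AE[OF q_integrable] q_nonneg by simp
  then have "AE s in lborel. s \<notin> {t0<..<t}"
  proof eventually_elim
    case (elim s)
    have "0 < sqrt (\<gamma> 1)" using B.\<nu>_pos[OF one_in_idx] by simp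
    then show ?case using elim \<psi>_pos A.t by (force simp: q_def)
  qed
  then have "emeasure lborel {t0<..<t} = 0"
    using AE_iff_null_sets[of "{t0<..<t}" lborel] by auto
  then show False using A.t by simp
qed

text \<open>Index 1 is kept with coefficient 0 instead of being deleted, so the remaining source is
  again a value of \<open>B.trunc\<close> and inherits its integrability and measurability.\<close>

lemma trunc_remove_first:
  assumes N: "1 \<le> N"
  shows "B.trunc N c s = B.trunc N (\<lambda>i. if i = 1 then 0 else c i) s + c 1 * q s"
proof -
  have "(\<Sum>i\<in>KL_idxN nb N. sqrt (\<gamma> i) * \<psi> i s * c i)
     = sqrt (\<gamma> 1) * \<psi> 1 s * c 1 + (\<Sum>i\<in>KL_idxN nb N - {1}. sqrt (\<gamma> i) * \<psi> i s * c i)"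
    by (rule sum.remove[OF KL_idxN_props(1) one_in_idxN[OF N]])
  moreover have "(\<Sum>i\<in>KL_idxN nb N. sqrt (\<gamma> i) * \<psi> i s * (if i = 1 then 0 else c i))
     = (\<Sum>i\<in>KL_idxN nb N - {1}. sqrt (\<gamma> i) * \<psi> i s * c i)"
    by (subst sum.remove[OF KL_idxN_props(1) one_in_idxN[OF N]]) (auto intro!: sum.cong)
  ultimately show ?thesis unfolding B.trunc_def q_def by (simp add: algebra_simps)
qed

abbreviation "\<alpha> N w \<equiv> A.trunc N (\<lambda>j. \<xi> j w)"
abbreviation "\<beta> N w \<equiv> B.trunc N (\<lambda>i. \<eta> i w)"
abbreviation "pd N x w \<equiv> path_density f\<eta>1 (\<alpha> N w) (\<lambda>s. \<beta> N w s - \<eta> 1 w * q s) q (x0 w) x"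

text \<open>Given the remaining coefficients \<open>z\<close>, the truncated solution at time \<open>t\<close> is
  \<open>exp (k N z) * (x0 + r N z + \<eta> 1 * c N z)\<close>.\<close>
definition k :: "nat \<Rightarrow> ((nat + nat) \<Rightarrow> real) \<Rightarrow> real" where
  "k N z = integral\<^sup>L lborel (A.trunc N (\<lambda>j. z (Inl j)))"
definition r :: "nat \<Rightarrow> ((nat + nat) \<Rightarrow> real) \<Rightarrow> real" where
  "r N z = wint (A.trunc N (\<lambda>j. z (Inl j))) (B.trunc N (\<lambda>i. if i = 1 then 0 else z (Inr i)))"
definition c :: "nat \<Rightarrow> ((nat + nat) \<Rightarrow> real) \<Rightarrow> real" where
  "c N z = wint (A.trunc N (\<lambda>j. z (Inl j))) q"

lemma component_measurable: "i \<in> D \<Longrightarrow> (\<lambda>z. z i) \<in> borel_measurable (RN D)"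
  unfolding RN_def using measurable_component_singleton[of i D "\<lambda>_. lborel"] by simp

lemma trunc_Inl_measurable:
  assumes "Inl ` KL_idxN na N \<subseteq> D"
  shows "(\<lambda>(z,s). A.trunc N (\<lambda>j. z (Inl j)) s) \<in> borel_measurable (RN D \<Otimes>\<^sub>M lborel)"
  using assms by (intro A.trunc_measurable component_measurable) auto

lemma krc_measurable:
  shows k_measurable: "k N \<in> borel_measurable (RN (idx_rest na nb N))"
    and r_measurable: "r N \<in> borel_measurable (RN (idx_rest na nb N))"
    and c_measurable: "c N \<in> borel_measurable (RN (idx_rest na nb N))"
proof -
  have [measurable]: "(\<lambda>(z,s). A.trunc N (\<lambda>j. z (Inl j)) s) \<in> borel_measurable (RN (idx_rest na nb N) \<Otimes>\<^sub>M lborel)"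
    by (rule trunc_Inl_measurable) (simp add: idx_rest_def)
  have [measurable]: "(\<lambda>(z,s). B.trunc N (\<lambda>i. if i = 1 then 0 else z (Inr i)) s) \<in> borel_measurable (RN (idx_rest na nb N) \<Otimes>\<^sub>M lborel)"
  proof (rule B.trunc_measurable)
    fix i assume "i \<in> KL_idxN nb N"
    then show "(\<lambda>z. if i = 1 then 0 else z (Inr i)) \<in> borel_measurable (RN (idx_rest na nb N))"
      by (cases "i = 1") (auto intro!: component_measurable simp: idx_rest_def)
  qed
  have [measurable]: "q \<in> borel_measurable borel" using q_integrable by auto
  show "k N \<in> borel_measurable (RN (idx_rest na nb N))"
    unfolding k_def[abs_def] by (rule integral_measurable_param) measurable
  show "r N \<in> borel_measurable (RN (idx_rest na nb N))"
    unfolding r_def[abs_def] by (rule wint_measurable_param) measurable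
  show "c N \<in> borel_measurable (RN (idx_rest na nb N))"
    unfolding c_def[abs_def] by (rule wint_measurable_param) measurable
qed

lemma trunc_vec_Inl:
  assumes "Inl ` KL_idxN na N \<subseteq> D"
  shows "A.trunc N (\<lambda>j. xieta_vec \<xi> \<eta> D w (Inl j)) = \<alpha> N w"
  unfolding A.trunc_def using assms
  by (intro ext arg_cong2[where f="(*)"] arg_cong2[where f="(+)"] refl sum.cong) (auto simp: xieta_vec_def)

lemma trunc_vec_Inr:
  assumes "Inr ` KL_idxN nb N \<subseteq> D"
  shows "B.trunc N (\<lambda>i. xieta_vec \<xi> \<eta> D w (Inr i)) = \<beta> N w"
  unfolding B.trunc_def using assms
  by (intro ext arg_cong2[where f="(*)"] arg_cong2[where f="(+)"] refl sum.cong) (auto simp: xieta_vec_def)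

lemma trunc_vec_rest:
  assumes N: "1 \<le> N"
  shows "B.trunc N (\<lambda>i. if i = 1 then 0 else xieta_vec \<xi> \<eta> (idx_rest na nb N) w (Inr i)) = (\<lambda>s. \<beta> N w s - \<eta> 1 w * q s)"
proof -
  have "B.trunc N (\<lambda>i. if i = 1 then 0 else xieta_vec \<xi> \<eta> (idx_rest na nb N) w (Inr i))
     = B.trunc N (\<lambda>i. if i = 1 then 0 else \<eta> i w)"
    unfolding B.trunc_def
    by (intro ext arg_cong2[where f="(*)"] arg_cong2[where f="(+)"] refl sum.cong) (auto simp: xieta_vec_def idx_rest_def)
  also have "\<dots> = (\<lambda>s. \<beta> N w s - \<eta> 1 w * q s)"
    using trunc_remove_first[OF N, of "\<lambda>i. \<eta> i w"] by (simp add: fun_eq_iff)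
  finally show ?thesis .
qed

context
  fixes N :: nat assumes N: "1 \<le> N"
begin

abbreviation "Z \<equiv> xieta_vec \<xi> \<eta> (idx_rest na nb N)"

lemma mixture: "affine_mixture M x0 (\<eta> 1) Z (RN (idx_rest na nb N)) f0 f\<eta>1 (k N) (r N) (c N)"
proof (rule affine_mixture.intro)
  show "0 < c N z" for z
    unfolding c_def by (intro wint_pos A.trunc_integrable q_integrable q_nonneg q_integral_pos)
qed (fact A.prob indep[OF N] f0_dens f\<eta>1_dens f0_nonneg f\<eta>1_nonneg krc_measurable)+

lemma k_Z: "k N (Z w) = integral\<^sup>L lborel (\<alpha> N w)"
  unfolding k_def by (subst trunc_vec_Inl) (auto simp: idx_rest_def)

lemma c_Z: "c N (Z w) = wint (\<alpha> N w) q"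
  unfolding c_def by (subst trunc_vec_Inl) (auto simp: idx_rest_def)

lemma r_Z: "r N (Z w) = wint (\<alpha> N w) (\<lambda>s. \<beta> N w s - \<eta> 1 w * q s)"
  unfolding r_def trunc_vec_rest[OF N] by (subst trunc_vec_Inl) (auto simp: idx_rest_def)

lemma rc_Z: "r N (Z w) + \<eta> 1 w * c N (Z w) = wint (\<alpha> N w) (\<beta> N w)"
  unfolding r_Z c_Z
  using wint_add[OF A.trunc_integrable[of N "\<lambda>j. \<xi> j w"] _ q_integrable, of "\<lambda>s. \<beta> N w s - \<eta> 1 w * q s" "\<eta> 1 w"]
    B.trunc_integrable q_integrable by simp

lemma pd_Z: "f\<eta>1 ((x * exp (- k N (Z w)) - r N (Z w) - x0 w) / c N (Z w)) * (exp (- k N (Z w)) / c N (Z w)) = pd N x w"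
  unfolding path_density_def k_Z r_Z c_Z ..

lemma test_function:
  assumes "\<Phi> \<in> borel_measurable borel"
  shows "(\<integral>\<^sup>+w. \<Phi> (path_value (\<alpha> N w) (\<beta> N w) (x0 w)) \<partial>M)
    = (\<integral>\<^sup>+x. \<Phi> x * (\<integral>\<^sup>+w. ennreal (pd N x w) \<partial>M) \<partial>lborel)"
  using affine_mixture.nn_integral_test_function[OF mixture assms]
  unfolding pd_Z unfolding rc_Z k_Z path_value_def .

text \<open>The integral against \<open>g\<close> is an expectation over the full coefficient
  vector; written through \<open>Z\<close> and \<open>\<eta> 1\<close> it is the left side of
  \<open>nn_integral_exchange_density\<close>.\<close>

lemma f1N_eq: "f1N M t0 a b na \<nu> \<phi> nb \<gamma> \<psi> f0 g N x t = (\<integral>w. pd N x w \<partial>M)"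
proof -
  interpret X: affine_mixture M x0 "\<eta> 1" Z "RN (idx_rest na nb N)" f0 f\<eta>1 "k N" "r N" "c N"
    by (rule mixture)
  note [measurable] = X.density_measurable X.XYZ_measurable krc_measurable
  let ?D = "idx_full na nb N"
  define h where "h z = f0 (x * exp (- integral\<^sup>L lborel (A.trunc N (\<lambda>j. z (Inl j))))
      - wint (A.trunc N (\<lambda>j. z (Inl j))) (B.trunc N (\<lambda>i. z (Inr i))))
      * exp (- integral\<^sup>L lborel (A.trunc N (\<lambda>j. z (Inl j))))" for z
  have [measurable]: "(\<lambda>(z,s). A.trunc N (\<lambda>j. z (Inl j)) s) \<in> borel_measurable (RN ?D \<Otimes>\<^sub>M lborel)"
    by (rule trunc_Inl_measurable) (simp add: idx_full_def)
  have [measurable]: "(\<lambda>(z,s). B.trunc N (\<lambda>i. z (Inr i)) s) \<in> borel_measurable (RN ?D \<Otimes>\<^sub>M lborel)"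
    by (intro B.trunc_measurable component_measurable) (auto simp: idx_full_def)
  have [measurable]: "(\<lambda>z. integral\<^sup>L lborel (A.trunc N (\<lambda>j. z (Inl j)))) \<in> borel_measurable (RN ?D)"
    "(\<lambda>z. wint (A.trunc N (\<lambda>j. z (Inl j))) (B.trunc N (\<lambda>i. z (Inr i)))) \<in> borel_measurable (RN ?D)"
    by (rule integral_measurable_param wint_measurable_param; measurable)+
  have hm: "h \<in> borel_measurable (RN ?D)" unfolding h_def by measurable
  have hX: "h (xieta_vec \<xi> \<eta> ?D w) = f0 (x * exp (- k N (Z w)) - (r N (Z w) + \<eta> 1 w * c N (Z w))) * exp (- k N (Z w))" for w
  proof -
    have "A.trunc N (\<lambda>j. xieta_vec \<xi> \<eta> ?D w (Inl j)) = \<alpha> N w" "B.trunc N (\<lambda>i. xieta_vec \<xi> \<eta> ?D w (Inr i)) = \<beta> N w"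
      by (rule trunc_vec_Inl trunc_vec_Inr; simp add: idx_full_def)+
    then show ?thesis unfolding h_def rc_Z k_Z by simp
  qed
  have nn: "0 \<le> pd N x w" for w by (intro path_density_nonneg f\<eta>1_nonneg q_nonneg)
  have pdm: "pd N x \<in> borel_measurable M"
    unfolding pd_Z[symmetric] by measurable
  have "f1N M t0 a b na \<nu> \<phi> nb \<gamma> \<psi> f0 g N x t = (\<integral>z. g N z * h z \<partial>RN ?D)"
    unfolding f1N_def S_b_eq_wint K_a_eq_integral h_def by (simp add: mult_ac)
  also have "\<dots> = (\<integral>w. h (xieta_vec \<xi> \<eta> ?D w) \<partial>M)"
    by (rule distributed_integral[OF g_dens[OF N] hm]) (rule g_nonneg)
  \<comment> \<open>The exchange is available for nonnegative integrals. Passing through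
    \<open>enn2real\<close> respects the Bochner convention, so finiteness need not be settled
    first.\<close>
  also have "\<dots> = enn2real (\<integral>\<^sup>+w. ennreal (h (xieta_vec \<xi> \<eta> ?D w)) \<partial>M)"
    unfolding hX by (rule integral_eq_nn_integral) (measurable, intro AE_I2 mult_nonneg_nonneg f0_nonneg exp_ge_zero)
  also have "\<dots> = enn2real (\<integral>\<^sup>+w. ennreal (pd N x w) \<partial>M)"
    unfolding hX X.nn_integral_exchange_density pd_Z ..
  also have "\<dots> = (\<integral>w. pd N x w \<partial>M)"
    using pdm nn by (intro integral_eq_nn_integral[symmetric]) auto
  finally show ?thesis .
qed

end

lemma density_convergence:
  "\<exists>p. (\<forall>x. 0 \<le> p x) \<and> p \<in> borel_measurable borel \<and>
     distributed M lborel (\<lambda>w. path_value (A.full w) (B.full w) (x0 w)) (\<lambda>x. ennreal (p x)) \<and>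
     (\<forall>N. (\<lambda>x. \<integral>w. pd N x w \<partial>M) \<in> borel_measurable borel) \<and>
     (\<forall>\<rho>. \<exists>c :: nat \<Rightarrow> ennreal. c \<longlonglongrightarrow> 0 \<and>
       (\<forall>N x. \<bar>x\<bar> \<le> \<rho> \<longrightarrow> ennreal \<bar>(\<integral>w. pd N x w \<partial>M) - p x\<bar> \<le> c N))"
proof -
  obtain L where L: "L-lipschitz_on UNIV f\<eta>1" using lipschitz by blast
  obtain A where A: "0 < A" "\<And>j. j \<in> KL_idx na \<Longrightarrow> AE w in M. \<xi> j w \<in> {-A..A}"
    using \<xi>_bounded by blast
  obtain \<kappa> where \<kappa>: "0 \<le> \<kappa>" "AE w in M. \<forall>N. (\<integral>\<^sup>+s. ennreal \<bar>\<alpha> N w s\<bar> \<partial>lborel) \<le> ennreal \<kappa>"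
    using A.trunc_bounded[OF A] by blast
  have F: "f\<eta>1 y \<le> 2 * L + 3" for y
    using distributed_nn_integral[OF f\<eta>1_dens, of "\<lambda>_. 1"] A.emeasure_space_1
    by (intro lipschitz_density_bounded[OF L f\<eta>1_nonneg]) simp
  have [measurable]: "\<eta> 1 \<in> borel_measurable M" by (rule B.\<xi>_measurable[OF one_in_idx])
  have \<beta>m: "(\<lambda>(w,s). \<beta> N w s) \<in> borel_measurable (M \<Otimes>\<^sub>M lborel)" for N
    by (intro B.trunc_measurable B.\<xi>_measurable B.in_idx)
  have \<alpha>m: "(\<lambda>(w,s). \<alpha> N w s) \<in> borel_measurable (M \<Otimes>\<^sub>M lborel)" for N
    by (intro A.trunc_measurable A.\<xi>_measurable A.in_idx)
  note [measurable] = \<beta>m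
  \<comment> \<open>With the constant weight 1, convergence in mean square becomes convergence in
    mean.\<close>
  have En: "(\<lambda>N. \<integral>\<^sup>+w. (\<integral>\<^sup>+s. ennreal \<bar>\<beta> N w s - B.full w s\<bar> \<partial>lborel) \<partial>M) \<longlonglongrightarrow> 0"
    using tendsto_nn_integral_mult_0[of "\<lambda>_. 1" M, OF _ _ _ B.trunc_error_tendsto]
    by (simp add: A.emeasure_space_1)
  have \<beta>_fin: "(\<integral>\<^sup>+s. ennreal \<bar>\<beta> N w s\<bar> \<partial>lborel) < \<infinity>" for N w
    using B.trunc_integrable[of N "\<lambda>i. \<eta> i w"] by (simp add: integrable_iff_bounded)
  show ?thesis
    by (rule limit_density[OF A.prob \<alpha>m A.full_measurable \<beta>m B.full_measurable x0_rv _ q_integrable q_nonneg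
          q_integral_pos L f\<eta>1_nonneg F \<kappa> A.trunc_error_tendsto En B.full_square_integral _ x0_square
          B.\<xi>_square(1)[OF one_in_idx] test_function])
       (fact B.\<xi>_measurable[OF one_in_idx], rule AE_I2, intro allI \<beta>_fin)
qed

end

theorem theorem4:
  fixes M :: "'w measure" and t0 T :: real
    and x0 :: "'w \<Rightarrow> real" and a b :: "real \<Rightarrow> 'w \<Rightarrow> real"
    and na nb :: enat
    and \<nu> \<gamma> :: "nat \<Rightarrow> real" and \<phi> \<psi> :: "nat \<Rightarrow> real \<Rightarrow> real"
    and \<xi> \<eta> :: "nat \<Rightarrow> 'w \<Rightarrow> real"
    and f0 f\<eta>1 :: "real \<Rightarrow> real"
    and g :: "nat \<Rightarrow> ((nat + nat) \<Rightarrow> real) \<Rightarrow> real"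
  assumes prob: "prob_space M" and compl: "complete_measure M"
    and t0T: "t0 < T"
    and x0_rv: "x0 \<in> borel_measurable M"
    \<comment> \<open>Karhunen-Loeve expansions of a and b\<close>
    and KLa: "KL_expansion M t0 T a na \<nu> \<phi> \<xi>"
    and KLb: "KL_expansion M t0 T b nb \<gamma> \<psi> \<eta>"
    and nb1: "1 \<le> nb"
    \<comment> \<open>densities: f0 of x0, f_eta1 of eta_1, g N of (xi_N, eta_N)\<close>
    and f0_nonneg: "\<And>x. 0 \<le> f0 x"
    and f0_dens: "distributed M lborel x0 (\<lambda>x. ennreal (f0 x))"
    and f\<eta>1_nonneg: "\<And>x. 0 \<le> f\<eta>1 x"
    and f\<eta>1_dens: "distributed M lborel (\<eta> 1) (\<lambda>x. ennreal (f\<eta>1 x))"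
    and g_nonneg: "\<And>N z. 0 \<le> g N z"
    and g_dens: "\<And>N. 1 \<le> N \<Longrightarrow> distributed M (RN (idx_full na nb N))
                   (xieta_vec \<xi> \<eta> (idx_full na nb N)) (\<lambda>z. ennreal (g N z))"
    \<comment> \<open>(H1)\<close>
    and H1a: "L2_process M t0 T a" and H1b: "L2_process M t0 T b"
    and H1x0: "integrable M (\<lambda>w. (x0 w)\<^sup>2)"
    \<comment> \<open>(H2)\<close>
    and H2ac: "\<And>N. 1 \<le> N \<Longrightarrow> absolutely_continuous (RN (idx_rest na nb N))
                 (distr M (RN (idx_rest na nb N)) (xieta_vec \<xi> \<eta> (idx_rest na nb N)))"
    and H2ind: "\<And>N. 1 \<le> N \<Longrightarrow> indep3 M lborel x0 lborel (\<eta> 1)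
                 (RN (idx_rest na nb N)) (xieta_vec \<xi> \<eta> (idx_rest na nb N))"
    \<comment> \<open>(H3)\<close>
    and H3: "\<exists>L. L-lipschitz_on UNIV f\<eta>1"
    \<comment> \<open>(H4)\<close>
    and H4: "\<exists>A>0. \<forall>j\<in>KL_idx na. AE w in M. \<xi> j w \<in> {-A..A}"
    and H4\<psi>: "\<forall>t\<in>{t0<..<T}. \<psi> 1 t > 0"
  shows "\<forall>t\<in>{t0<..T}. \<exists>f1 :: real \<Rightarrow> real.
           (\<forall>x. 0 \<le> f1 x) \<and>
           distributed M lborel (\<lambda>w. sol x0 a b t0 t w) (\<lambda>x. ennreal (f1 x)) \<and>
           (\<forall>J. J \<in> sets lborel \<and> bounded J \<longrightarrow>
              (\<lambda>N. esssup lborel (\<lambda>x. ereal (indicator J x *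
                    \<bar>f1N M t0 a b na \<nu> \<phi> nb \<gamma> \<psi> f0 g N x t - f1 x\<bar>))) \<longlonglongrightarrow> 0)"
proof
  fix t assume "t \<in> {t0<..T}"
  then have t: "t0 < t" "t \<le> T" by auto
  interpret E: KL_equation M t0 T t a na \<nu> \<phi> \<xi> b nb \<gamma> \<psi> \<eta> x0 f0 f\<eta>1 g
    by (intro KL_equation.intro KL_process.intro KL_equation_axioms.intro) (fact prob t H1a H1b KLa KLb x0_rv nb1 f0_nonneg f0_dens f\<eta>1_nonneg f\<eta>1_dens
      g_nonneg g_dens H1x0 H2ind H3 H4 H4\<psi>)+
  interpret C: complete_measure M by (rule compl)
  let ?f = "\<lambda>N x. f1N M t0 a b na \<nu> \<phi> nb \<gamma> \<psi> f0 g N x t"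
  let ?X = "\<lambda>w. path_value (E.A.full w) (E.B.full w) (x0 w)"
  obtain p where p: "\<And>x. 0 \<le> p x" and [measurable]: "p \<in> borel_measurable borel"
    and dist: "distributed M lborel ?X (\<lambda>x. ennreal (p x))"
    and fm: "\<And>N. (\<lambda>x. \<integral>w. E.pd N x w \<partial>M) \<in> borel_measurable borel"
    and unif: "\<And>\<rho>. \<exists>c :: nat \<Rightarrow> ennreal. c \<longlonglongrightarrow> 0 \<and>
       (\<forall>N x. \<bar>x\<bar> \<le> \<rho> \<longrightarrow> ennreal \<bar>(\<integral>w. E.pd N x w \<partial>M) - p x\<bar> \<le> c N)"
    using E.density_convergence by blast
  have Xm: "?X \<in> borel_measurable M" using distributed_measurable[OF dist] by simp
  have ae: "AE w in M. ?X w = sol x0 a b t0 t w"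
    using E.AE_full_integrable by eventually_elim (simp add: E.sol_eq_path_value)
  have sm: "(\<lambda>w. sol x0 a b t0 t w) \<in> borel_measurable M"
    by (rule C.borel_measurable_AE_cong[OF Xm ae])
  have "distr M lborel (\<lambda>w. sol x0 a b t0 t w) = distr M lborel ?X"
    using ae sm Xm by (intro distr_cong_AE) auto
  then have sol: "distributed M lborel (\<lambda>w. sol x0 a b t0 t w) (\<lambda>x. ennreal (p x))"
    using dist sm unfolding distributed_def by simp
  have conv: "(\<lambda>N. esssup lborel (\<lambda>x. ereal (indicator J x * \<bar>?f N x - p x\<bar>))) \<longlonglongrightarrow> 0"
    if [measurable]: "J \<in> sets lborel" and J: "bounded J" for J
  proof -
    obtain \<rho> where \<rho>: "\<And>x. x \<in> J \<Longrightarrow> \<bar>x\<bar> \<le> \<rho>" using J by (auto simp: bounded_iff)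
    obtain c :: "nat \<Rightarrow> ennreal" where c: "c \<longlonglongrightarrow> 0"
      "\<And>N x. \<bar>x\<bar> \<le> \<rho> \<Longrightarrow> ennreal \<bar>(\<integral>w. E.pd N x w \<partial>M) - p x\<bar> \<le> c N" using unif[of \<rho>] by blast
    show ?thesis
    proof (rule tendsto_sandwich[where f="\<lambda>_. 0" and h="\<lambda>N. enn2ereal (c N)"])
      show "(\<lambda>N. enn2ereal (c N)) \<longlonglongrightarrow> 0"
        using continuous_on_tendsto_compose[OF continuous_on_enn2ereal c(1)] by (simp add: zero_ennreal.rep_eq)
      \<comment> \<open>\<open>esssup\<close> is \<open>top\<close> for a function that is not
        measurable, so the upper bound depends on this; measurability comes from
        \<open>f1N_eq\<close>, available from \<open>N = 1\<close> on.\<close>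
      have m: "(\<lambda>x. ereal (indicator J x * \<bar>?f N x - p x\<bar>)) \<in> borel_measurable lborel" if "1 \<le> N" for N
        unfolding E.f1N_eq[OF that] using fm[of N] by measurable
      show "\<forall>\<^sub>F N in sequentially. esssup lborel (\<lambda>x. ereal (indicator J x * \<bar>?f N x - p x\<bar>)) \<le> enn2ereal (c N)"
        using eventually_ge_at_top[of 1]
      proof eventually_elim
        case (elim N)
        \<comment> \<open>The estimate holds at every \<open>x\<close>, so it is a genuine supremum
          bound; off \<open>J\<close> the left side is 0.\<close>
        have "ereal (indicator J x * \<bar>?f N x - p x\<bar>) \<le> enn2ereal (c N)" for x
        proof (cases "x \<in> J")
          case True
          have "enn2ereal (ennreal \<bar>?f N x - p x\<bar>) \<le> enn2ereal (c N)"
            using c(2)[OF \<rho>[OF True], of N] unfolding E.f1N_eq[OF elim] by (simp add: less_eq_ennreal.rep_eq)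
          then show ?thesis using True by (simp add: enn2ereal_ennreal)
        qed (simp add: zero_ereal_def[symmetric] enn2ereal_nonneg)
        then show ?case by (intro esssup_I m[OF elim] AE_I2)
      qed
      show "\<forall>\<^sub>F N in sequentially. 0 \<le> esssup lborel (\<lambda>x. ereal (indicator J x * \<bar>?f N x - p x\<bar>))"
      proof (rule always_eventually, rule allI)
        fix N
        have "esssup lborel (\<lambda>x::real. 0::ereal) \<le> esssup lborel (\<lambda>x. ereal (indicator J x * \<bar>?f N x - p x\<bar>))"
          by (rule esssup_mono) (auto simp: zero_ereal_def)
        then show "0 \<le> esssup lborel (\<lambda>x. ereal (indicator J x * \<bar>?f N x - p x\<bar>))"
          by (subst (asm) esssup_const) auto
      qed
    qed simp
  qed
  show "\<exists>f1 :: real \<Rightarrow> real. (\<forall>x. 0 \<le> f1 x) \<and>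
      distributed M lborel (\<lambda>w. sol x0 a b t0 t w) (\<lambda>x. ennreal (f1 x)) \<and>
      (\<forall>J. J \<in> sets lborel \<and> bounded J \<longrightarrow>
         (\<lambda>N. esssup lborel (\<lambda>x. ereal (indicator J x * \<bar>?f N x - f1 x\<bar>))) \<longlonglongrightarrow> 0)"
    using p sol conv by (intro exI[of _ p]) auto
qed

end
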